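(* Let $\alpha>0$, $L>0$, $0<r<s\le 2$, and suppose Assumption (ND) and the right-hand inequality of Assumption (N) hold, i.e. there are $u_0>0$, $b_{\max}>0$, $\gamma'\in\mathbb{R}$ with $|\Phi^\varepsilon(u)|\le b_{\max}|u|^{\gamma'}e^{-\beta|u|^s}$ for $|u|\ge u_0$. Then $$\liminf_{n\to\infty}\inf_{T_n}R_n(x,T_n,\mathcal{A}_{\alpha,r}(L))\,\varphi_n^{-2}\ge 1\quad\text{for all }x\in\mathbb{R},$$ and $$\liminf_{n\to\infty}\inf_{T_n}R_n(\mathbb{L}_2,T_n,\mathcal{A}_{\alpha,r}(L))\,\varphi_n^{-2}(\mathbb{L}_2)\ge 1,$$ where $\inf_{T_n}$ is over all estimators (measurable functions of $Y_1,\dots,Y_n$).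
   Context: Observations $Y_i=X_i+\varepsilon_i$, $i=1,\dots,n$, with $X_i$ i.i.d. with unknown density $f$, $\varepsilon_i$ i.i.d. with known density $f^\varepsilon$ and characteristic function $\Phi^\varepsilon$, independent of the $X_i$. $\Phi^g(u)=\int g(x)e^{ixu}dx$. $\mathcal{A}_{\alpha,r}(L)$ is the set of probability densities $f$ on $\mathbb{R}$ with $\int|\Phi^f(u)|^2e^{2\alpha|u|^r}du\le 2\pi L$. Assumption (ND): there are $u_1>0$, $B>0$, $\gamma_1\in\mathbb{R}$, $\beta>0$, $s>0$ such that $\Phi^\varepsilon$ is twice continuously differentiable for $|u|\ge u_1$ with $\max\{|(\Phi^\varepsilon)'(u)|,|(\Phi^\varepsilon)''(u)|\}\le B|u|^{\gamma_1}e^{-\beta|u|^s}$ there; the same $\beta,s$ appear in the bound on $|\Phi^\varepsilon|$. For $n\ge3$, $h_*$ solves $\frac{2\beta}{h_*^s}+\frac{2\alpha}{h_*^r}=\log n-(\log\log n)^2$; $\varphi_n^2=\frac{L}{2\pi\alpha r}h_*^{r-1}e^{-2\alpha/h_*^r}$, $\varphi_n^2(\mathbb{L}_2)=Le^{-2\alpha/h_*^r}$. Risks: $R_n(x,T_n,\mathcal{A}_{\alpha,r}(L))=\sup_{f\in\mathcal{A}_{\alpha,r}(L)}E_f|T_n(x)-f(x)|^2$, $R_n(\mathbb{L}_2,T_n,\mathcal{A}_{\alpha,r}(L))=\sup_{f\in\mathcal{A}_{\alpha,r}(L)}E_f\|T_n-f\|_2^2$. *)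

theory Defs
  imports "HOL-Probability.Probability" "HOL-Probability.Convolution"
begin

definition is_density :: "(real \<Rightarrow> real) \<Rightarrow> bool" where
  "is_density g \<longleftrightarrow> g \<in> borel_measurable borel \<and> (\<forall>x. 0 \<le> g x)
     \<and> (\<integral>\<^sup>+ x. ennreal (g x) \<partial>lborel) = 1"

definition Phi :: "(real \<Rightarrow> real) \<Rightarrow> real \<Rightarrow> complex" where
  "Phi g u = (\<integral> x. complex_of_real (g x) * cis (x * u) \<partial>lborel)"

text \<open>The class A_{alpha,r}(L); densities are taken in their continuous version
  (every f in the class has integrable Fourier transform, hence a continuous version),
  so that the pointwise value f(x) is meaningful.\<close>
definition A_class :: "real \<Rightarrow> real \<Rightarrow> real \<Rightarrow> (real \<Rightarrow> real) set" where
  "A_class \<alpha> r L = {f. is_density f \<and> continuous_on UNIV f \<and>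
     (\<integral>\<^sup>+ u. ennreal ((cmod (Phi f u))\<^sup>2 * exp (2 * \<alpha> * \<bar>u\<bar> powr r)) \<partial>lborel)
        \<le> ennreal (2 * pi * L)}"

definition law_Y :: "(real \<Rightarrow> real) \<Rightarrow> (real \<Rightarrow> real) \<Rightarrow> real measure" where
  "law_Y f fe = convolution (density lborel f) (density lborel fe)"

definition sample_law :: "nat \<Rightarrow> (real \<Rightarrow> real) \<Rightarrow> (real \<Rightarrow> real) \<Rightarrow> (nat \<Rightarrow> real) measure" where
  "sample_law n f fe = PiM {..<n} (\<lambda>_. law_Y f fe)"

definition pt_estimators :: "nat \<Rightarrow> ((nat \<Rightarrow> real) \<Rightarrow> real) set" where
  "pt_estimators n = borel_measurable (PiM {..<n} (\<lambda>_. borel))"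

definition fun_estimators :: "nat \<Rightarrow> ((nat \<Rightarrow> real) \<Rightarrow> real \<Rightarrow> real) set" where
  "fun_estimators n = {T. case_prod T \<in> borel_measurable (PiM {..<n} (\<lambda>_. borel) \<Otimes>\<^sub>M borel)}"

definition risk_pt :: "nat \<Rightarrow> (real \<Rightarrow> real) \<Rightarrow> real \<Rightarrow> ((nat \<Rightarrow> real) \<Rightarrow> real) \<Rightarrow> (real \<Rightarrow> real) set \<Rightarrow> ennreal" where
  "risk_pt n fe x T \<A> = (SUP f\<in>\<A>. \<integral>\<^sup>+ y. ennreal ((T y - f x)\<^sup>2) \<partial>sample_law n f fe)"

definition risk_L2 :: "nat \<Rightarrow> (real \<Rightarrow> real) \<Rightarrow> ((nat \<Rightarrow> real) \<Rightarrow> real \<Rightarrow> real) \<Rightarrow> (real \<Rightarrow> real) set \<Rightarrow> ennreal" where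
  "risk_L2 n fe T \<A> = (SUP f\<in>\<A>. \<integral>\<^sup>+ y. (\<integral>\<^sup>+ t. ennreal ((T y t - f t)\<^sup>2) \<partial>lborel) \<partial>sample_law n f fe)"

text \<open>Bandwidth h_* (for n >= 3): the unique h > 0 with
  2 beta / h^s + 2 alpha / h^r = log n - (log log n)^2.\<close>
definition h_star :: "real \<Rightarrow> real \<Rightarrow> real \<Rightarrow> real \<Rightarrow> nat \<Rightarrow> real" where
  "h_star \<alpha> \<beta> r s n = (THE h. 0 < h \<and>
     2 * \<beta> / h powr s + 2 * \<alpha> / h powr r = ln (real n) - (ln (ln (real n)))\<^sup>2)"

definition phi2 :: "real \<Rightarrow> real \<Rightarrow> real \<Rightarrow> real \<Rightarrow> real \<Rightarrow> nat \<Rightarrow> real" where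
  "phi2 \<alpha> \<beta> r s L n = (let h = h_star \<alpha> \<beta> r s n in
     L / (2 * pi * \<alpha> * r) * h powr (r - 1) * exp (- 2 * \<alpha> / h powr r))"

definition phi2_L2 :: "real \<Rightarrow> real \<Rightarrow> real \<Rightarrow> real \<Rightarrow> real \<Rightarrow> nat \<Rightarrow> real" where
  "phi2_L2 \<alpha> \<beta> r s L n = (let h = h_star \<alpha> \<beta> r s n in L * exp (- 2 * \<alpha> / h powr r))"

end

theory Submission
  imports Defs "HOL-Real_Asymp.Real_Asymp"
begin

text \<open>
  Two hypotheses \<^term>\<open>f0 + g\<close> and \<^term>\<open>f0 - g\<close>, both in the class, whose \<open>n\<close>-sample laws are
  asymptotically indistinguishable force the risk to be at least \<open>(1 - o(1)) g(x)\<^sup>2\<close>.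
  The Fourier transform of \<open>g\<close> lives just beyond the frequency \<open>U = 1/h\<^sub>*\<close>, on the scale
  \<open>U powr (1 - r)\<close> on which \<open>exp (2 \<alpha> |u| powr r)\<close> varies. Moving the edge of the support from \<open>U\<close> to
  \<open>U + \<eta> U powr (1 - r)\<close> changes \<open>exp (- 2 \<alpha> U powr r)\<close> only by a factor close to 1, but since \<open>r < s\<close> it lowers
  \<open>exp (- 2 \<beta> U powr s)\<close> by \<open>exp (- c U powr (s - r))\<close>; this beats both the polynomial factors and the
  \<open>(log log n)\<^sup>2\<close> in the definition of \<open>h\<^sub>*\<close>, so that \<open>n\<close> times the chi-square distance vanishes.
  For the pointwise risk the profile of the transform approximates the exponential that is extremal in
  Cauchy-Schwarz; for the \<open>L\<^sub>2\<close> risk it is concentrated at the edge of the support.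

  All functions are combinations of modulated Fejer kernels, whose transforms are tent functions. Thus both
  directions of every Fourier transform are explicit and no general inversion theorem is needed.
\<close>

section \<open>Fourier pairs\<close>

text \<open>Both rates solve an extremal problem. If \<open>g\<close> is real, its transform
  vanishes on [-U, U] and its weighted energy is at most 2 pi L, Cauchy-Schwarz bounds g(x)^2 by L /
  (2 pi) times the integral of exp (-2 \<alpha> |u|^r) over |u| > U, which is asymptotic to L / (2
  pi \<alpha> r) U^(1 - r) exp (-2 \<alpha> U^r); Plancherel bounds the squared norm by L exp (-2
  \<alpha> U^r). The constant 1 requires approaching these values, so the central density
  \<open>f0\<close> may consume only a vanishing share of the energy: its transform lives on a short
  interval [-a, a], disjoint from that of \<open>g\<close>. Two demands shape the rest.
  Nonnegativity of both hypotheses forces \<open>f0\<close> to dominate the quadratically decaying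
  Fejer kernels in \<open>g\<close>, so \<open>f0\<close> must not decay faster than 1 / t^2. The
  chi-square distance divides by the observed density, which is only known to be at least of order 1
  / (1 + y^2), so the noisy perturbation is measured with weight 1 + y^2. On the Fourier side this
  weight costs one derivative, and there the bound on the derivative of the noise characteristic
  function enters.\<close>

definition tent :: "real \<Rightarrow> real" where
  "tent u = max 0 (1 - \<bar>u\<bar>)"

definition fejer :: "real \<Rightarrow> real" where
  "fejer x = (if x = 0 then 1 / (2 * pi) else (1 - cos x) / (pi * x\<^sup>2))"

definition fourier_pair :: "(real \<Rightarrow> complex) \<Rightarrow> (real \<Rightarrow> complex) \<Rightarrow> bool" where
  "fourier_pair p P \<longleftrightarrow> integrable lborel p \<and> integrable lborel P \<and>
     (\<forall>u. P u = (\<integral>y. p y * cis (y * u) \<partial>lborel)) \<and>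
     (\<forall>y. p y = 1 / (2 * pi) * (\<integral>u. P u * cis (- (u * y)) \<partial>lborel))"

lemma measurable_cis [measurable]: "cis \<in> borel_measurable borel"
  by (intro borel_measurable_continuous_onI continuous_intros)

lemma measurable_cnj [measurable]: "cnj \<in> borel_measurable borel"
  by (intro borel_measurable_continuous_onI continuous_intros)

lemma integrable_mult_cis:
  assumes "integrable lborel (p :: real \<Rightarrow> complex)" and [measurable]: "h \<in> borel_measurable borel"
  shows "integrable lborel (\<lambda>y. p y * cis (h y))"
proof -
  have [measurable]: "p \<in> borel_measurable borel" using assms(1) by auto
  show ?thesis
    by (rule Bochner_Integration.integrable_bound[OF assms(1)]) (auto simp: norm_mult)
qed

lemma integral_even_cis:
  fixes p :: "real \<Rightarrow> real"
  assumes p: "integrable lborel p" and even: "\<And>x. p (- x) = p x"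
  shows "(\<integral>x. complex_of_real (p x) * cis (x * u) \<partial>lborel) = complex_of_real (\<integral>x. p x * cos (x * u) \<partial>lborel)"
proof -
  let ?p = "\<lambda>x. complex_of_real (p x)"
  have i: "integrable lborel ?p" using p by simp
  have 1: "(\<integral>x. ?p x * cis (x * u) \<partial>lborel) = (\<integral>x. ?p x * cis (- (x * u)) \<partial>lborel)"
    using lborel_integral_real_affine[of "-1" "\<lambda>x. ?p x * cis (x * u)" 0] by (simp add: even)
  have "2 * (\<integral>x. ?p x * cis (x * u) \<partial>lborel) = (\<integral>x. ?p x * cis (x * u) \<partial>lborel) + (\<integral>x. ?p x * cis (- (x * u)) \<partial>lborel)"
    using 1 by simp
  also have "\<dots> = (\<integral>x. ?p x * cis (x * u) + ?p x * cis (- (x * u)) \<partial>lborel)"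
    by (rule Bochner_Integration.integral_add[symmetric]) (auto intro!: integrable_mult_cis i)
  also have "\<dots> = (\<integral>x. 2 * complex_of_real (p x * cos (x * u)) \<partial>lborel)"
    by (intro Bochner_Integration.integral_cong refl) (simp add: complex_eq_iff algebra_simps)
  also have "\<dots> = 2 * complex_of_real (\<integral>x. p x * cos (x * u) \<partial>lborel)"
    by (simp only: integral_mult_right_zero integral_complex_of_real)
  finally show ?thesis by simp
qed

section \<open>The tent and the Fejer kernel as transforms of each other\<close>

lemma tent_simps: "0 \<le> tent u" "tent u \<le> 1" "tent (- u) = tent u" "tent 0 = 1"
  by (auto simp: tent_def)

lemma tent_eq_0: "1 \<le> \<bar>u\<bar> \<Longrightarrow> tent u = 0"
  by (auto simp: tent_def)

lemma continuous_on_tent [continuous_intros]: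
  "continuous_on S f \<Longrightarrow> continuous_on S (\<lambda>x. tent (f x))"
  unfolding tent_def by (intro continuous_intros)

lemma measurable_tent [measurable]: "tent \<in> borel_measurable borel"
  by (intro borel_measurable_continuous_onI continuous_intros)

lemma tent_lipschitz: "\<bar>tent u - tent v\<bar> \<le> \<bar>u - v\<bar>"
  by (auto simp: tent_def)

lemma has_integral_tent_cos:
  "has_bochner_integral lborel (\<lambda>u. tent u * cos (u * x)) (2 * pi * fejer x)"
proof -
  \<comment> \<open>Antiderivatives for the falling and the rising slope of the tent. Integration by
    parts divides by \<open>x\<close>, hence the separate branch at 0.\<close>
  let ?F = "\<lambda>u::real. if x = 0 then u - u\<^sup>2 / 2 else (1 - u) * sin (u * x) / x - cos (u * x) / x\<^sup>2"
  let ?G = "\<lambda>u::real. if x = 0 then u + u\<^sup>2 / 2 else (1 + u) * sin (u * x) / x + cos (u * x) / x\<^sup>2"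
  have dF: "(?F has_real_derivative (1 - u) * cos (u * x)) (at u within S)" for u S
    by (cases "x = 0") (auto intro!: derivative_eq_intros simp: power2_eq_square field_simps)
  have dG: "(?G has_real_derivative (1 + u) * cos (u * x)) (at u within S)" for u S
    by (cases "x = 0") (auto intro!: derivative_eq_intros simp: power2_eq_square field_simps)
  have 1: "has_bochner_integral lborel (\<lambda>u. indicator {0..1} u *\<^sub>R ((1 - u) * cos (u * x))) (?F 1 - ?F 0)"
    by (rule has_bochner_integral_FTC_Icc)
       (use dF in \<open>auto intro!: continuous_intros simp: has_real_derivative_iff_has_vector_derivative\<close>)
  have 2: "has_bochner_integral lborel (\<lambda>u. indicator {-1..0} u *\<^sub>R ((1 + u) * cos (u * x))) (?G 0 - ?G (-1))"
    by (rule has_bochner_integral_FTC_Icc)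
       (use dG in \<open>auto intro!: continuous_intros simp: has_real_derivative_iff_has_vector_derivative\<close>)
  have "has_bochner_integral lborel (\<lambda>u. tent u * cos (u * x)) ((?F 1 - ?F 0) + (?G 0 - ?G (-1)))"
  proof (rule has_bochner_integral_cong_AE[THEN iffD1, OF _ _ _ has_bochner_integral_add[OF 1 2]])
    show "AE u in lborel. indicator {0..1} u *\<^sub>R ((1 - u) * cos (u * x)) + indicator {-1..0} u *\<^sub>R ((1 + u) * cos (u * x))
        = tent u * cos (u * x)"
      using AE_lborel_singleton[of "0::real"] by eventually_elim (auto simp: tent_def split: split_indicator)
  qed auto
  also have "(?F 1 - ?F 0) + (?G 0 - ?G (-1)) = 2 * pi * fejer x"
    by (auto simp: fejer_def field_simps power2_eq_square)
  finally show ?thesis .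
qed

lemma one_minus_cos_eq: "1 - cos x = 2 * (sin (x / 2))\<^sup>2" for x :: real
  using cos_double_sin[of "x / 2"] by simp

lemma fejer_sinc: "fejer x = (sinc (x / 2))\<^sup>2 / (2 * pi)"
  by (auto simp: fejer_def one_minus_cos_eq field_simps power2_eq_square)

lemma continuous_on_fejer [continuous_intros]:
  "continuous_on S f \<Longrightarrow> continuous_on S (\<lambda>x. fejer (f x))"
  unfolding fejer_sinc by (intro continuous_intros continuous_on_sinc) auto

lemma measurable_fejer [measurable]: "fejer \<in> borel_measurable borel"
  by (intro borel_measurable_continuous_onI continuous_intros)

lemma fejer_nonneg: "0 \<le> fejer x"
  by (simp add: fejer_sinc del: sinc_neg)

lemma fejer_even: "fejer (- x) = fejer x"
  by (simp add: fejer_def)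

text \<open>Integrating (1 - cos x) / x^2 by parts leaves the sine integral: an antiderivative is
  (Si x - (1 - cos x) / x) / pi. The limit pi / 2 of \<open>Si\<close> gives mass 1/2 on the
  half-line, and evenness doubles it.\<close>

lemma has_integral_fejer: "has_bochner_integral lborel fejer 1"
proof -
  let ?F = "\<lambda>x. (Si x - x * (pi * fejer x)) / pi"
  have der: "(?F has_real_derivative fejer x) (at x)" for x
  proof (cases "x = 0")
    case True
    have "isCont (\<lambda>x. pi * fejer x) 0"
      using continuous_on_fejer[OF continuous_on_id, of UNIV]
      by (intro continuous_intros) (auto simp: continuous_on_eq_continuous_at)
    \<comment> \<open>Caratheodory's criterion: x times a function continuous at 0 is differentiable
      at 0, so \<open>fejer\<close> itself need not be differentiated.\<close>
    then have "((\<lambda>x. x * (pi * fejer x)) has_real_derivative pi * fejer 0) (at 0)"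
      by (auto simp: CARAT_DERIV intro!: exI[of _ "\<lambda>x. pi * fejer x"])
    from DERIV_cdivide[OF DERIV_diff[OF DERIV_Si[of 0] this], of pi]
    have "(?F has_real_derivative (1 - pi * fejer 0) / pi) (at 0)" by simp
    then show ?thesis using True by (simp add: fejer_def field_simps)
  next
    case False
    have "((\<lambda>x. (Si x - (1 - cos x) / x) / pi) has_real_derivative fejer x) (at x)"
      using False by (auto intro!: derivative_eq_intros DERIV_Si simp: fejer_def field_simps power2_eq_square)
    moreover have "eventually (\<lambda>y. (Si y - (1 - cos y) / y) / pi = ?F y) (nhds x)"
      using t1_space_nhds[OF False] by eventually_elim (auto simp: fejer_def power2_eq_square)
    ultimately show ?thesis by (simp add: DERIV_cong_ev)
  qed
  have lim: "(?F \<longlongrightarrow> 1 / 2) at_top"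
  proof -
    have "((\<lambda>x::real. (1 - cos x) / x) \<longlongrightarrow> 0) at_top" by real_asymp
    from tendsto_divide[OF tendsto_diff[OF Si_at_top this] tendsto_const[of pi]]
    have "((\<lambda>x. (Si x - (1 - cos x) / x) / pi) \<longlongrightarrow> 1 / 2) at_top" by simp
    then show ?thesis
      by (rule Lim_transform_eventually)
         (use eventually_gt_at_top[of "0::real"] in \<open>eventually_elim, auto simp: fejer_def power2_eq_square\<close>)
  qed
  have nn: "(\<integral>\<^sup>+x. ennreal (fejer x) * indicator {0..} x \<partial>lborel) = ennreal (1 / 2 - ?F 0)"
    by (rule nn_integral_FTC_atLeast[OF _ der _ lim]) (auto simp: fejer_nonneg)
  have half: "(\<integral>\<^sup>+x. ennreal (fejer x) * indicator {0..} x \<partial>lborel) = ennreal (1 / 2)"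
  proof -
    have "Si 0 = 0" by (simp add: Si_def zero_ereal_def)
    then show ?thesis unfolding nn by simp
  qed
  have "(\<integral>\<^sup>+x. ennreal (fejer x) * indicator {..0} x \<partial>lborel) = (\<integral>\<^sup>+x. ennreal (fejer x) * indicator {0..} x \<partial>lborel)"
    using nn_integral_real_affine[of "\<lambda>x. ennreal (fejer x) * indicator {..0} x" "-1" 0]
    by (auto simp: fejer_even indicator_def intro!: nn_integral_cong)
  have "(\<integral>\<^sup>+x. ennreal (fejer x) \<partial>lborel)
      = (\<integral>\<^sup>+x. ennreal (fejer x) * indicator {0..} x + ennreal (fejer x) * indicator {..0} x \<partial>lborel)"
    by (rule nn_integral_cong_AE, use AE_lborel_singleton[of "0::real"] in eventually_elim)
       (auto split: split_indicator)
  also have "\<dots> = ennreal (1 / 2) + ennreal (1 / 2)"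
    by (subst nn_integral_add) (simp_all add: half \<open>_ = (\<integral>\<^sup>+x. ennreal (fejer x) * indicator {0..} x \<partial>lborel)\<close>)
  also have "\<dots> = ennreal 1" by (subst ennreal_plus[symmetric]) auto
  finally show ?thesis
    by (intro has_bochner_integral_nn_integral) (auto simp: fejer_nonneg)
qed

lemma has_integral_one_minus_cos:
  "has_bochner_integral lborel (\<lambda>x. (1 - cos (x * u)) / x\<^sup>2) (pi * \<bar>u\<bar>)"
proof (cases "u = 0")
  case False
  have "has_bochner_integral lborel (\<lambda>x. pi * u\<^sup>2 * fejer (0 + u * x)) (pi * u\<^sup>2 * (1 /\<^sub>R \<bar>u\<bar>))"
    by (intro has_bochner_integral_mult_right lborel_has_bochner_integral_real_affine_iff[THEN iffD1] has_integral_fejer False)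
  also have "pi * u\<^sup>2 * (1 /\<^sub>R \<bar>u\<bar>) = pi * \<bar>u\<bar>"
    using False by (auto simp: power2_eq_square field_simps)
  finally show ?thesis
  proof (rule has_bochner_integral_cong_AE[THEN iffD1, rotated -1])
    show "AE x in lborel. pi * u\<^sup>2 * fejer (0 + u * x) = (1 - cos (x * u)) / x\<^sup>2"
      using AE_lborel_singleton[of "0::real"]
      by eventually_elim (use False in \<open>auto simp: fejer_def power_mult_distrib mult.commute\<close>)
  qed auto
qed (simp add: has_bochner_integral_zero)

text \<open>By the product formula for cosines, \<open>fejer x * cos (x * u)\<close> is a second
  difference in \<open>u\<close> of (1 - cos (x u)) / x^2, whose integral is pi |u|. The tent is the
  corresponding second difference of |u|.\<close>

lemma has_integral_fejer_cos:
  "has_bochner_integral lborel (\<lambda>x. fejer x * cos (x * u)) (tent u)"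
proof -
  have "has_bochner_integral lborel (\<lambda>x. 1 / (2 * pi) * ((1 - cos (x * (1 + u))) / x\<^sup>2 + (1 - cos (x * (1 - u))) / x\<^sup>2
      - 2 * ((1 - cos (x * u)) / x\<^sup>2))) (1 / (2 * pi) * (pi * \<bar>1 + u\<bar> + pi * \<bar>1 - u\<bar> - 2 * (pi * \<bar>u\<bar>)))"
    by (intro has_bochner_integral_mult_right has_bochner_integral_diff has_bochner_integral_add has_integral_one_minus_cos)
  also have "1 / (2 * pi) * (pi * \<bar>1 + u\<bar> + pi * \<bar>1 - u\<bar> - 2 * (pi * \<bar>u\<bar>)) = (\<bar>1 + u\<bar> + \<bar>1 - u\<bar> - 2 * \<bar>u\<bar>) / 2"
    by (simp add: field_simps)
  also have "\<dots> = tent u" by (simp add: tent_def max_def abs_if)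
  finally show ?thesis
  proof (rule has_bochner_integral_cong_AE[THEN iffD1, rotated -1])
    show "AE x in lborel. 1 / (2 * pi) * ((1 - cos (x * (1 + u))) / x\<^sup>2 + (1 - cos (x * (1 - u))) / x\<^sup>2
      - 2 * ((1 - cos (x * u)) / x\<^sup>2)) = fejer x * cos (x * u)"
      using AE_lborel_singleton[of "0::real"]
    proof eventually_elim
      case (elim x)
      have "cos (x * (1 + u)) + cos (x * (1 - u)) = 2 * cos x * cos (x * u)"
        by (simp add: algebra_simps cos_add cos_diff)
      then have "(1 - cos (x * (1 + u))) + (1 - cos (x * (1 - u))) - 2 * (1 - cos (x * u)) = 2 * ((1 - cos x) * cos (x * u))"
        by (simp add: algebra_simps)
      then show ?case using elim
        by (simp add: fejer_def add_divide_distrib[symmetric] diff_divide_distrib[symmetric])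
    qed
  qed auto
qed

lemma fourier_pair_fejer: "fourier_pair (\<lambda>x. complex_of_real (fejer x)) (\<lambda>u. complex_of_real (tent u))"
  unfolding fourier_pair_def
proof (intro conjI allI)
  have t: "integrable lborel tent" using has_integral_tent_cos[of 0] by (auto simp: has_bochner_integral_iff)
  have f: "integrable lborel fejer" using has_integral_fejer by (auto simp: has_bochner_integral_iff)
  show "integrable lborel (\<lambda>x. complex_of_real (fejer x))" "integrable lborel (\<lambda>u. complex_of_real (tent u))"
    using t f by simp_all
  show "complex_of_real (tent u) = (\<integral>y. complex_of_real (fejer y) * cis (y * u) \<partial>lborel)" for u
    using has_integral_fejer_cos[of u] by (simp add: integral_even_cis[OF f fejer_even] has_bochner_integral_iff)
  show "complex_of_real (fejer y) = 1 / (2 * pi) * (\<integral>u. complex_of_real (tent u) * cis (- (u * y)) \<partial>lborel)" for y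
    using has_integral_tent_cos[of y] integral_even_cis[OF t tent_simps(3), of "- y"]
    by (simp add: has_bochner_integral_iff)
qed



section \<open>Operations on Fourier pairs and the Plancherel identity\<close>

lemma fourier_pairD:
  fixes p P :: "real \<Rightarrow> complex"
  assumes "fourier_pair p P"
  shows "integrable lborel p" "integrable lborel P"
    "(\<integral>y. p y * cis (y * u) \<partial>lborel) = P u"
    "(\<integral>u. P u * cis (- (u * y)) \<partial>lborel) = 2 * pi * p y"
proof -
  note * = assms[unfolded fourier_pair_def]
  show "integrable lborel p" "integrable lborel P"
    using * by blast+
  show "(\<integral>y. p y * cis (y * u) \<partial>lborel) = P u"
    by (rule sym) (rule *[THEN conjunct2, THEN conjunct2, THEN conjunct1, rule_format])
  have "p y = 1 / (2 * pi) * (\<integral>u. P u * cis (- (u * y)) \<partial>lborel)"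
    by (rule *[THEN conjunct2, THEN conjunct2, THEN conjunct2, rule_format])
  then show "(\<integral>u. P u * cis (- (u * y)) \<partial>lborel) = 2 * pi * p y"
    by (rule ssubst) simp
qed

lemma fourier_pairI:
  fixes p P :: "real \<Rightarrow> complex"
  assumes "integrable lborel p" "integrable lborel P"
    "\<And>u. (\<integral>y. p y * cis (y * u) \<partial>lborel) = P u"
    "\<And>y. (\<integral>u. P u * cis (- (u * y)) \<partial>lborel) = 2 * pi * p y"
  shows "fourier_pair p P"
  unfolding fourier_pair_def by (simp add: assms)

lemma fourier_pair_cmult:
  fixes p P :: "real \<Rightarrow> complex" and c :: complex
  assumes "fourier_pair p P"
  shows "fourier_pair (\<lambda>y. c * p y) (\<lambda>u. c * P u)"
  by (rule fourier_pairI) (simp_all add: fourier_pairD[OF assms] mult.assoc)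

lemma fourier_pair_add:
  fixes p P :: "real \<Rightarrow> complex"
  assumes "fourier_pair p P" "fourier_pair q Q"
  shows "fourier_pair (\<lambda>y. p y + q y) (\<lambda>u. P u + Q u)"
proof (rule fourier_pairI)
  note D = fourier_pairD[OF assms(1)] fourier_pairD[OF assms(2)]
  show "(\<integral>y. (p y + q y) * cis (y * u) \<partial>lborel) = P u + Q u" for u
    unfolding distrib_right by (subst Bochner_Integration.integral_add) (simp_all add: D integrable_mult_cis)
  show "(\<integral>u. (P u + Q u) * cis (- (u * y)) \<partial>lborel) = 2 * pi * (p y + q y)" for y
    unfolding distrib_right
    by (subst Bochner_Integration.integral_add) (simp_all add: D integrable_mult_cis distrib_left)
qed (simp_all add: assms[THEN fourier_pairD(1)] assms[THEN fourier_pairD(2)])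

lemma fourier_pair_sum:
  assumes "finite A" "\<And>k. k \<in> A \<Longrightarrow> fourier_pair (p k) (P k)"
  shows "fourier_pair (\<lambda>y. \<Sum>k\<in>A. p k y) (\<lambda>u. \<Sum>k\<in>A. P k u)"
  using assms
proof (induction A rule: finite_induct)
  case empty
  then show ?case by (simp add: fourier_pair_def)
next
  case (insert k A)
  then show ?case using fourier_pair_add[of "p k" "P k"] by simp
qed

lemma fourier_pair_modulate:
  fixes p P :: "real \<Rightarrow> complex"
  assumes "fourier_pair p P"
  shows "fourier_pair (\<lambda>y. p y * cis (w * y)) (\<lambda>u. P (u + w))"
proof (rule fourier_pairI)
  note D = fourier_pairD[OF assms]
  show "integrable lborel (\<lambda>y. p y * cis (w * y))" by (intro integrable_mult_cis D) simp
  show "integrable lborel (\<lambda>u. P (u + w))"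
    using lborel_integrable_real_affine[OF D(2), of 1 w] by (simp add: add.commute)
  show "(\<integral>y. p y * cis (w * y) * cis (y * u) \<partial>lborel) = P (u + w)" for u
    unfolding D(3)[symmetric] by (simp add: cis_mult mult.assoc algebra_simps)
  show "(\<integral>u. P (u + w) * cis (- (u * y)) \<partial>lborel) = 2 * pi * (p y * cis (w * y))" for y
  proof -
    have "(\<integral>u. P u * cis (- (u * y)) * cis (w * y) \<partial>lborel) = (\<integral>u. P (u + w) * cis (- (u * y)) \<partial>lborel)"
      by (subst lborel_integral_real_affine[of 1 _ w], simp)
         (simp only: abs_one scaleR_one mult_1, intro Bochner_Integration.integral_cong refl,
          simp add: mult.assoc cis_mult algebra_simps)
    then have "2 * pi * p y * cis (w * y) = (\<integral>u. P (u + w) * cis (- (u * y)) \<partial>lborel)" by (simp add: D)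
    then show ?thesis by (simp only: mult.assoc)
  qed
qed

lemma fourier_pair_dilate:
  fixes p P :: "real \<Rightarrow> complex"
  assumes "fourier_pair p P" and d: "0 < d"
  shows "fourier_pair (\<lambda>y. d * p (d * y)) (\<lambda>u. P (u / d))"
proof (rule fourier_pairI)
  note D = fourier_pairD[OF assms(1)]
  show "integrable lborel (\<lambda>u. P (u / d))"
    using lborel_integrable_real_affine[OF D(2), of "1 / d" 0] d by simp
  show "integrable lborel (\<lambda>u. d * p (d * u))"
    using lborel_integrable_real_affine[OF D(1), of d 0] d by simp
  show "(\<integral>y. d * p (d * y) * cis (y * u) \<partial>lborel) = P (u / d)" for u
    unfolding D(3)[symmetric]
    using d lborel_integral_real_affine[of d "\<lambda>y. p y * cis (y * (u / d))" 0]
    by (simp add: mult.assoc scaleR_conv_of_real)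
  show "(\<integral>u. P (u / d) * cis (- (u * y)) \<partial>lborel) = 2 * pi * (d * p (d * y))" for y
  proof -
    have "(\<integral>u. P (u / d) * cis (- (u * y)) \<partial>lborel) = d * (\<integral>u. P u * cis (- (u * (d * y))) \<partial>lborel)"
      using d lborel_integral_real_affine[of d "\<lambda>u. P (u / d) * cis (- (u * y))" 0]
      by (simp add: mult_ac scaleR_conv_of_real)
    then show ?thesis unfolding D by simp
  qed
qed

lemma fourier_pair_translate:
  fixes p P :: "real \<Rightarrow> complex"
  assumes "fourier_pair p P"
  shows "fourier_pair (\<lambda>y. p (y - x)) (\<lambda>u. cis (x * u) * P u)"
proof (rule fourier_pairI)
  note D = fourier_pairD[OF assms]
  show "integrable lborel (\<lambda>y. p (y - x))"
    using lborel_integrable_real_affine[OF D(1), of 1 "- x"] by simp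
  show "integrable lborel (\<lambda>u. cis (x * u) * P u)"
    using integrable_mult_cis[OF D(2), of "\<lambda>u. x * u"] by (simp add: mult.commute)
  show "(\<integral>y. p (y - x) * cis (y * u) \<partial>lborel) = cis (x * u) * P u" for u
  proof -
    have "(\<integral>y. p (y - x) * cis (y * u) \<partial>lborel) = (\<integral>y. cis (x * u) * (p y * cis (y * u)) \<partial>lborel)"
      by (subst lborel_integral_real_affine[of 1 _ x], simp)
         (simp only: abs_one scaleR_one mult_1, intro Bochner_Integration.integral_cong refl,
          simp add: mult.left_commute[of "cis _" "p _"] cis_mult algebra_simps)
    then show ?thesis by (simp add: D)
  qed
  show "(\<integral>u. cis (x * u) * P u * cis (- (u * y)) \<partial>lborel) = 2 * pi * p (y - x)" for y
  proof -
    have "(\<integral>u. cis (x * u) * P u * cis (- (u * y)) \<partial>lborel) = (\<integral>u. P u * cis (- (u * (y - x))) \<partial>lborel)"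
      by (intro Bochner_Integration.integral_cong refl)
         (simp add: mult.assoc mult.left_commute[of _ "P _"] cis_mult algebra_simps)
    then show ?thesis unfolding D .
  qed
qed

lemma fourier_pair_bounded:
  fixes p P :: "real \<Rightarrow> complex"
  assumes "fourier_pair p P"
  shows "cmod (P u) \<le> (\<integral>y. cmod (p y) \<partial>lborel)" "cmod (p y) \<le> 1 / (2 * pi) * (\<integral>u. cmod (P u) \<partial>lborel)"
proof -
  note D = fourier_pairD[OF assms]
  have "cmod (\<integral>y. p y * cis (y * u) \<partial>lborel) \<le> (\<integral>y. cmod (p y * cis (y * u)) \<partial>lborel)"
    by (rule integral_norm_bound)
  then show "cmod (P u) \<le> (\<integral>y. cmod (p y) \<partial>lborel)"
    unfolding D by (simp add: norm_mult)
  have "cmod (\<integral>u. P u * cis (- (u * y)) \<partial>lborel) \<le> (\<integral>u. cmod (P u * cis (- (u * y))) \<partial>lborel)"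
    by (rule integral_norm_bound)
  then show "cmod (p y) \<le> 1 / (2 * pi) * (\<integral>u. cmod (P u) \<partial>lborel)"
    unfolding D by (simp add: norm_mult field_simps)
qed

lemma integrable_square_of_bounded:
  fixes p :: "real \<Rightarrow> complex"
  assumes p: "integrable lborel p" and bd: "\<And>y. cmod (p y) \<le> C"
  shows "integrable lborel (\<lambda>y. (cmod (p y))\<^sup>2)"
proof -
  have [measurable]: "p \<in> borel_measurable borel" using p by auto
  have "integrable lborel (\<lambda>y. C * cmod (p y))" using p by simp
  then show ?thesis
    by (rule Bochner_Integration.integrable_bound)
       (auto simp: power2_eq_square abs_mult intro!: AE_I2 mult_right_mono order_trans[OF bd abs_ge_self])
qed

text \<open>Substitute the inversion formula for the conjugate of \<open>p y\<close> and exchange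
  the integrals. Integrability of both members of the pair makes the double integral absolutely
  convergent, and each member is bounded by the norm of the other, hence square integrable.\<close>

theorem fourier_pair_plancherel:
  fixes p P :: "real \<Rightarrow> complex"
  assumes "fourier_pair p P"
  shows "integrable lborel (\<lambda>y. (cmod (p y))\<^sup>2)" "integrable lborel (\<lambda>u. (cmod (P u))\<^sup>2)"
    "(\<integral>y. (cmod (p y))\<^sup>2 \<partial>lborel) = 1 / (2 * pi) * (\<integral>u. (cmod (P u))\<^sup>2 \<partial>lborel)"
proof -
  note D = fourier_pairD[OF assms]
  note i = D(1,2)
  have [measurable]: "p \<in> borel_measurable borel" "P \<in> borel_measurable borel"
    using i by auto
  show "integrable lborel (\<lambda>y. (cmod (p y))\<^sup>2)" "integrable lborel (\<lambda>u. (cmod (P u))\<^sup>2)"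
    using integrable_square_of_bounded[OF i(1) fourier_pair_bounded(2)[OF assms]]
      integrable_square_of_bounded[OF i(2) fourier_pair_bounded(1)[OF assms]] by auto
  have int2: "integrable (lborel \<Otimes>\<^sub>M lborel) (\<lambda>(y, u). p y * (cnj (P u) * cis (y * u)))"
  proof (rule lborel_pair.Fubini_integrable)
    show "integrable lborel (\<lambda>y. \<integral>u. cmod (case (y, u) of (y, u) \<Rightarrow> p y * (cnj (P u) * cis (y * u))) \<partial>lborel)"
      using i by (simp add: norm_mult)
    show "AE y in lborel. integrable lborel (\<lambda>u. case (y, u) of (y, u) \<Rightarrow> p y * (cnj (P u) * cis (y * u)))"
      using i by (simp add: integrable_mult_cis)
  qed measurable
  have cn: "cnj (p y) = 1 / (2 * pi) * (\<integral>u. cnj (P u) * cis (y * u) \<partial>lborel)" for y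
  proof -
    have "cnj (\<integral>u. P u * cis (- (u * y)) \<partial>lborel) = (\<integral>u. cnj (P u) * cis (y * u) \<partial>lborel)"
      by (subst Bochner_Integration.integral_cnj[symmetric]) (simp add: cis_cnj mult.commute)
    then have "(\<integral>u. cnj (P u) * cis (y * u) \<partial>lborel) = 2 * pi * cnj (p y)"
      unfolding D by simp
    then show ?thesis by simp
  qed
  have "complex_of_real (\<integral>y. (cmod (p y))\<^sup>2 \<partial>lborel) = (\<integral>y. p y * cnj (p y) \<partial>lborel)"
    by (simp only: complex_norm_square[symmetric] integral_complex_of_real)
  also have "\<dots> = (\<integral>y. 1 / (2 * pi) * (\<integral>u. p y * (cnj (P u) * cis (y * u)) \<partial>lborel) \<partial>lborel)"
    by (simp add: cn)
  also have "\<dots> = 1 / (2 * pi) * (\<integral>y. (\<integral>u. p y * (cnj (P u) * cis (y * u)) \<partial>lborel) \<partial>lborel)"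
    by (rule integral_mult_right_zero)
  also have "(\<integral>y. (\<integral>u. p y * (cnj (P u) * cis (y * u)) \<partial>lborel) \<partial>lborel)
      = (\<integral>u. (\<integral>y. p y * (cnj (P u) * cis (y * u)) \<partial>lborel) \<partial>lborel)"
    using lborel_pair.Fubini_integral[OF int2] by simp
  also have "\<dots> = (\<integral>u. P u * cnj (P u) \<partial>lborel)"
  proof (intro Bochner_Integration.integral_cong refl)
    fix u
    have "(\<integral>y. p y * (cnj (P u) * cis (y * u)) \<partial>lborel) = (\<integral>y. cnj (P u) * (p y * cis (y * u)) \<partial>lborel)"
      by (simp add: mult_ac)
    then show "(\<integral>y. p y * (cnj (P u) * cis (y * u)) \<partial>lborel) = P u * cnj (P u)"
      by (simp add: D)
  qed
  also have "\<dots> = complex_of_real (\<integral>u. (cmod (P u))\<^sup>2 \<partial>lborel)"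
    by (simp only: complex_norm_square[symmetric] integral_complex_of_real)
  finally have "complex_of_real (\<integral>y. (cmod (p y))\<^sup>2 \<partial>lborel) = complex_of_real (1 / (2 * pi) * (\<integral>u. (cmod (P u))\<^sup>2 \<partial>lborel))"
    by simp
  then show "(\<integral>y. (cmod (p y))\<^sup>2 \<partial>lborel) = 1 / (2 * pi) * (\<integral>u. (cmod (P u))\<^sup>2 \<partial>lborel)"
    by (simp only: of_real_eq_iff)
qed


section \<open>Characteristic functions and convolution with the noise\<close>

lemma is_densityD:
  assumes "is_density fe"
  shows "fe \<in> borel_measurable borel" "0 \<le> fe x" "integrable lborel fe" "(\<integral>x. fe x \<partial>lborel) = 1"
proof -
  show m: "fe \<in> borel_measurable borel" and p: "0 \<le> fe x" for x
    using assms by (auto simp: is_density_def)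
  have "has_bochner_integral lborel fe 1"
    using m p assms by (intro has_bochner_integral_nn_integral) (auto simp: is_density_def)
  then show "integrable lborel fe" "(\<integral>x. fe x \<partial>lborel) = 1"
    by (auto simp: has_bochner_integral_iff)
qed

text \<open>Supplies the measurability of \<open>Phi fe\<close> in
  \<open>fourier_pair_convolve\<close>.\<close>

lemma continuous_Phi:
  assumes "is_density fe"
  shows "continuous_on UNIV (Phi fe)"
proof -
  note D = is_densityD[OF assms]
  note [measurable] = D(1)
  have "isCont (Phi fe) u" for u
    unfolding continuous_at_sequentially comp_def Phi_def
  proof (intro allI impI)
    fix X :: "nat \<Rightarrow> real" assume X: "X \<longlonglongrightarrow> u"
    show "(\<lambda>n. \<integral>x. complex_of_real (fe x) * cis (x * X n) \<partial>lborel) \<longlonglongrightarrow> (\<integral>x. complex_of_real (fe x) * cis (x * u) \<partial>lborel)"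
      using X D by (intro integral_dominated_convergence[where w = fe])
        (auto simp: norm_mult intro!: tendsto_intros isCont_tendsto_compose[OF continuous_on_interior[OF continuous_on_cis[OF continuous_on_id], of _ UNIV]])
  qed
  then show ?thesis by (simp add: continuous_at_imp_continuous_on)
qed

lemma cmod_Phi_le: "is_density fe \<Longrightarrow> cmod (Phi fe u) \<le> 1"
proof -
  assume "is_density fe"
  note D = is_densityD[OF this]
  have "cmod (Phi fe u) \<le> (\<integral>x. cmod (complex_of_real (fe x) * cis (x * u)) \<partial>lborel)"
    unfolding Phi_def by (rule integral_norm_bound)
  also have "\<dots> = 1" using D by (simp add: norm_mult)
  finally show ?thesis .
qed

text \<open>The noise density need not have an integrable transform, so it is never inverted: in the
  backward direction Fubini isolates \<open>fe x\<close>, and the inversion formula of the given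
  pair is applied at \<open>y - x\<close>.\<close>

lemma fourier_pair_convolve:
  fixes p P :: "real \<Rightarrow> complex"
  assumes "fourier_pair p P" and fe: "is_density fe"
  shows "fourier_pair (\<lambda>y. \<integral>x. p (y - x) * fe x \<partial>lborel) (\<lambda>u. P u * Phi fe u)"
proof (rule fourier_pairI)
  note D = fourier_pairD[OF assms(1)] and E = is_densityD[OF fe]
  note [measurable] = E(1)
  have [measurable]: "p \<in> borel_measurable borel" "P \<in> borel_measurable borel"
    using D by auto
  have [measurable]: "Phi fe \<in> borel_measurable borel"
    by (intro borel_measurable_continuous_onI continuous_Phi fe)
  have int1: "integrable (lborel \<Otimes>\<^sub>M lborel) (\<lambda>(x, y). p (y - x) * fe x)"
  proof (rule lborel_pair.Fubini_integrable)
    have 1: "(\<integral>y. cmod (p (y - x)) \<partial>lborel) = (\<integral>y. cmod (p y) \<partial>lborel)" for x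
      using lborel_integral_real_affine[of 1 "\<lambda>y. cmod (p (y - x))" x] by simp
    show "integrable lborel (\<lambda>x. \<integral>y. cmod (case (x, y) of (x, y) \<Rightarrow> p (y - x) * fe x) \<partial>lborel)"
      using E by (simp add: norm_mult 1)
    show "AE x in lborel. integrable lborel (\<lambda>y. case (x, y) of (x, y) \<Rightarrow> p (y - x) * fe x)"
      by (intro AE_I2) (simp add: fourier_pairD(1)[OF fourier_pair_translate[OF assms(1)]])
  qed measurable
  show "integrable lborel (\<lambda>y. \<integral>x. p (y - x) * fe x \<partial>lborel)"
    using lborel_pair.integrable_snd[OF int1] by simp
  show "integrable lborel (\<lambda>u. P u * Phi fe u)"
    by (rule Bochner_Integration.integrable_bound[OF D(2)])
       (auto simp: norm_mult cmod_Phi_le[OF fe] intro!: mult_left_le)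
  show "(\<integral>y. (\<integral>x. p (y - x) * fe x \<partial>lborel) * cis (y * u) \<partial>lborel) = P u * Phi fe u" for u
  proof -
    have int2: "integrable (lborel \<Otimes>\<^sub>M lborel) (\<lambda>(x, y). p (y - x) * fe x * cis (y * u))"
      by (rule Bochner_Integration.integrable_bound[OF int1]) (auto simp: norm_mult)
    have "(\<integral>y. (\<integral>x. p (y - x) * fe x \<partial>lborel) * cis (y * u) \<partial>lborel) = (\<integral>y. (\<integral>x. p (y - x) * fe x * cis (y * u) \<partial>lborel) \<partial>lborel)"
      by simp
    also have "\<dots> = (\<integral>x. (\<integral>y. p (y - x) * fe x * cis (y * u) \<partial>lborel) \<partial>lborel)"
      using lborel_pair.Fubini_integral[OF int2] by simp
    also have "\<dots> = (\<integral>x. P u * (fe x * cis (x * u)) \<partial>lborel)"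
    proof (intro Bochner_Integration.integral_cong refl)
      fix x
      have "(\<integral>y. p (y - x) * fe x * cis (y * u) \<partial>lborel) = (\<integral>y. fe x * (p (y - x) * cis (y * u)) \<partial>lborel)"
        by (simp add: mult_ac)
      also have "\<dots> = fe x * (cis (x * u) * P u)"
        by (simp add: fourier_pairD(3)[OF fourier_pair_translate[OF assms(1)]])
      finally show "(\<integral>y. p (y - x) * fe x * cis (y * u) \<partial>lborel) = P u * (fe x * cis (x * u))" by simp
    qed
    also have "\<dots> = P u * Phi fe u" by (simp add: Phi_def)
    finally show ?thesis .
  qed
  show "(\<integral>u. P u * Phi fe u * cis (- (u * y)) \<partial>lborel) = 2 * pi * (\<integral>x. p (y - x) * fe x \<partial>lborel)" for y
  proof -
    have int2: "integrable (lborel \<Otimes>\<^sub>M lborel) (\<lambda>(u, x). P u * fe x * cis (x * u) * cis (- (u * y)))"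
    proof (rule lborel_pair.Fubini_integrable)
      show "integrable lborel (\<lambda>u. \<integral>x. cmod (case (u, x) of (u, x) \<Rightarrow> P u * fe x * cis (x * u) * cis (- (u * y))) \<partial>lborel)"
        using D E by (simp add: norm_mult)
      show "AE u in lborel. integrable lborel (\<lambda>x. case (u, x) of (u, x) \<Rightarrow> P u * fe x * cis (x * u) * cis (- (u * y)))"
        using E by (simp add: integrable_mult_cis)
    qed measurable
    have "(\<integral>u. P u * Phi fe u * cis (- (u * y)) \<partial>lborel) = (\<integral>u. (\<integral>x. P u * fe x * cis (x * u) * cis (- (u * y)) \<partial>lborel) \<partial>lborel)"
    proof (intro Bochner_Integration.integral_cong refl)
      fix u
      have "(\<integral>x. P u * fe x * cis (x * u) * cis (- (u * y)) \<partial>lborel) = (\<integral>x. P u * (fe x * cis (x * u)) \<partial>lborel) * cis (- (u * y))"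
        by (subst integral_mult_left_zero[symmetric]) (simp only: mult.assoc)
      then show "P u * Phi fe u * cis (- (u * y)) = (\<integral>x. P u * fe x * cis (x * u) * cis (- (u * y)) \<partial>lborel)"
        by (simp add: Phi_def)
    qed
    also have "\<dots> = (\<integral>x. (\<integral>u. P u * fe x * cis (x * u) * cis (- (u * y)) \<partial>lborel) \<partial>lborel)"
      using lborel_pair.Fubini_integral[OF int2] by simp
    also have "\<dots> = (\<integral>x. (\<integral>u. fe x * (P u * cis (- (u * (y - x)))) \<partial>lborel) \<partial>lborel)"
    proof (intro Bochner_Integration.integral_cong refl)
      fix u x
      have "cis (x * u) * cis (- (u * y)) = cis (- (u * (y - x)))"
        by (simp add: cis_mult algebra_simps)
      then show "P u * fe x * cis (x * u) * cis (- (u * y)) = fe x * (P u * cis (- (u * (y - x))))"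
        by (simp only: mult.assoc mult.left_commute[of "P u"])
    qed
    also have "\<dots> = (\<integral>x. 2 * pi * (p (y - x) * fe x) \<partial>lborel)"
      unfolding integral_mult_right_zero D by (simp add: mult_ac)
    also have "\<dots> = 2 * pi * (\<integral>x. p (y - x) * fe x \<partial>lborel)"
      by (simp only: integral_mult_right_zero)
    finally show ?thesis .
  qed
qed

text \<open>The weight \<open>y\<^sup>2\<close> is the limit of \<open>|(cis (t y) - 1) / t|\<^sup>2\<close>, and multiplication by \<open>cis (t y) - 1\<close> is a
  difference of translates of \<^term>\<open>H\<close>. So Plancherel and Fatou suffice and \<^term>\<open>H\<close> need only be Lipschitz.\<close>

lemma weighted_square_bound:
  fixes k H :: "real \<Rightarrow> complex"
  assumes kH: "fourier_pair k H"
    and supp: "\<And>u. R < \<bar>u\<bar> \<Longrightarrow> H u = 0" and "0 \<le> R"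
    and lip: "\<And>u v. \<bar>u - v\<bar> \<le> 1 \<Longrightarrow> cmod (H u - H v) \<le> M * \<bar>u - v\<bar>"
  shows "(\<integral>\<^sup>+y. ennreal (y\<^sup>2 * (cmod (k y))\<^sup>2) \<partial>lborel) \<le> ennreal (1 / pi * (R + 1) * M\<^sup>2)"
proof -
  note D = fourier_pairD[OF kH]
  have [measurable]: "k \<in> borel_measurable borel" "H \<in> borel_measurable borel"
    using D by auto
  have M: "0 \<le> M" using lip[of 1 0] by (simp add: order_trans[OF norm_ge_zero])
  define t :: "nat \<Rightarrow> real" where "t n = 1 / Suc n" for n
  have t: "0 < t n" "t n \<le> 1" for n
    unfolding t_def by auto
  have t_lim: "t \<longlonglongrightarrow> 0" unfolding t_def by real_asymp
  define q where "q n y = k y * (cis (t n * y) - 1)" for n y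
  have q: "fourier_pair (q n) (\<lambda>u. H (u + t n) - H u)" for n
    using fourier_pair_add[OF fourier_pair_modulate[OF kH, of "t n"] fourier_pair_cmult[OF kH, of "-1"]]
    by (simp add: q_def[abs_def] algebra_simps)
  have bd: "(\<integral>\<^sup>+y. ennreal ((cmod (q n y) / t n)\<^sup>2) \<partial>lborel) \<le> ennreal (1 / pi * (R + 1) * M\<^sup>2)" for n
  proof -
    have "(\<integral>y. (cmod (q n y) / t n)\<^sup>2 \<partial>lborel) = (\<integral>y. (cmod (q n y))\<^sup>2 \<partial>lborel) / (t n)\<^sup>2"
      by (simp add: power_divide)
    also have "\<dots> = 1 / (2 * pi) * (\<integral>u. (cmod (H (u + t n) - H u) / t n)\<^sup>2 \<partial>lborel)"
      by (simp add: fourier_pair_plancherel(3)[OF q] power_divide)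
    \<comment> \<open>The difference quotient can be nonzero slightly outside the support of
      \<open>H\<close>; since \<open>t n \<le> 1\<close>, enlarging the interval by 1 covers every
      \<open>n\<close>.\<close>
    also have "\<dots> \<le> 1 / (2 * pi) * (\<integral>u. M\<^sup>2 * indicator {-(R + 1)..R + 1} u \<partial>lborel)"
    proof (intro mult_left_mono integral_mono)
      show "integrable lborel (\<lambda>u. (cmod (H (u + t n) - H u) / t n)\<^sup>2)"
        using fourier_pair_plancherel(2)[OF q[of n]] by (simp add: power_divide)
      fix u
      show "(cmod (H (u + t n) - H u) / t n)\<^sup>2 \<le> M\<^sup>2 * indicator {-(R + 1)..R + 1} u"
      proof (cases "u \<in> {-(R + 1)..R + 1}")
        case True
        have "cmod (H (u + t n) - H u) \<le> M * t n"
          using lip[of "u + t n" u] t[of n] by simp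
        then have "cmod (H (u + t n) - H u) / t n \<le> M"
          using t[of n] by (simp add: field_simps)
        then show ?thesis using True t(1)[of n] by (auto intro!: power_mono)
      next
        case False
        then have "H (u + t n) = 0" "H u = 0" using t[of n] by (auto intro!: supp)
        then show ?thesis by simp
      qed
    qed (auto simp: integrable_indicator_iff emeasure_lborel_Icc_eq)
    also have "\<dots> = 1 / pi * (R + 1) * M\<^sup>2"
      using \<open>0 \<le> R\<close> by (simp add: field_simps)
    finally have "(\<integral>y. (cmod (q n y) / t n)\<^sup>2 \<partial>lborel) \<le> 1 / pi * (R + 1) * M\<^sup>2" .
    moreover have "integrable lborel (\<lambda>y. (cmod (q n y) / t n)\<^sup>2)"
      using fourier_pair_plancherel(1)[OF q[of n]] by (simp add: power_divide)
    ultimately show ?thesis by (subst nn_integral_eq_integral) (auto intro!: ennreal_leI)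
  qed
  have lim: "(\<lambda>n. ennreal ((cmod (q n y) / t n)\<^sup>2)) \<longlonglongrightarrow> ennreal (y\<^sup>2 * (cmod (k y))\<^sup>2)" for y
  proof -
    have "((\<lambda>s. (cis (s * y) - 1) / s) \<longlongrightarrow> \<i> * y) (at 0)"
    proof -
      have "((\<lambda>s. cos (s * y)) has_real_derivative 0) (at 0)" "((\<lambda>s. sin (s * y)) has_real_derivative y) (at 0)"
        by (auto intro!: derivative_eq_intros)
      then have "((\<lambda>s. Complex ((cos (s * y) - 1) / s) (sin (s * y) / s)) \<longlongrightarrow> Complex 0 y) (at 0)"
        by (intro tendsto_Complex) (simp_all add: has_field_derivative_iff)
      moreover have "Complex ((cos (s * y) - 1) / s) (sin (s * y) / s) = (cis (s * y) - 1) / s" for s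
        by (simp add: complex_eq_iff)
      moreover have "Complex 0 y = \<i> * y"
        by (simp add: complex_eq_iff)
      ultimately show ?thesis by (simp only:)
    qed
    then have "(\<lambda>n. (cis (t n * y) - 1) / t n) \<longlonglongrightarrow> \<i> * y"
      using t t_lim by (auto simp: tendsto_at_iff_sequentially comp_def less_imp_neq[symmetric])
    then have "(\<lambda>n. (cmod (k y) * cmod ((cis (t n * y) - 1) / t n))\<^sup>2) \<longlonglongrightarrow> (cmod (k y) * cmod (\<i> * y))\<^sup>2"
      by (intro tendsto_intros)
    moreover have "(cmod (k y) * cmod ((cis (t n * y) - 1) / t n))\<^sup>2 = (cmod (q n y) / t n)\<^sup>2" for n
      using t(1)[of n] by (simp add: q_def norm_mult norm_divide)
    ultimately have "(\<lambda>n. (cmod (q n y) / t n)\<^sup>2) \<longlonglongrightarrow> y\<^sup>2 * (cmod (k y))\<^sup>2"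
      by (simp add: norm_mult power_mult_distrib mult.commute)
    then show ?thesis by (intro tendsto_ennrealI)
  qed
  have "(\<integral>\<^sup>+y. ennreal (y\<^sup>2 * (cmod (k y))\<^sup>2) \<partial>lborel) = (\<integral>\<^sup>+y. liminf (\<lambda>n. ennreal ((cmod (q n y) / t n)\<^sup>2)) \<partial>lborel)"
    by (intro nn_integral_cong lim_imp_Liminf[symmetric] lim) simp
  also have "\<dots> \<le> liminf (\<lambda>n. \<integral>\<^sup>+y. ennreal ((cmod (q n y) / t n)\<^sup>2) \<partial>lborel)"
    by (intro nn_integral_liminf) (auto simp: q_def)
  also have "\<dots> \<le> ennreal (1 / pi * (R + 1) * M\<^sup>2)"
    by (rule order_trans[OF Liminf_mono[of _ "\<lambda>_. ennreal (1 / pi * (R + 1) * M\<^sup>2)"]])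
       (use bd in \<open>auto simp: Liminf_const simp del: ennreal_mult\<close>)
  finally show ?thesis .
qed

section \<open>Two-point lower bound\<close>

lemma PiM_density_prod:
  assumes "finite I" and N: "prob_space N" and N1: "prob_space (density N \<rho>)"
    and [measurable]: "\<rho> \<in> borel_measurable N"
  shows "PiM I (\<lambda>_. density N \<rho>) = density (PiM I (\<lambda>_. N)) (\<lambda>x. \<Prod>i\<in>I. \<rho> (x i))"
proof -
  interpret N: prob_space N by fact
  interpret N1: prob_space "density N \<rho>" by fact
  interpret P: product_sigma_finite "\<lambda>_::'a. N" ..
  interpret P1: product_sigma_finite "\<lambda>_::'a. density N \<rho>" ..
  show ?thesis
  proof (rule P1.PiM_eqI[symmetric])
    show "sets (density (PiM I (\<lambda>_. N)) (\<lambda>x. \<Prod>i\<in>I. \<rho> (x i))) = sets (PiM I (\<lambda>_. density N \<rho>))"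
      by (auto intro!: sets_PiM_cong)
    fix A assume "\<And>i. i \<in> I \<Longrightarrow> A i \<in> sets (density N \<rho>)"
    then have A: "\<And>i. i \<in> I \<Longrightarrow> A i \<in> sets N" by simp
    have "emeasure (density (PiM I (\<lambda>_. N)) (\<lambda>x. \<Prod>i\<in>I. \<rho> (x i))) (Pi\<^sub>E I A)
        = (\<integral>\<^sup>+x. (\<Prod>i\<in>I. \<rho> (x i)) * indicator (Pi\<^sub>E I A) x \<partial>PiM I (\<lambda>_. N))"
      using A \<open>finite I\<close> by (intro emeasure_density) auto
    also have "\<dots> = (\<integral>\<^sup>+x. (\<Prod>i\<in>I. \<rho> (x i) * indicator (A i) (x i)) \<partial>PiM I (\<lambda>_. N))"
    proof (intro nn_integral_cong)
      fix x assume "x \<in> space (PiM I (\<lambda>_. N))"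
      \<comment> \<open>The indicator of the box factors over the coordinates only for extensional
        functions, since membership in \<open>Pi\<^sub>E\<close> also constrains the values outside
        \<open>I\<close>.\<close>
      then have "x \<in> extensional I" by (auto simp: space_PiM PiE_def)
      then have "indicator (Pi\<^sub>E I A) x = (\<Prod>i\<in>I. indicator (A i) (x i) :: ennreal)"
        using \<open>finite I\<close> by (auto simp: indicator_def PiE_def Pi_def prod_zero_iff)
      then show "(\<Prod>i\<in>I. \<rho> (x i)) * indicator (Pi\<^sub>E I A) x = (\<Prod>i\<in>I. \<rho> (x i) * indicator (A i) (x i))"
        by (simp add: prod.distrib)
    qed
    also have "\<dots> = (\<Prod>i\<in>I. \<integral>\<^sup>+x. \<rho> x * indicator (A i) x \<partial>N)"
      using A \<open>finite I\<close> by (intro P.product_nn_integral_prod) auto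
    also have "\<dots> = (\<Prod>i\<in>I. emeasure (density N \<rho>) (A i))"
      using A by (intro prod.cong refl emeasure_density[symmetric]) auto
    finally show "emeasure (density (PiM I (\<lambda>_. N)) (\<lambda>x. \<Prod>i\<in>I. \<rho> (x i))) (Pi\<^sub>E I A) = (\<Prod>i\<in>I. emeasure (density N \<rho>) (A i))" .
  qed fact
qed

text \<open>With mean-zero \<open>\<rho>\<close>, the product Z of the factors 1 + \<rho> has mean 1
  and second moment (1 + chi-square) to the power of the sample size, so its variance is at most
  \<tau>^2. The first absolute moment of Z - 1 follows from 2 \<tau> |z| \<le> \<tau>^2 +
  z^2.\<close>

lemma integral_abs_prod_minus_one:
  fixes \<rho> :: "'a \<Rightarrow> real" and I :: "'i set"
  assumes "finite I" and N: "prob_space N" and [measurable]: "\<rho> \<in> borel_measurable N"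
    and bd: "\<And>x. \<bar>\<rho> x\<bar> \<le> 1" and mean: "(\<integral>x. \<rho> x \<partial>N) = 0"
    and chi: "(1 + (\<integral>x. (\<rho> x)\<^sup>2 \<partial>N)) ^ card I \<le> 1 + \<tau>\<^sup>2" and "0 < \<tau>"
  shows "integrable (PiM I (\<lambda>_. N)) (\<lambda>x. \<Prod>i\<in>I. 1 + \<rho> (x i))"
    "(\<integral>x. \<bar>(\<Prod>i\<in>I. 1 + \<rho> (x i)) - 1\<bar> \<partial>PiM I (\<lambda>_. N)) \<le> \<tau>"
proof -
  interpret N: prob_space N by fact
  interpret P: product_prob_space "\<lambda>_::'i. N" I ..
  let ?P = "PiM I (\<lambda>_. N)" and ?Z = "\<lambda>x. \<Prod>i\<in>I. 1 + \<rho> (x i)"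
  have ir: "integrable N \<rho>" "integrable N (\<lambda>x. (\<rho> x)\<^sup>2)"
    using bd by (auto intro!: N.integrable_const_bound[where B = 1] simp: abs_square_le_1)
  have sq: "integrable N (\<lambda>x. (1 + \<rho> x)\<^sup>2)" "(\<integral>x. (1 + \<rho> x)\<^sup>2 \<partial>N) = 1 + (\<integral>x. (\<rho> x)\<^sup>2 \<partial>N)"
    using ir mean by (simp_all add: power2_sum N.prob_space)
  show i1: "integrable ?P ?Z"
    using ir \<open>finite I\<close> by (intro P.product_integrable_prod) auto
  have i2: "integrable ?P (\<lambda>x. (?Z x)\<^sup>2)"
    unfolding prod_power_distrib using sq \<open>finite I\<close> by (intro P.product_integrable_prod) auto
  have m1: "(\<integral>x. ?Z x \<partial>?P) = 1"
    using ir mean \<open>finite I\<close> by (subst P.product_integral_prod) (auto simp: N.prob_space)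
  have m2: "(\<integral>x. (?Z x)\<^sup>2 \<partial>?P) \<le> 1 + \<tau>\<^sup>2"
    unfolding prod_power_distrib using sq \<open>finite I\<close> chi
    by (subst P.product_integral_prod) (auto simp: sq)
  have "(\<integral>x. \<bar>?Z x - 1\<bar> \<partial>?P) \<le> (\<integral>x. (\<tau>\<^sup>2 + ((?Z x)\<^sup>2 - 2 * ?Z x + 1)) / (2 * \<tau>) \<partial>?P)"
  proof (intro integral_mono)
    fix x
    have "0 \<le> (\<bar>?Z x - 1\<bar> - \<tau>)\<^sup>2" by simp
    then have "2 * \<tau> * \<bar>?Z x - 1\<bar> \<le> \<tau>\<^sup>2 + (?Z x - 1)\<^sup>2"
      by (simp add: power2_diff algebra_simps)
    then show "\<bar>?Z x - 1\<bar> \<le> (\<tau>\<^sup>2 + ((?Z x)\<^sup>2 - 2 * ?Z x + 1)) / (2 * \<tau>)"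
      using \<open>0 < \<tau>\<close> by (simp add: field_simps power2_diff)
  qed (use i1 i2 in auto)
  also have "\<dots> = (\<tau>\<^sup>2 + ((\<integral>x. (?Z x)\<^sup>2 \<partial>?P) - 1)) / (2 * \<tau>)"
    using i1 i2 by (simp add: m1 prob_space.prob_space[OF prob_space_PiM[OF N]])
  also have "\<dots> \<le> (\<tau>\<^sup>2 + \<tau>\<^sup>2) / (2 * \<tau>)"
    using m2 \<open>0 < \<tau>\<close> by (intro divide_right_mono) auto
  also have "\<dots> = \<tau>" using \<open>0 < \<tau>\<close> by (simp add: power2_eq_square)
  finally show "(\<integral>x. \<bar>?Z x - 1\<bar> \<partial>?P) \<le> \<tau>" .
qed

text \<open>Both hypotheses are compared with the law \<open>N\<close> midway between them. Their
  likelihood ratios are within \<tau> of 1 in mean, and min Z1 Z2 \<ge> 1 - |Z1 - 1| - |Z2 - 1|, so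
  the overlap has mass at least 1 - 2 \<tau>. On the overlap both losses are paid at once, and the
  larger risk is at least the average. Abstract losses \<open>W1\<close>, \<open>W2\<close> let one
  statement serve pointwise and integrated error.\<close>

theorem two_point_lower_bound:
  fixes \<rho> :: "'a \<Rightarrow> real" and I :: "'i set" and W1 W2 :: "('i \<Rightarrow> 'a) \<Rightarrow> ennreal"
  assumes "finite I" and N: "prob_space N" and [measurable]: "\<rho> \<in> borel_measurable N"
    and bd: "\<And>x. \<bar>\<rho> x\<bar> \<le> 1"
    and N1: "prob_space (density N (\<lambda>x. ennreal (1 + \<rho> x)))"
    and N2: "prob_space (density N (\<lambda>x. ennreal (1 - \<rho> x)))"
    and chi: "(1 + (\<integral>x. (\<rho> x)\<^sup>2 \<partial>N)) ^ card I \<le> 1 + \<tau>\<^sup>2" and "0 < \<tau>"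
    and [measurable]: "W1 \<in> borel_measurable (PiM I (\<lambda>_. N))" "W2 \<in> borel_measurable (PiM I (\<lambda>_. N))"
    and sep: "\<And>x. x \<in> space (PiM I (\<lambda>_. N)) \<Longrightarrow> 2 * D \<le> W1 x + W2 x"
  shows "D * ennreal (1 - 2 * \<tau>) \<le> sup (\<integral>\<^sup>+x. W1 x \<partial>PiM I (\<lambda>_. density N (\<lambda>x. ennreal (1 + \<rho> x))))
                                    (\<integral>\<^sup>+x. W2 x \<partial>PiM I (\<lambda>_. density N (\<lambda>x. ennreal (1 - \<rho> x))))"
proof -
  interpret N: prob_space N by fact
  interpret P: product_prob_space "\<lambda>_::'i. N" I ..
  let ?P = "PiM I (\<lambda>_. N)"
  let ?Z1 = "\<lambda>x. \<Prod>i\<in>I. 1 + \<rho> (x i)" and ?Z2 = "\<lambda>x. \<Prod>i\<in>I. 1 - \<rho> (x i)"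
  have nn: "0 \<le> 1 + \<rho> x" "0 \<le> 1 - \<rho> x" for x using bd[of x] by (auto simp: abs_le_iff)
  \<comment> \<open>The tilted law has total mass 1.\<close>
  have mean: "(\<integral>x. \<rho> x \<partial>N) = 0"
  proof -
    have ir: "integrable N \<rho>" using bd by (auto intro!: N.integrable_const_bound[where B = 1])
    have "ennreal (\<integral>x. 1 + \<rho> x \<partial>N) = (\<integral>\<^sup>+x. ennreal (1 + \<rho> x) \<partial>N)"
      using ir nn by (intro nn_integral_eq_integral[symmetric]) auto
    also have "\<dots> = emeasure (density N (\<lambda>x. ennreal (1 + \<rho> x))) (space N)"
      by (subst emeasure_density) (auto intro!: nn_integral_cong)
    also have "\<dots> = ennreal 1" using prob_space.emeasure_space_1[OF N1] by simp
    finally have "(\<integral>x. 1 + \<rho> x \<partial>N) = 1"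
      using nn by (subst (asm) ennreal_inj) (auto intro!: integral_nonneg_AE)
    then show ?thesis using ir by (simp add: N.prob_space)
  qed
  note a1 = integral_abs_prod_minus_one[OF \<open>finite I\<close> N _ bd mean chi \<open>0 < \<tau>\<close>]
  note a2 = integral_abs_prod_minus_one[of I N "\<lambda>x. - \<rho> x", OF \<open>finite I\<close> N _ _ _ _ \<open>0 < \<tau>\<close>]
  have i: "integrable ?P ?Z1" "integrable ?P ?Z2" using a1 a2 bd mean chi by auto
  have b: "(\<integral>x. \<bar>?Z1 x - 1\<bar> \<partial>?P) \<le> \<tau>" "(\<integral>x. \<bar>?Z2 x - 1\<bar> \<partial>?P) \<le> \<tau>"
    using a1 a2 bd mean chi by auto
  have z: "0 \<le> ?Z1 x" "0 \<le> ?Z2 x" for x using nn by (auto intro!: prod_nonneg)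
  have "1 - 2 * \<tau> \<le> (\<integral>x. 1 - \<bar>?Z1 x - 1\<bar> - \<bar>?Z2 x - 1\<bar> \<partial>?P)"
    using b i by (simp add: prob_space.prob_space[OF prob_space_PiM[OF N]])
  also have "\<dots> \<le> (\<integral>x. min (?Z1 x) (?Z2 x) \<partial>?P)"
    using i z by (intro integral_mono) (auto intro: integrable_min)
  finally have "ennreal (1 - 2 * \<tau>) \<le> ennreal (\<integral>x. min (?Z1 x) (?Z2 x) \<partial>?P)"
    by (rule ennreal_leI)
  also have "\<dots> = (\<integral>\<^sup>+x. ennreal (min (?Z1 x) (?Z2 x)) \<partial>?P)"
    using i z by (intro nn_integral_eq_integral[symmetric]) auto
  finally have overlap: "ennreal (1 - 2 * \<tau>) \<le> (\<integral>\<^sup>+x. ennreal (min (?Z1 x) (?Z2 x)) \<partial>?P)" .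
  have W: "(\<integral>\<^sup>+x. W1 x \<partial>PiM I (\<lambda>_. density N (\<lambda>x. ennreal (1 + \<rho> x)))) = (\<integral>\<^sup>+x. ennreal (?Z1 x) * W1 x \<partial>?P)"
    "(\<integral>\<^sup>+x. W2 x \<partial>PiM I (\<lambda>_. density N (\<lambda>x. ennreal (1 - \<rho> x)))) = (\<integral>\<^sup>+x. ennreal (?Z2 x) * W2 x \<partial>?P)"
    using \<open>finite I\<close> by (auto simp: PiM_density_prod[OF _ N] N1 N2 nn_integral_density prod_ennreal[OF nn(1)] prod_ennreal[OF nn(2)])
  have "2 * (D * ennreal (1 - 2 * \<tau>)) \<le> 2 * D * (\<integral>\<^sup>+x. ennreal (min (?Z1 x) (?Z2 x)) \<partial>?P)"
    unfolding mult.assoc by (intro mult_left_mono overlap) auto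
  also have "\<dots> = (\<integral>\<^sup>+x. 2 * D * ennreal (min (?Z1 x) (?Z2 x)) \<partial>?P)"
    by (rule nn_integral_cmult[symmetric]) auto
  also have "\<dots> \<le> (\<integral>\<^sup>+x. ennreal (?Z1 x) * W1 x + ennreal (?Z2 x) * W2 x \<partial>?P)"
  proof (intro nn_integral_mono)
    fix x assume "x \<in> space ?P"
    then have "2 * D * ennreal (min (?Z1 x) (?Z2 x)) \<le> (W1 x + W2 x) * ennreal (min (?Z1 x) (?Z2 x))"
      by (intro mult_right_mono sep) auto
    also have "\<dots> \<le> ennreal (?Z1 x) * W1 x + ennreal (?Z2 x) * W2 x"
      unfolding distrib_right by (subst (1 2) mult.commute) (intro add_mono mult_right_mono ennreal_leI, auto)
    finally show "2 * D * ennreal (min (?Z1 x) (?Z2 x)) \<le> ennreal (?Z1 x) * W1 x + ennreal (?Z2 x) * W2 x" .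
  qed
  also have "\<dots> = (\<integral>\<^sup>+x. ennreal (?Z1 x) * W1 x \<partial>?P) + (\<integral>\<^sup>+x. ennreal (?Z2 x) * W2 x \<partial>?P)"
    by (intro nn_integral_add) auto
  also have "\<dots> \<le> 2 * sup (\<integral>\<^sup>+x. ennreal (?Z1 x) * W1 x \<partial>?P) (\<integral>\<^sup>+x. ennreal (?Z2 x) * W2 x \<partial>?P)"
    unfolding mult_2 by (intro add_mono) auto
  finally show ?thesis unfolding W by (subst (asm) ennreal_mult_le_mult_iff) auto
qed


section \<open>From perturbed densities to the minimax risk\<close>

lemma integrable_shift_mult:
  fixes f fe :: "real \<Rightarrow> real"
  assumes [measurable]: "f \<in> borel_measurable borel" and C: "\<And>x. \<bar>f x\<bar> \<le> C" and fe: "is_density fe"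
  shows "integrable lborel (\<lambda>x. f (y - x) * fe x)"
proof -
  note E = is_densityD[OF fe]
  note [measurable] = E(1)
  have "integrable lborel (\<lambda>x. C * fe x)" using E by simp
  then show ?thesis
    by (rule Bochner_Integration.integrable_bound)
       (auto simp: abs_mult E(2) intro!: mult_right_mono order_trans[OF C abs_ge_self])
qed

lemma law_Y_eq_density:
  assumes f: "is_density f" and fe: "is_density fe" and C: "\<And>x. f x \<le> C"
  shows "law_Y f fe = density lborel (\<lambda>y. ennreal (\<integral>x. f (y - x) * fe x \<partial>lborel))"
    and "prob_space (law_Y f fe)"
proof -
  note D = is_densityD[OF f] and E = is_densityD[OF fe]
  note [measurable] = D(1) E(1)
  have p: "prob_space (density lborel (\<lambda>x. ennreal (f x)))" "prob_space (density lborel (\<lambda>x. ennreal (fe x)))"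
    using f fe by (auto intro!: prob_spaceI simp: emeasure_density is_density_def)
  have eq: "law_Y f fe = density lborel (\<lambda>y. \<integral>\<^sup>+x. ennreal (f (y - x)) * ennreal (fe x) \<partial>lborel)"
    unfolding law_Y_def using p by (intro convolution_density) (auto simp: prob_space_def)
  show "prob_space (law_Y f fe)"
    unfolding eq by (rule prob_space_convolution_density) (use D E p in auto)
  show "law_Y f fe = density lborel (\<lambda>y. ennreal (\<integral>x. f (y - x) * fe x \<partial>lborel))"
    unfolding eq
  proof (intro arg_cong[of _ _ "density lborel"] ext)
    fix y
    have "integrable lborel (\<lambda>x. f (y - x) * fe x)"
      by (rule integrable_shift_mult[where C = C]) (use C D fe in auto)
    then show "(\<integral>\<^sup>+x. ennreal (f (y - x)) * ennreal (fe x) \<partial>lborel) = ennreal (\<integral>x. f (y - x) * fe x \<partial>lborel)"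
      by (subst nn_integral_eq_integral[symmetric]) (auto simp: D E ennreal_mult)
  qed
qed

text \<open>Convolution with the noise is linear, so the observed densities are
  \<open>q0 + k\<close> and \<open>q0 - k\<close>: tilts of the central observed law by
  \<open>\<rho> = k / q0\<close>. The second moment of this \<rho> under the central law is the
  chi-square integral bounded in \<open>chi\<close>.\<close>

lemma minimax_two_point:
  fixes f0 g fe :: "real \<Rightarrow> real"
  defines "q0 \<equiv> \<lambda>y. \<integral>x. f0 (y - x) * fe x \<partial>lborel" and "k \<equiv> \<lambda>y. \<integral>x. g (y - x) * fe x \<partial>lborel"
  assumes fe: "is_density fe" and f0: "is_density f0"
    and fp: "is_density (\<lambda>t. f0 t + g t)" and fm: "is_density (\<lambda>t. f0 t - g t)"
    and C: "\<And>t. f0 t \<le> C"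
    and q0: "\<And>y. 0 < q0 y"
    and chi: "(\<integral>\<^sup>+y. ennreal ((k y)\<^sup>2 / q0 y) \<partial>lborel) \<le> ennreal c2" "0 \<le> c2"
    and n: "(1 + c2) ^ n \<le> 1 + \<tau>\<^sup>2" and \<tau>: "0 < \<tau>"
    and A: "(\<lambda>t. f0 t + g t) \<in> \<A>" "(\<lambda>t. f0 t - g t) \<in> \<A>"
  shows "T \<in> pt_estimators n \<Longrightarrow> ennreal ((g x)\<^sup>2) * ennreal (1 - 2 * \<tau>) \<le> risk_pt n fe x T \<A>"
    and "S \<in> fun_estimators n \<Longrightarrow> (\<integral>\<^sup>+t. ennreal ((g t)\<^sup>2) \<partial>lborel) * ennreal (1 - 2 * \<tau>) \<le> risk_L2 n fe S \<A>"
proof -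
  note E = is_densityD[OF fe] and D0 = is_densityD[OF f0] and Dp = is_densityD[OF fp] and Dm = is_densityD[OF fm]
  note [measurable] = E(1) D0(1) Dp(1) Dm(1)
  have "(\<lambda>t. (f0 t + g t) - f0 t) \<in> borel_measurable borel" by measurable
  then have [measurable]: "g \<in> borel_measurable borel" by simp
  \<comment> \<open>Nonnegativity of the two hypotheses is what bounds \<open>g\<close> by
    \<open>f0\<close>. After convolution the same argument gives |k| \<le> q0, that is |\<rho>|
    \<le> 1.\<close>
  have g: "\<bar>g t\<bar> \<le> f0 t" for t using Dp(2)[of t] Dm(2)[of t] by auto
  have gC: "\<bar>g t\<bar> \<le> C" "\<bar>f0 t\<bar> \<le> C" "f0 t + g t \<le> 2 * C" "f0 t - g t \<le> 2 * C" for t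
    using g[of t] C[of t] D0(2)[of t] by auto
  have i: "integrable lborel (\<lambda>x. f0 (y - x) * fe x)" "integrable lborel (\<lambda>x. g (y - x) * fe x)" for y
    by (auto intro!: integrable_shift_mult fe gC)
  have qp: "(\<integral>x. (f0 (y - x) + g (y - x)) * fe x \<partial>lborel) = q0 y + k y"
    and qm: "(\<integral>x. (f0 (y - x) - g (y - x)) * fe x \<partial>lborel) = q0 y - k y" for y
    using i by (simp_all add: distrib_right left_diff_distrib q0_def k_def)
  have kq: "\<bar>k y\<bar> \<le> q0 y" for y
  proof -
    have "0 \<le> (\<integral>x. (f0 (y - x) + g (y - x)) * fe x \<partial>lborel)" "0 \<le> (\<integral>x. (f0 (y - x) - g (y - x)) * fe x \<partial>lborel)"
      using Dp(2) Dm(2) E(2) by (auto intro!: integral_nonneg_AE AE_I2 mult_nonneg_nonneg)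
    then show ?thesis unfolding qp qm by auto
  qed
  have [measurable]: "q0 \<in> borel_measurable borel" "k \<in> borel_measurable borel"
    unfolding q0_def k_def by measurable
  let ?\<rho> = "\<lambda>y. k y / q0 y"
  let ?N = "law_Y f0 fe"
  have L0: "?N = density lborel (\<lambda>y. ennreal (q0 y))" "prob_space ?N"
    using law_Y_eq_density[OF f0 fe C] by (simp_all add: q0_def)
  note Lp = law_Y_eq_density[OF fp fe gC(3), unfolded qp] and Lm = law_Y_eq_density[OF fm fe gC(4), unfolded qm]
  have prod: "ennreal (q0 y) * ennreal (1 + ?\<rho> y) = ennreal (q0 y + k y)" "ennreal (q0 y) * ennreal (1 - ?\<rho> y) = ennreal (q0 y - k y)" for y
    using q0[of y] by (simp_all add: ennreal_mult'[symmetric] distrib_left right_diff_distrib)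
  have dp: "density ?N (\<lambda>y. ennreal (1 + ?\<rho> y)) = law_Y (\<lambda>t. f0 t + g t) fe"
    and dm: "density ?N (\<lambda>y. ennreal (1 - ?\<rho> y)) = law_Y (\<lambda>t. f0 t - g t) fe"
    unfolding L0(1) Lp(1) Lm(1) by (simp_all add: density_density_eq prod)
  have sN [simp, measurable_cong]: "sets ?N = sets borel" by (simp add: L0(1))
  have sP [measurable_cong]: "sets (PiM {..<n} (\<lambda>_. ?N)) = sets (PiM {..<n} (\<lambda>_. borel))"
    by (intro sets_PiM_cong) auto
  have rho: "\<bar>?\<rho> y\<bar> \<le> 1" for y using kq[of y] q0[of y] by (simp add: abs_divide)
  interpret N: prob_space ?N by (rule L0(2))
  have "integrable ?N (\<lambda>y. (?\<rho> y)\<^sup>2)"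
    using rho by (intro N.integrable_const_bound[where B = 1]) (auto simp: abs_square_le_1)
  then have "ennreal (\<integral>y. (?\<rho> y)\<^sup>2 \<partial>?N) = (\<integral>\<^sup>+y. ennreal ((?\<rho> y)\<^sup>2) \<partial>?N)"
    by (intro nn_integral_eq_integral[symmetric]) auto
  also have "\<dots> = (\<integral>\<^sup>+y. ennreal (q0 y) * ennreal ((?\<rho> y)\<^sup>2) \<partial>lborel)"
    unfolding L0(1) by (subst nn_integral_density) auto
  also have "\<dots> = (\<integral>\<^sup>+y. ennreal ((k y)\<^sup>2 / q0 y) \<partial>lborel)"
    using q0 by (intro nn_integral_cong) (auto simp: ennreal_mult''[symmetric] power_divide power2_eq_square less_imp_neq[symmetric])
  finally have "ennreal (\<integral>y. (?\<rho> y)\<^sup>2 \<partial>?N) \<le> ennreal c2" using chi(1) by simp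
  then have "(\<integral>y. (?\<rho> y)\<^sup>2 \<partial>?N) \<le> c2" using chi(2) by (subst (asm) ennreal_le_iff)
  then have "(1 + (\<integral>y. (?\<rho> y)\<^sup>2 \<partial>?N)) ^ card {..<n} \<le> (1 + c2) ^ n"
    by (auto intro!: power_mono add_nonneg_nonneg integral_nonneg_AE)
  then have c: "(1 + (\<integral>y. (?\<rho> y)\<^sup>2 \<partial>?N)) ^ card {..<n} \<le> 1 + \<tau>\<^sup>2" using n by (rule order_trans)
  have [measurable]: "?\<rho> \<in> borel_measurable ?N" by measurable
  note key = two_point_lower_bound[where I = "{..<n}" and \<rho> = ?\<rho>, OF _ L0(2) _ rho _ _ c \<tau>, unfolded dp dm,
      OF _ _ Lp(2) Lm(2)]
  {
    assume T: "T \<in> pt_estimators n"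
    then have [measurable]: "T \<in> borel_measurable (PiM {..<n} (\<lambda>_. borel))"
      by (simp add: pt_estimators_def)
    have [measurable]: "T \<in> borel_measurable (PiM {..<n} (\<lambda>_. ?N))" by measurable
    have "ennreal ((g x)\<^sup>2) * ennreal (1 - 2 * \<tau>) \<le> sup
        (\<integral>\<^sup>+y. ennreal ((T y - (f0 x + g x))\<^sup>2) \<partial>PiM {..<n} (\<lambda>_. law_Y (\<lambda>t. f0 t + g t) fe))
        (\<integral>\<^sup>+y. ennreal ((T y - (f0 x - g x))\<^sup>2) \<partial>PiM {..<n} (\<lambda>_. law_Y (\<lambda>t. f0 t - g t) fe))"
    proof (rule key)
      fix y
      \<comment> \<open>With a = T y - f0 x the right-hand side equals 2 a^2 + 2 (g x)^2, so no
        estimate can be close to both hypotheses.\<close>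
      have "2 * (g x)\<^sup>2 \<le> (T y - (f0 x + g x))\<^sup>2 + (T y - (f0 x - g x))\<^sup>2"
        using zero_le_power2[of "T y - f0 x"] by (simp add: power2_eq_square algebra_simps)
      then have "ennreal (2 * (g x)\<^sup>2) \<le> ennreal ((T y - (f0 x + g x))\<^sup>2 + (T y - (f0 x - g x))\<^sup>2)"
        by (rule ennreal_leI)
      then show "2 * ennreal ((g x)\<^sup>2) \<le> ennreal ((T y - (f0 x + g x))\<^sup>2) + ennreal ((T y - (f0 x - g x))\<^sup>2)"
        by (simp add: ennreal_mult)
    qed auto
    also have "\<dots> \<le> risk_pt n fe x T \<A>"
      unfolding risk_pt_def sample_law_def
      by (rule sup_least) (rule SUP_upper2[OF A(1)] SUP_upper2[OF A(2)], rule order_refl)+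
    finally show "ennreal ((g x)\<^sup>2) * ennreal (1 - 2 * \<tau>) \<le> risk_pt n fe x T \<A>" .
  }
  {
    assume "S \<in> fun_estimators n"
    then have [measurable]: "case_prod S \<in> borel_measurable (PiM {..<n} (\<lambda>_. borel) \<Otimes>\<^sub>M borel)"
      by (simp add: fun_estimators_def)
    have [measurable]: "case_prod S \<in> borel_measurable (PiM {..<n} (\<lambda>_. ?N) \<Otimes>\<^sub>M lborel)" by measurable
    have [measurable]: "(\<lambda>y. S (fst y) (snd y)) \<in> borel_measurable (PiM {..<n} (\<lambda>_. ?N) \<Otimes>\<^sub>M lborel)"
      using \<open>case_prod S \<in> borel_measurable (PiM {..<n} (\<lambda>_. ?N) \<Otimes>\<^sub>M lborel)\<close> by (simp add: case_prod_beta')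
    have "(\<integral>\<^sup>+t. ennreal ((g t)\<^sup>2) \<partial>lborel) * ennreal (1 - 2 * \<tau>) \<le> sup
        (\<integral>\<^sup>+y. (\<integral>\<^sup>+t. ennreal ((S y t - (f0 t + g t))\<^sup>2) \<partial>lborel) \<partial>PiM {..<n} (\<lambda>_. law_Y (\<lambda>t. f0 t + g t) fe))
        (\<integral>\<^sup>+y. (\<integral>\<^sup>+t. ennreal ((S y t - (f0 t - g t))\<^sup>2) \<partial>lborel) \<partial>PiM {..<n} (\<lambda>_. law_Y (\<lambda>t. f0 t - g t) fe))"
    proof (rule key)
      fix y assume y: "y \<in> space (PiM {..<n} (\<lambda>_. ?N))"
      have [measurable]: "S y \<in> borel_measurable lborel"
        using measurable_Pair2[OF \<open>case_prod S \<in> borel_measurable (PiM {..<n} (\<lambda>_. ?N) \<Otimes>\<^sub>M lborel)\<close> y] by simp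
      have "2 * (\<integral>\<^sup>+t. ennreal ((g t)\<^sup>2) \<partial>lborel) = (\<integral>\<^sup>+t. 2 * ennreal ((g t)\<^sup>2) \<partial>lborel)"
        by (rule nn_integral_cmult[symmetric]) auto
      also have "\<dots> \<le> (\<integral>\<^sup>+t. ennreal ((S y t - (f0 t + g t))\<^sup>2) + ennreal ((S y t - (f0 t - g t))\<^sup>2) \<partial>lborel)"
      proof (intro nn_integral_mono)
        fix x
        have "2 * (g x)\<^sup>2 \<le> (S y x - (f0 x + g x))\<^sup>2 + (S y x - (f0 x - g x))\<^sup>2"
          using zero_le_power2[of "S y x - f0 x"] by (simp add: power2_eq_square algebra_simps)
        then have "ennreal (2 * (g x)\<^sup>2) \<le> ennreal ((S y x - (f0 x + g x))\<^sup>2 + (S y x - (f0 x - g x))\<^sup>2)"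
          by (rule ennreal_leI)
        then show "2 * ennreal ((g x)\<^sup>2) \<le> ennreal ((S y x - (f0 x + g x))\<^sup>2) + ennreal ((S y x - (f0 x - g x))\<^sup>2)"
          by (simp add: ennreal_mult)
      qed
      also have "\<dots> = (\<integral>\<^sup>+t. ennreal ((S y t - (f0 t + g t))\<^sup>2) \<partial>lborel) + (\<integral>\<^sup>+t. ennreal ((S y t - (f0 t - g t))\<^sup>2) \<partial>lborel)"
        by (rule nn_integral_add) auto
      finally show "2 * (\<integral>\<^sup>+t. ennreal ((g t)\<^sup>2) \<partial>lborel) \<le> \<dots>" .
    qed (auto simp: case_prod_beta')
    also have "\<dots> \<le> risk_L2 n fe S \<A>"
      unfolding risk_L2_def sample_law_def
      by (rule sup_least) (rule SUP_upper2[OF A(1)] SUP_upper2[OF A(2)], rule order_refl)+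
    finally show "(\<integral>\<^sup>+t. ennreal ((g t)\<^sup>2) \<partial>lborel) * ennreal (1 - 2 * \<tau>) \<le> risk_L2 n fe S \<A>" .
  }
qed

section \<open>The perturbation\<close>

text \<open>The nodes start at 2: the gap of one unit between 0 and the support separates the perturbation
  from the critical frequency.\<close>

definition prof :: "nat \<Rightarrow> (nat \<Rightarrow> real) \<Rightarrow> real \<Rightarrow> real" where
  "prof N b w = (\<Sum>k<N. b k * tent (w - real (k + 2)))"

text \<open>The mirror image at negative frequencies makes the transform even, hence its inverse
  \<open>pert\<close> real: each pair of tents at w and -w becomes a Fejer kernel modulated by 2 cos
  (w t).\<close>

definition pert_hat :: "nat \<Rightarrow> (nat \<Rightarrow> real) \<Rightarrow> real \<Rightarrow> real \<Rightarrow> real \<Rightarrow> real \<Rightarrow> real" where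
  "pert_hat N b A U d u = A * (prof N b ((u - U) / d) + prof N b ((- u - U) / d))"

definition pert :: "nat \<Rightarrow> (nat \<Rightarrow> real) \<Rightarrow> real \<Rightarrow> real \<Rightarrow> real \<Rightarrow> real \<Rightarrow> real" where
  "pert N b A U d t = A * (\<Sum>k<N. b k * (2 * cos ((U + real (k + 2) * d) * t) * (d * fejer (d * t))))"

lemma fourier_pair_pert:
  assumes d: "0 < d"
  shows "fourier_pair (\<lambda>t. complex_of_real (pert N b A U d t)) (\<lambda>u. complex_of_real (pert_hat N b A U d u))"
proof -
  have 1: "fourier_pair (\<lambda>t. complex_of_real (2 * cos (w * t) * (d * fejer (d * t))))
      (\<lambda>u. complex_of_real (tent ((u - w) / d) + tent ((- u - w) / d)))" for w
  proof -
    have 0: "fourier_pair (\<lambda>y. d * complex_of_real (fejer (d * y))) (\<lambda>u. complex_of_real (tent (u / d)))"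
      by (rule fourier_pair_dilate[OF fourier_pair_fejer d])
    have "fourier_pair (\<lambda>y. d * complex_of_real (fejer (d * y)) * cis (w * y) + d * complex_of_real (fejer (d * y)) * cis (- w * y))
       (\<lambda>u. complex_of_real (tent ((u + w) / d)) + complex_of_real (tent ((u + - w) / d)))"
      by (intro fourier_pair_add fourier_pair_modulate[OF 0])
    moreover have "d * complex_of_real (fejer (d * y)) * cis (w * y) + d * complex_of_real (fejer (d * y)) * cis (- w * y)
       = complex_of_real (2 * cos (w * y) * (d * fejer (d * y)))" for y
      by (simp add: complex_eq_iff)
    moreover have "tent ((u + w) / d) = tent ((- u - w) / d)" for u
      using tent_simps(3)[of "(u + w) / d"] by (simp add: minus_divide_left)
    ultimately show ?thesis by (simp add: add.commute)
  qed
  have "fourier_pair (\<lambda>t. A * (\<Sum>k<N. b k * complex_of_real (2 * cos ((U + real (k + 2) * d) * t) * (d * fejer (d * t)))))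
     (\<lambda>u. A * (\<Sum>k<N. b k * complex_of_real (tent ((u - (U + real (k + 2) * d)) / d) + tent ((- u - (U + real (k + 2) * d)) / d))))"
    by (intro fourier_pair_cmult fourier_pair_sum 1) auto
  moreover have "(v - (U + real (k + 2) * d)) / d = (v - U) / d - real (k + 2)" for v k
    using d by (simp add: field_simps)
  ultimately show ?thesis
    by (simp add: pert_def pert_hat_def prof_def distrib_left sum.distrib)
qed

context
  fixes N :: nat and b :: "nat \<Rightarrow> real"
  assumes b: "\<And>k. 0 \<le> b k"
begin

lemma prof_nonneg: "0 \<le> prof N b w"
  unfolding prof_def by (intro sum_nonneg mult_nonneg_nonneg b tent_simps)

lemma prof_le: "prof N b w \<le> (\<Sum>k<N. b k)"
  unfolding prof_def by (intro sum_mono) (use b tent_simps in \<open>auto intro!: mult_left_le\<close>)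

text \<open>The nodes run from 2 to N + 1 and each tent reaches one unit further, so after rescaling
  the frequencies used lie between U + d and U + (N + 2) d.\<close>

lemma prof_eq_0: "w \<le> 1 \<or> real N + 2 \<le> w \<Longrightarrow> prof N b w = 0"
  unfolding prof_def by (intro sum.neutral) (auto intro!: tent_eq_0)

lemma prof_lipschitz: "\<bar>prof N b w - prof N b v\<bar> \<le> (\<Sum>k<N. b k) * \<bar>w - v\<bar>"
proof -
  have "\<bar>prof N b w - prof N b v\<bar> = \<bar>\<Sum>k<N. b k * (tent (w - real (k + 2)) - tent (v - real (k + 2)))\<bar>"
    unfolding prof_def by (simp add: sum_subtractf right_diff_distrib)
  also have "\<dots> \<le> (\<Sum>k<N. b k * \<bar>w - v\<bar>)"
  proof (intro order_trans[OF sum_abs] sum_mono)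
    fix k
    show "\<bar>b k * (tent (w - real (k + 2)) - tent (v - real (k + 2)))\<bar> \<le> b k * \<bar>w - v\<bar>"
      using b[of k] tent_lipschitz[of "w - real (k + 2)" "v - real (k + 2)"]
      by (simp add: abs_mult mult_left_mono)
  qed
  finally show ?thesis by (simp add: sum_distrib_right)
qed

lemma measurable_prof [measurable]: "prof N b \<in> borel_measurable borel"
  unfolding prof_def[abs_def] by measurable

context
  fixes A U d :: real
  assumes A: "0 \<le> A" and U: "1 \<le> U" and d: "0 < d"
begin

text \<open>All terms share one Fejer envelope and differ only in the cosine factor, so the bound
  does not depend on the frequency \<open>U\<close>. This envelope is what the central density has
  to dominate.\<close>

lemma pert_abs_le: "\<bar>pert N b A U d t\<bar> \<le> 2 * A * (\<Sum>k<N. b k) * (d * fejer (d * t))"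
proof -
  have "\<bar>\<Sum>k<N. b k * (2 * cos ((U + real (k + 2) * d) * t) * (d * fejer (d * t)))\<bar> \<le> (\<Sum>k<N. b k * (2 * (d * fejer (d * t))))"
    by (intro order_trans[OF sum_abs] sum_mono)
       (use b d fejer_nonneg in \<open>auto simp: abs_mult intro!: mult_left_mono mult_right_le_one_le mult_left_le_one_le\<close>)
  then have "\<bar>\<Sum>k<N. b k * (2 * cos ((U + real (k + 2) * d) * t) * (d * fejer (d * t)))\<bar> \<le> (\<Sum>k<N. b k) * (2 * (d * fejer (d * t)))"
    by (simp only: sum_distrib_right)
  from mult_left_mono[OF this A] show ?thesis
    using A by (simp add: pert_def abs_mult mult.assoc mult.left_commute[of 2])
qed

lemma pert_0: "pert N b A U d 0 = A * d / pi * (\<Sum>k<N. b k)"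
  by (simp add: pert_def fejer_def sum_distrib_right[symmetric] sum_divide_distrib[symmetric])

lemma continuous_on_pert: "continuous_on S (pert N b A U d)"
  unfolding pert_def[abs_def] by (intro continuous_intros)

lemma measurable_pert_hat [measurable]: "pert_hat N b A U d \<in> borel_measurable borel"
  unfolding pert_hat_def[abs_def] by measurable

lemma pert_hat_eq_0: "\<bar>u\<bar> \<le> U + d \<or> U + (real N + 2) * d \<le> \<bar>u\<bar> \<Longrightarrow> pert_hat N b A U d u = 0"
proof -
  assume *: "\<bar>u\<bar> \<le> U + d \<or> U + (real N + 2) * d \<le> \<bar>u\<bar>"
  have "(u - U) / d \<le> 1 \<or> real N + 2 \<le> (u - U) / d" "(- u - U) / d \<le> 1 \<or> real N + 2 \<le> (- u - U) / d"
    using * d U by (auto simp: field_simps abs_if split: if_splits)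
  then show ?thesis by (simp add: pert_hat_def prof_eq_0)
qed

text \<open>Since \<open>U\<close> is positive, at most one of the two mirror arguments is positive,
  and the profile vanishes on nonpositive ones. Hence squares of \<open>pert_hat\<close> have no
  cross term.\<close>

lemma pert_hat_disjoint: "prof N b ((u - U) / d) * prof N b ((- u - U) / d) = 0"
proof (cases "0 \<le> u")
  case True
  then have "(- u - U) / d \<le> 0" using d U by (auto simp: divide_le_0_iff)
  then show ?thesis by (simp add: prof_eq_0)
next
  case False
  then have "(u - U) / d \<le> 0" using d U by (auto simp: divide_le_0_iff)
  then show ?thesis by (simp add: prof_eq_0)
qed

lemma pert_hat_le: "\<bar>pert_hat N b A U d u\<bar> \<le> 2 * A * (\<Sum>k<N. b k)"
  using mult_left_mono[OF add_mono[OF prof_le[of "(u - U) / d"] prof_le[of "(- u - U) / d"]] A] A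
  by (simp add: pert_hat_def abs_mult prof_nonneg)

lemma pert_hat_lipschitz: "\<bar>pert_hat N b A U d u - pert_hat N b A U d v\<bar> \<le> 2 * A * (\<Sum>k<N. b k) / d * \<bar>u - v\<bar>"
proof -
  let ?S = "\<Sum>k<N. b k"
  have e: "\<bar>(u - U) / d - (v - U) / d\<bar> = \<bar>u - v\<bar> / d" "\<bar>(- u - U) / d - (- v - U) / d\<bar> = \<bar>u - v\<bar> / d"
    using d by (auto simp: diff_divide_distrib[symmetric] abs_divide)
  have "\<bar>(prof N b ((u - U) / d) - prof N b ((v - U) / d)) + (prof N b ((- u - U) / d) - prof N b ((- v - U) / d))\<bar>
      \<le> ?S * (\<bar>u - v\<bar> / d) + ?S * (\<bar>u - v\<bar> / d)"
    using prof_lipschitz[of "(u - U) / d" "(v - U) / d"] prof_lipschitz[of "(- u - U) / d" "(- v - U) / d"]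
    unfolding e by linarith
  from mult_left_mono[OF this A]
  have "A * \<bar>(prof N b ((u - U) / d) + prof N b ((- u - U) / d)) - (prof N b ((v - U) / d) + prof N b ((- v - U) / d))\<bar>
      \<le> 2 * A * ?S / d * \<bar>u - v\<bar>"
    by (simp add: algebra_simps)
  then show ?thesis
    using A by (simp add: pert_hat_def right_diff_distrib[symmetric] abs_mult)
qed

text \<open>The substitutions u = U + d w and u = - (U + d w) carry the two halves to the same
  integral, each with Jacobian \<open>d\<close>. Used with the exponential weight for membership in
  the class and with weight 1 for the norm.\<close>

lemma nn_integral_pert_hat:
  assumes [measurable]: "\<omega> \<in> borel_measurable borel" and w: "\<And>v. 0 \<le> \<omega> v"
  shows "(\<integral>\<^sup>+u. ennreal ((pert_hat N b A U d u)\<^sup>2 * \<omega> \<bar>u\<bar>) \<partial>lborel)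
     = ennreal (2 * A\<^sup>2 * d) * (\<integral>\<^sup>+w. ennreal ((prof N b w)\<^sup>2 * \<omega> \<bar>U + d * w\<bar>) \<partial>lborel)"
proof -
  let ?f = "\<lambda>u. ennreal ((prof N b ((u - U) / d))\<^sup>2 * \<omega> \<bar>u\<bar>)"
  let ?f' = "\<lambda>u. ennreal ((prof N b ((- u - U) / d))\<^sup>2 * \<omega> \<bar>u\<bar>)"
  let ?I = "\<integral>\<^sup>+w. ennreal ((prof N b w)\<^sup>2 * \<omega> \<bar>U + d * w\<bar>) \<partial>lborel"
  have sq: "(pert_hat N b A U d u)\<^sup>2 = A\<^sup>2 * ((prof N b ((u - U) / d))\<^sup>2 + (prof N b ((- u - U) / d))\<^sup>2)" for u
    using pert_hat_disjoint[of u] by (auto simp: pert_hat_def power_mult_distrib power2_sum)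
  have 1: "(\<integral>\<^sup>+u. ?f u \<partial>lborel) = ennreal d * ?I"
    using d by (subst nn_integral_real_affine[where c = d and t = U]) auto
  have 2: "(\<integral>\<^sup>+u. ?f' u \<partial>lborel) = ennreal d * ?I"
  proof (subst nn_integral_real_affine[where c = "- d" and t = "- U"])
    have "\<bar>- U + - d * x\<bar> = \<bar>U + d * x\<bar>" for x by linarith
    then show "ennreal \<bar>- d\<bar> * (\<integral>\<^sup>+x. ennreal ((prof N b ((- (- U + - d * x) - U) / d))\<^sup>2 * \<omega> \<bar>- U + - d * x\<bar>) \<partial>lborel) = ennreal d * ?I"
      using d by simp
  qed (use d in auto)
  have "(\<integral>\<^sup>+u. ennreal ((pert_hat N b A U d u)\<^sup>2 * \<omega> \<bar>u\<bar>) \<partial>lborel) = (\<integral>\<^sup>+u. ennreal (A\<^sup>2) * (?f u + ?f' u) \<partial>lborel)"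
    unfolding sq by (intro nn_integral_cong) (simp add: ennreal_mult'[symmetric] ennreal_plus[symmetric] distrib_right distrib_left w mult.assoc del: ennreal_plus)
  also have "\<dots> = ennreal (A\<^sup>2) * ((\<integral>\<^sup>+u. ?f u \<partial>lborel) + (\<integral>\<^sup>+u. ?f' u \<partial>lborel))"
    by (subst nn_integral_cmult, simp, subst nn_integral_add) auto
  also have "\<dots> = ennreal (A\<^sup>2) * (ennreal (2 * d) * ?I)"
  proof -
    have "ennreal (2 * d) = ennreal d + ennreal d"
      using d by (subst ennreal_plus[symmetric]) auto
    then show ?thesis unfolding 1 2 by (simp only: distrib_right)
  qed
  also have "\<dots> = ennreal (2 * A\<^sup>2 * d) * ?I"
  proof -
    have "ennreal (2 * A\<^sup>2 * d) = ennreal (A\<^sup>2) * ennreal (2 * d)"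
      using d by (subst ennreal_mult[symmetric]) (auto simp: mult_ac)
    then show ?thesis by (simp only: mult.assoc)
  qed
  finally show ?thesis .
qed

text \<open>The transform of \<open>k\<close> is \<open>pert_hat\<close> times
  \<open>Phi fe\<close>. The part without \<open>y\<^sup>2\<close> needs its height, the part with
  \<open>y\<^sup>2\<close> its Lipschitz constant. By the product rule the latter is at most 2 A S /
  d times Q plus 2 A S times Q, where \<open>Q\<close> bounds both the size and the slope of
  \<open>Phi fe\<close> on the frequencies used; the common bound \<open>?M\<close> also covers the
  height.\<close>

lemma noisy_pert_bound:
  fixes fe :: "real \<Rightarrow> real"
  defines "k \<equiv> \<lambda>y. \<integral>x. pert N b A U d (y - x) * fe x \<partial>lborel" and "R \<equiv> U + (real N + 2) * d"
    and "S \<equiv> \<Sum>k<N. b k"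
  assumes fe: "is_density fe" and Q: "0 \<le> Q"
    and bd: "\<And>u. U + d \<le> \<bar>u\<bar> \<Longrightarrow> \<bar>u\<bar> \<le> R \<Longrightarrow> cmod (Phi fe u) \<le> Q"
    and lip: "\<And>u v. U + d \<le> \<bar>u\<bar> \<Longrightarrow> \<bar>u\<bar> \<le> R \<Longrightarrow> U + d \<le> \<bar>v\<bar> \<Longrightarrow> \<bar>v\<bar> \<le> R \<Longrightarrow> 0 < u * v \<Longrightarrow>
        cmod (Phi fe u - Phi fe v) \<le> Q * \<bar>u - v\<bar>"
  shows "(\<integral>\<^sup>+y. ennreal ((1 + y\<^sup>2) * (k y)\<^sup>2) \<partial>lborel) \<le> ennreal (8 / pi * (R + 1) * (A * S * Q * (1 + 1 / d))\<^sup>2)"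
proof -
  let ?G = "pert_hat N b A U d"
  let ?H = "\<lambda>u. complex_of_real (?G u) * Phi fe u"
  let ?M = "2 * A * S * Q * (1 + 1 / d)"
  have S: "0 \<le> S" unfolding S_def by (intro sum_nonneg b)
  have R: "1 \<le> R" using U d by (simp add: R_def add_increasing2)
  have "fourier_pair (\<lambda>y. \<integral>x. complex_of_real (pert N b A U d (y - x)) * complex_of_real (fe x) \<partial>lborel) ?H"
    by (rule fourier_pair_convolve[OF fourier_pair_pert[OF d] fe])
  moreover have "(\<integral>x. complex_of_real (pert N b A U d (y - x)) * complex_of_real (fe x) \<partial>lborel) = complex_of_real (k y)" for y
    unfolding k_def by (simp only: of_real_mult[symmetric] integral_complex_of_real)
  ultimately have kH: "fourier_pair (\<lambda>y. complex_of_real (k y)) ?H" by simp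
  have supp: "?H u = 0" if "R < \<bar>u\<bar>" for u
    using pert_hat_eq_0[of u] that by (simp add: R_def)
  have z: "?G u = 0 \<or> (U + d \<le> \<bar>u\<bar> \<and> \<bar>u\<bar> \<le> R)" for u
  proof (cases "?G u = 0")
    case False
    then have "\<not> (\<bar>u\<bar> \<le> U + d \<or> U + (real N + 2) * d \<le> \<bar>u\<bar>)"
      using pert_hat_eq_0[of u] by blast
    then show ?thesis by (simp add: R_def not_le less_imp_le)
  qed simp
  have Hbd: "cmod (?H u) \<le> ?M" for u
  proof -
    have "cmod (?H u) \<le> 2 * A * S * Q * 1"
      using z[of u] mult_mono[OF pert_hat_le[of u] bd[of u]] A S Q by (auto simp: norm_mult S_def[symmetric])
    also have "2 * A * S * Q * 1 \<le> ?M" using A S Q d by (intro mult_left_mono) auto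
    finally show ?thesis .
  qed
  have Hlip: "cmod (?H u - ?H v) \<le> ?M * \<bar>u - v\<bar>" if uv: "\<bar>u - v\<bar> \<le> 1" for u v
  proof -
    \<comment> \<open>The product rule is arranged to evaluate \<open>Phi fe\<close> alone at
      \<open>u\<close>, which lies in the frequency band. At \<open>v\<close> it occurs only with
      the factor \<open>?G v\<close>, so nothing has to be known about it when \<open>v\<close> is
      outside the band.\<close>
    have *: "cmod (?H u - ?H v) \<le> ?M * \<bar>u - v\<bar>" if u: "U + d \<le> \<bar>u\<bar>" "\<bar>u\<bar> \<le> R" and uv: "\<bar>u - v\<bar> \<le> 1" for u v
    proof -
      have "?H u - ?H v = complex_of_real (?G u - ?G v) * Phi fe u + complex_of_real (?G v) * (Phi fe u - Phi fe v)"
        by (simp add: algebra_simps)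
      then have "cmod (?H u - ?H v) \<le> \<bar>?G u - ?G v\<bar> * cmod (Phi fe u) + \<bar>?G v\<bar> * cmod (Phi fe u - Phi fe v)"
        by (metis (no_types) norm_triangle_ineq norm_mult norm_of_real)
      moreover have "\<bar>?G u - ?G v\<bar> * cmod (Phi fe u) \<le> (2 * A * S / d * \<bar>u - v\<bar>) * Q"
        using A S d Q by (intro mult_mono bd u pert_hat_lipschitz[folded S_def]) auto
      moreover have "\<bar>?G v\<bar> * cmod (Phi fe u - Phi fe v) \<le> (2 * A * S) * (Q * \<bar>u - v\<bar>)"
      proof (cases "?G v = 0")
        case True
        then show ?thesis using A S Q by simp
      next
        case False
        then have v: "U + d \<le> \<bar>v\<bar>" "\<bar>v\<bar> \<le> R" using z[of v] by auto
        \<comment> \<open>Opposite signs are impossible: both points have modulus at least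
          \<open>U + d\<close>, which exceeds 1, while their distance is at most 1.\<close>
        have "0 < u * v"
          using u v uv U d by (auto simp: zero_less_mult_iff abs_if split: if_splits)
        then show ?thesis
          using A S Q u v by (intro mult_mono lip pert_hat_le[folded S_def]) auto
      qed
      ultimately show ?thesis by (simp add: algebra_simps)
    qed
    show ?thesis
    proof (cases "?G u = 0 \<and> ?G v = 0")
      case True
      then show ?thesis using A S Q d by simp
    next
      case False
      then show ?thesis
        using z[of u] z[of v] *[of u v] *[of v u] uv by (auto simp: norm_minus_commute abs_minus_commute)
    qed
  qed
  have [measurable]: "k \<in> borel_measurable borel"
  proof -
    have "(\<lambda>y. Re (complex_of_real (k y))) \<in> borel_measurable borel"
      using fourier_pairD(1)[OF kH] by measurable
    then show ?thesis by simp
  qed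
  have sq1: "(\<integral>\<^sup>+y. ennreal (y\<^sup>2 * (k y)\<^sup>2) \<partial>lborel) \<le> ennreal (1 / pi * (R + 1) * ?M\<^sup>2)"
    using weighted_square_bound[OF kH supp _ Hlip] R by simp
  have sq2: "(\<integral>\<^sup>+y. ennreal ((k y)\<^sup>2) \<partial>lborel) \<le> ennreal (1 / pi * (R + 1) * ?M\<^sup>2)"
  proof -
    note P = fourier_pair_plancherel[OF kH]
    have "(\<integral>y. (k y)\<^sup>2 \<partial>lborel) = 1 / (2 * pi) * (\<integral>u. (cmod (?H u))\<^sup>2 \<partial>lborel)"
      using P(3) by simp
    also have "\<dots> \<le> 1 / (2 * pi) * (\<integral>u. ?M\<^sup>2 * indicator {- R..R} u \<partial>lborel)"
    proof (intro mult_left_mono integral_mono P)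
      fix u show "(cmod (?H u))\<^sup>2 \<le> ?M\<^sup>2 * indicator {- R..R} u"
      proof (cases "\<bar>u\<bar> \<le> R")
        case True
        then show ?thesis using power_mono[OF Hbd[of u]] by (auto simp: abs_le_iff indicator_def)
      next
        case False
        then have "cmod (?H u) = 0" using supp[of u] by (simp only: not_le norm_zero)
        then show ?thesis by (simp only: power_zero_numeral zero_le_mult_iff) simp
      qed
    qed (auto simp: integrable_indicator_iff emeasure_lborel_Icc_eq)
    also have "\<dots> = 1 / pi * R * ?M\<^sup>2" using R by (simp add: field_simps)
    also have "\<dots> \<le> 1 / pi * (R + 1) * ?M\<^sup>2" by (intro mult_right_mono mult_left_mono) auto
    finally show ?thesis
      using P(1) by (subst nn_integral_eq_integral) (auto intro!: ennreal_leI)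
  qed
  have "(\<integral>\<^sup>+y. ennreal ((1 + y\<^sup>2) * (k y)\<^sup>2) \<partial>lborel) = (\<integral>\<^sup>+y. ennreal ((k y)\<^sup>2) + ennreal (y\<^sup>2 * (k y)\<^sup>2) \<partial>lborel)"
    by (intro nn_integral_cong) (simp add: distrib_right ennreal_plus[symmetric] del: ennreal_plus)
  also have "\<dots> = (\<integral>\<^sup>+y. ennreal ((k y)\<^sup>2) \<partial>lborel) + (\<integral>\<^sup>+y. ennreal (y\<^sup>2 * (k y)\<^sup>2) \<partial>lborel)"
    by (intro nn_integral_add) auto
  also have "\<dots> \<le> ennreal (1 / pi * (R + 1) * ?M\<^sup>2) + ennreal (1 / pi * (R + 1) * ?M\<^sup>2)"
    by (intro add_mono sq1 sq2)
  \<comment> \<open>Two equal contributions, each with the factor 4 from the square of the 2 in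
    \<open>?M\<close>.\<close>
  also have "\<dots> = ennreal (8 / pi * (R + 1) * (A * S * Q * (1 + 1 / d))\<^sup>2)"
    using R by (subst ennreal_plus[symmetric]) (auto simp: power_mult_distrib)
  finally show ?thesis .
qed

end
end

section \<open>The base density and risk bounds at a fixed frequency\<close>

lemma fejer_le: "fejer x \<le> 1 / (2 * pi)"
proof -
  have "(sin (x / 2))\<^sup>2 \<le> (x / 2)\<^sup>2"
    using abs_sin_x_le_abs_x[of "x / 2"] by (simp add: abs_le_square_iff[symmetric])
  then show ?thesis
    by (auto simp: fejer_def one_minus_cos_eq field_simps)
qed

lemma square_fejer_le: "x\<^sup>2 * fejer x \<le> 2 / pi"
proof (cases "x = 0")
  case False
  have "(1 - cos x) / pi \<le> 2 / pi"
    using cos_ge_minus_one[of x] by (intro divide_right_mono) auto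
  then show ?thesis using False by (simp add: fejer_def)
qed simp

lemma fejer_le_1: "fejer x \<le> 1"
proof -
  have "1 / (2 * pi) \<le> 1" using pi_gt3 by (simp add: field_simps)
  then show ?thesis using fejer_le[of x] by linarith
qed

lemma dilated_fejer_le:
  assumes "0 < d"
  shows "d * fejer (d * t) \<le> (d + 1 / d) / (1 + t\<^sup>2)"
proof -
  have "d * fejer (d * t) \<le> d"
    using assms by (intro mult_right_le_one_le) (auto simp: fejer_nonneg fejer_le_1)
  moreover have "d * fejer (d * t) * t\<^sup>2 \<le> 1 / d"
  proof -
    have "2 / pi \<le> 1" using pi_gt3 by (simp add: field_simps)
    then have "(d * t)\<^sup>2 * fejer (d * t) \<le> 1"
      using square_fejer_le[of "d * t"] by linarith
    then show ?thesis using assms by (simp add: field_simps power2_eq_square)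
  qed
  ultimately have "d * fejer (d * t) * (1 + t\<^sup>2) \<le> d + 1 / d" by (simp add: distrib_left)
  then show ?thesis by (simp add: pos_le_divide_eq add_pos_nonneg)
qed

text \<open>A single Fejer kernel has zeros; shifting a copy by half a period fills them.\<close>

definition base :: "real \<Rightarrow> real \<Rightarrow> real" where
  "base a t = a / 2 * (fejer (a * t) + fejer (a * t - pi))"

text \<open>Shifting the kernel only multiplies the tent by a phase, so the transform still vanishes
  for |u| \<ge> a. Its value 1 at 0 makes \<open>base a\<close> a density once nonnegativity is
  known.\<close>

lemma fourier_pair_base:
  assumes "0 < a"
  shows "fourier_pair (\<lambda>t. complex_of_real (base a t)) (\<lambda>u. (1 + cis (pi * (u / a))) / 2 * tent (u / a))"
proof -
  have "fourier_pair (\<lambda>y. complex_of_real (fejer y) + complex_of_real (fejer (y - pi)))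
     (\<lambda>u. complex_of_real (tent u) + cis (pi * u) * complex_of_real (tent u))"
    by (intro fourier_pair_add fourier_pair_fejer fourier_pair_translate[OF fourier_pair_fejer])
  from fourier_pair_cmult[OF fourier_pair_dilate[OF this assms], of "1 / 2"]
  show ?thesis by (simp add: base_def field_simps)
qed

text \<open>Shifting by pi turns cos x into - cos x, so over a common denominator the two numerators
  add up to 2 and no zero survives. The denominator is the bound \<open>?B\<close>, quadratic in
  \<open>t\<close>, for both squared arguments.\<close>

lemma base_lower:
  assumes a: "0 < a"
  shows "a / (2 * pi * (a\<^sup>2 + pi\<^sup>2)) / (1 + t\<^sup>2) \<le> base a t"
proof -
  let ?x = "a * t"
  have F: "(1 - cos x) / (pi * B) \<le> fejer x" if "x\<^sup>2 \<le> B" "0 < B" for x B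
    using that by (cases "x = 0") (auto simp: fejer_def fejer_nonneg intro!: divide_left_mono mult_left_mono)
  have "(\<bar>?x\<bar> + pi)\<^sup>2 \<le> 2 * (?x\<^sup>2 + pi\<^sup>2)"
    using sum_squares_bound[of "\<bar>?x\<bar>" pi] by (simp add: power2_sum)
  also have "\<dots> \<le> 2 * ((a\<^sup>2 + pi\<^sup>2) * (1 + t\<^sup>2))"
    by (simp add: algebra_simps power_mult_distrib)
  finally have B: "(\<bar>?x\<bar> + pi)\<^sup>2 \<le> 2 * (a\<^sup>2 + pi\<^sup>2) * (1 + t\<^sup>2)" by (simp only: mult.assoc)
  let ?B = "2 * (a\<^sup>2 + pi\<^sup>2) * (1 + t\<^sup>2)"
  have B0: "0 < ?B" by (intro mult_pos_pos) (simp_all add: add_pos_nonneg add_nonneg_pos)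
  have "?x\<^sup>2 \<le> (\<bar>?x\<bar> + pi)\<^sup>2" "(?x - pi)\<^sup>2 \<le> (\<bar>?x\<bar> + pi)\<^sup>2"
    using pi_gt_zero by (auto simp: abs_le_square_iff[symmetric] abs_if simp del: pi_gt_zero)
  then have "?x\<^sup>2 \<le> ?B" "(?x - pi)\<^sup>2 \<le> ?B" using B by linarith+
  then have "(1 - cos ?x) / (pi * ?B) + (1 - cos (?x - pi)) / (pi * ?B) \<le> fejer ?x + fejer (?x - pi)"
    by (intro add_mono F B0)
  also have "(1 - cos ?x) / (pi * ?B) + (1 - cos (?x - pi)) / (pi * ?B) = 2 / (pi * ?B)"
    by (simp add: add_divide_distrib[symmetric] cos_diff)
  finally have "a / 2 * (2 / (pi * ?B)) \<le> base a t"
    using a unfolding base_def by (intro mult_left_mono) auto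
  then show ?thesis by (simp add: field_simps)
qed

lemma base_le: "0 < a \<Longrightarrow> base a t \<le> a"
  using mult_left_mono[OF add_mono[OF fejer_le_1[of "a * t"] fejer_le_1[of "a * t - pi"]], of "a / 2"]
  unfolding base_def by simp

lemma continuous_on_base: "continuous_on S (base a)"
  unfolding base_def[abs_def] by (intro continuous_intros)

section \<open>Membership in the class and the observed central density\<close>

lemma is_density_fourier_pair:
  assumes "fourier_pair (\<lambda>t. complex_of_real (f t)) P" "\<And>t. 0 \<le> f t" "P 0 = 1"
  shows "is_density f"
proof -
  note D = fourier_pairD[OF assms(1)]
  have f: "integrable lborel f" using D(1) by (simp only: complex_of_real_integrable_eq)
  have "complex_of_real (\<integral>t. f t \<partial>lborel) = 1"
    using D(3)[of 0] assms(3) by (simp del: integral_complex_of_real add: integral_complex_of_real[symmetric])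
  then have "(\<integral>t. f t \<partial>lborel) = 1" by (simp only: of_real_eq_1_iff)
  then show ?thesis
    using f assms(2) by (auto simp: is_density_def nn_integral_eq_integral)
qed

text \<open>A translation multiplies the transform by a unimodular phase. The weighted energy is
  unchanged, so hypotheses peaking at an arbitrary point \<open>x\<close> come for free.\<close>

lemma A_classI_translate:
  assumes fP: "fourier_pair (\<lambda>t. complex_of_real (f t)) P" and nn: "\<And>t. 0 \<le> f t" and P0: "P 0 = 1"
    and f: "continuous_on UNIV f"
    and L: "(\<integral>\<^sup>+u. ennreal ((cmod (P u))\<^sup>2 * exp (2 * \<alpha> * \<bar>u\<bar> powr r)) \<partial>lborel) \<le> ennreal (2 * pi * L)"
  shows "(\<lambda>t. f (t - x)) \<in> A_class \<alpha> r L"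
proof -
  note T = fourier_pair_translate[OF fP, of x]
  have "Phi (\<lambda>t. f (t - x)) u = cis (x * u) * P u" for u
    using fourier_pairD(3)[OF T] by (simp add: Phi_def)
  moreover have "is_density (\<lambda>t. f (t - x))"
    by (rule is_density_fourier_pair[OF T]) (auto simp: nn P0)
  moreover have "continuous_on UNIV (\<lambda>t. f (t - x))"
    by (rule continuous_on_compose2[OF f]) (auto intro!: continuous_intros)
  ultimately show ?thesis using L by (simp add: A_class_def norm_mult)
qed

text \<open>Quadratic tails survive convolution with any density: 1 + (y - x)^2 \<le> 2 (1 + y^2) (1
  + x^2) separates the variables. The constant that remains is the integral of
  \<open>fe x / (1 + x\<^sup>2)\<close>, which is positive because otherwise \<open>fe\<close> would
  vanish almost everywhere.\<close>

lemma convolve_lower_bound: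
  assumes fe: "is_density fe" and f0: "is_density f0" and C: "\<And>t. f0 t \<le> C"
    and c: "0 < c" "\<And>t. c / (1 + t\<^sup>2) \<le> f0 t"
  obtains c' where "0 < c'" "\<And>y. c' / (1 + y\<^sup>2) \<le> (\<integral>x. f0 (y - x) * fe x \<partial>lborel)"
proof
  note E = is_densityD[OF fe] and D = is_densityD[OF f0]
  note [measurable] = E(1) D(1)
  let ?I = "\<integral>x. fe x / (1 + x\<^sup>2) \<partial>lborel"
  have int: "integrable lborel (\<lambda>x. fe x / (1 + x\<^sup>2))"
  proof (rule Bochner_Integration.integrable_bound[OF E(3)])
    show "AE x in lborel. norm (fe x / (1 + x\<^sup>2)) \<le> norm (fe x)"
    proof (rule AE_I2)
      fix x
      have "\<bar>fe x\<bar> / (1 + x\<^sup>2) \<le> \<bar>fe x\<bar> / 1" by (rule divide_left_mono) (auto simp: add_pos_nonneg)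
      then show "norm (fe x / (1 + x\<^sup>2)) \<le> norm (fe x)" by (simp add: abs_divide)
    qed
  qed measurable
  have "?I \<noteq> 0"
  proof
    assume "?I = 0"
    then have "AE x in lborel. fe x / (1 + x\<^sup>2) = 0"
      using integral_nonneg_eq_0_iff_AE[OF int] E(2) by auto
    moreover have "1 + x\<^sup>2 \<noteq> 0" for x :: real using zero_le_power2[of x] by linarith
    ultimately have "AE x in lborel. fe x = 0" by simp
    then have "(\<integral>x. fe x \<partial>lborel) = 0" by (rule integral_eq_zero_AE)
    then show False using E(4) by simp
  qed
  moreover have "0 \<le> ?I" by (intro integral_nonneg_AE AE_I2 divide_nonneg_nonneg) (auto simp: E(2))
  ultimately show "0 < c / 2 * ?I" using c by simp
  fix y
  have "(\<integral>x. c / 2 / (1 + y\<^sup>2) * (fe x / (1 + x\<^sup>2)) \<partial>lborel) \<le> (\<integral>x. f0 (y - x) * fe x \<partial>lborel)"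
  proof (intro integral_mono)
    show "integrable lborel (\<lambda>x. f0 (y - x) * fe x)"
      by (rule integrable_shift_mult[where C = C]) (auto simp: D C fe)
    fix x
    have "1 + (y - x)\<^sup>2 \<le> 2 * ((1 + y\<^sup>2) * (1 + x\<^sup>2))"
    proof -
      have "1 + (y - x)\<^sup>2 + (y + x)\<^sup>2 + 1 + 2 * (y * x)\<^sup>2 = 2 * ((1 + y\<^sup>2) * (1 + x\<^sup>2))"
        by (simp add: power2_diff power2_sum power_mult_distrib algebra_simps)
      then show ?thesis using zero_le_power2[of "y + x"] zero_le_power2[of "y * x"] by linarith
    qed
    then have "c / (2 * ((1 + y\<^sup>2) * (1 + x\<^sup>2))) \<le> c / (1 + (y - x)\<^sup>2)"
      using c(1) by (intro divide_left_mono mult_pos_pos) (simp_all add: add_pos_nonneg)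
    also have "\<dots> \<le> f0 (y - x)" by (rule c)
    finally have "c / (2 * ((1 + y\<^sup>2) * (1 + x\<^sup>2))) * fe x \<le> f0 (y - x) * fe x"
      by (intro mult_right_mono E)
    then show "c / 2 / (1 + y\<^sup>2) * (fe x / (1 + x\<^sup>2)) \<le> f0 (y - x) * fe x"
      by (simp add: mult_ac del: distrib_left_numeral)
  qed (use int in \<open>auto simp del: times_divide_eq_right times_divide_eq_left times_divide_times_eq\<close>)
  then have "c / 2 / (1 + y\<^sup>2) * ?I \<le> (\<integral>x. f0 (y - x) * fe x \<partial>lborel)"
    by (simp only: integral_mult_right_zero)
  then show "c / 2 * ?I / (1 + y\<^sup>2) \<le> (\<integral>x. f0 (y - x) * fe x \<partial>lborel)" by simp
qed


lemma cmod_base_hat_le: "cmod ((1 + cis v) / 2 * complex_of_real (tent u)) \<le> tent u"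
proof -
  have "cmod (1 + cis v) / 2 \<le> 1" using norm_triangle_ineq[of 1 "cis v"] by simp
  from mult_right_mono[OF this tent_simps(1)[of u]]
  show ?thesis by (simp add: norm_mult norm_divide tent_simps)
qed

text \<open>Separates construction from asymptotics: each condition is one demand on the parameters.
  \<open>pos\<close> makes both hypotheses nonnegative, \<open>aL\<close> and \<open>cls\<close>
  share the energy 2 pi L between the central density and the perturbation (additive because
  \<open>a \<le> U\<close> keeps the spectra apart), and \<open>n\<close> makes the samples nearly
  indistinguishable.\<close>

theorem risk_lower_bounds:
  fixes b :: "nat \<Rightarrow> real" and fe :: "real \<Rightarrow> real" and A U d :: real and N :: nat
  defines "R \<equiv> U + (real N + 2) * d" and "S \<equiv> \<Sum>k<N. b k"
  assumes \<alpha>: "0 < \<alpha>" and r: "0 < r"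
    and b: "\<And>k. 0 \<le> b k" and A: "0 \<le> A" and U: "1 \<le> U" and d: "0 < d" and fe: "is_density fe"
    and a: "0 < a" "a \<le> U"
    and c0: "\<And>t. c0 / (1 + t\<^sup>2) \<le> base a t" and pos: "2 * A * S * (d + 1 / d) \<le> c0"
    and c1: "0 < c1" "\<And>y. c1 / (1 + y\<^sup>2) \<le> (\<integral>x. base a (y - x) * fe x \<partial>lborel)"
    and aL: "2 * a * exp (2 * \<alpha> * a powr r) \<le> 2 * pi * L"
    and cls: "(\<integral>\<^sup>+u. ennreal ((pert_hat N b A U d u)\<^sup>2 * exp (2 * \<alpha> * \<bar>u\<bar> powr r)) \<partial>lborel)
        \<le> ennreal (2 * pi * L - 2 * a * exp (2 * \<alpha> * a powr r))"
    and Q: "0 \<le> Q" "\<And>u. U + d \<le> \<bar>u\<bar> \<Longrightarrow> \<bar>u\<bar> \<le> R \<Longrightarrow> cmod (Phi fe u) \<le> Q"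
      "\<And>u v. U + d \<le> \<bar>u\<bar> \<Longrightarrow> \<bar>u\<bar> \<le> R \<Longrightarrow> U + d \<le> \<bar>v\<bar> \<Longrightarrow> \<bar>v\<bar> \<le> R \<Longrightarrow> 0 < u * v \<Longrightarrow>
        cmod (Phi fe u - Phi fe v) \<le> Q * \<bar>u - v\<bar>"
    and n: "(1 + 8 / pi * (R + 1) * (A * S * Q * (1 + 1 / d))\<^sup>2 / c1) ^ n \<le> 1 + \<tau>\<^sup>2" and \<tau>: "0 < \<tau>"
  shows "T \<in> pt_estimators n \<Longrightarrow>
      ennreal ((pert N b A U d 0)\<^sup>2) * ennreal (1 - 2 * \<tau>) \<le> risk_pt n fe x T (A_class \<alpha> r L)"
    and "T' \<in> fun_estimators n \<Longrightarrow>
      (\<integral>\<^sup>+t. ennreal ((pert N b A U d t)\<^sup>2) \<partial>lborel) * ennreal (1 - 2 * \<tau>) \<le> risk_L2 n fe T' (A_class \<alpha> r L)"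
proof -
  let ?g = "pert N b A U d" and ?G = "pert_hat N b A U d"
  let ?B = "\<lambda>u. (1 + cis (pi * (u / a))) / 2 * complex_of_real (tent (u / a))"
  let ?e = "\<lambda>u. exp (2 * \<alpha> * \<bar>u\<bar> powr r)"
  note fb = fourier_pair_base[OF a(1)] and fg = fourier_pair_pert[OF d, of N b A U]
  have g_le: "\<bar>?g t\<bar> \<le> base a t" for t
  proof -
    have "\<bar>?g t\<bar> \<le> 2 * A * S * (d * fejer (d * t))"
      unfolding S_def by (rule pert_abs_le[OF b A U d])
    also have "\<dots> \<le> 2 * A * S * ((d + 1 / d) / (1 + t\<^sup>2))"
      using A b by (intro mult_left_mono dilated_fejer_le d) (auto simp: S_def intro!: mult_nonneg_nonneg sum_nonneg)
    also have "\<dots> \<le> c0 / (1 + t\<^sup>2)"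
      using pos by (simp add: divide_right_mono)
    also have "\<dots> \<le> base a t" by (rule c0)
    finally show ?thesis .
  qed
  have G0: "?G u = 0" if "\<bar>u\<bar> \<le> U" for u
    using that d by (intro pert_hat_eq_0[OF b A U d]) auto
  have B0: "?B u = 0" if "a \<le> \<bar>u\<bar>" for u
    using that a by (simp add: tent_eq_0 abs_divide)
  \<comment> \<open>The sign \<open>sg\<close> treats both hypotheses at once.\<close>
  have mem: "(\<lambda>t. base a (t - x) + sg * ?g (t - x)) \<in> A_class \<alpha> r L" if sg: "\<bar>sg\<bar> = 1" for sg x
  proof -
    have "fourier_pair (\<lambda>t. complex_of_real (base a t) + sg * complex_of_real (?g t)) (\<lambda>u. ?B u + sg * complex_of_real (?G u))"
      by (intro fourier_pair_add fourier_pair_cmult fb fg)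
    then have fp: "fourier_pair (\<lambda>t. complex_of_real (base a t + sg * ?g t)) (\<lambda>u. ?B u + sg * complex_of_real (?G u))"
      by simp
    have "(\<integral>\<^sup>+u. ennreal ((cmod (?B u + sg * complex_of_real (?G u)))\<^sup>2 * ?e u) \<partial>lborel)
      \<le> (\<integral>\<^sup>+u. ennreal (exp (2 * \<alpha> * a powr r)) * indicator {- a..a} u + ennreal ((?G u)\<^sup>2 * ?e u) \<partial>lborel)"
    proof (intro nn_integral_mono)
      fix u
      show "ennreal ((cmod (?B u + sg * complex_of_real (?G u)))\<^sup>2 * ?e u)
         \<le> ennreal (exp (2 * \<alpha> * a powr r)) * indicator {- a..a} u + ennreal ((?G u)\<^sup>2 * ?e u)"
      proof (cases "\<bar>u\<bar> \<le> a")
        case True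
        then have "?G u = 0" using G0[of u] a by simp
        moreover have "(cmod (?B u))\<^sup>2 * ?e u \<le> 1 * exp (2 * \<alpha> * a powr r)"
        proof (intro mult_mono)
          show "(cmod (?B u))\<^sup>2 \<le> 1"
            using cmod_base_hat_le[of "pi * (u / a)" "u / a"] tent_simps(2)[of "u / a"]
            by (intro power_le_one) auto
          show "?e u \<le> exp (2 * \<alpha> * a powr r)"
            using True \<alpha> r by (auto intro!: powr_mono2)
        qed auto
        ultimately show ?thesis using True by (auto simp: abs_le_iff indicator_def intro!: ennreal_leI)
      next
        case False
        then have "cmod (?B u + sg * complex_of_real (?G u)) = \<bar>?G u\<bar>"
          using B0[of u] sg by (simp only: not_le less_imp_le add_0 norm_mult norm_of_real mult_1)
        then show ?thesis by simp
      qed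
    qed
    also have "\<dots> = ennreal (exp (2 * \<alpha> * a powr r)) * ennreal (2 * a) + (\<integral>\<^sup>+u. ennreal ((?G u)\<^sup>2 * ?e u) \<partial>lborel)"
    proof (subst nn_integral_add)
      show "(\<lambda>u. ennreal ((?G u)\<^sup>2 * ?e u)) \<in> borel_measurable lborel"
        using measurable_pert_hat[OF b A U d] by measurable
    qed (use a in \<open>auto simp: nn_integral_cmult_indicator\<close>)
    also have "\<dots> \<le> ennreal (exp (2 * \<alpha> * a powr r) * (2 * a)) + ennreal (2 * pi * L - 2 * a * exp (2 * \<alpha> * a powr r))"
      by (intro add_mono cls) (simp add: ennreal_mult')
    also have "\<dots> = ennreal (2 * pi * L)"
      using aL a by (subst ennreal_plus[symmetric]) (auto simp: mult_ac)
    finally have L': "(\<integral>\<^sup>+u. ennreal ((cmod (?B u + sg * complex_of_real (?G u)))\<^sup>2 * ?e u) \<partial>lborel) \<le> ennreal (2 * pi * L)" .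
    have "0 \<le> base a t + sg * ?g t" for t
    proof -
      have "\<bar>sg * ?g t\<bar> \<le> base a t" using g_le[of t] sg by (simp add: abs_mult)
      then show ?thesis by (simp add: abs_le_iff)
    qed
    moreover have "continuous_on UNIV (\<lambda>t. base a t + sg * ?g t)"
      by (intro continuous_intros continuous_on_base continuous_on_pert[OF b A U d])
    moreover have "?B 0 + sg * complex_of_real (?G 0) = 1" using U by (simp add: G0 tent_simps)
    ultimately show ?thesis by (intro A_classI_translate[OF fp] L')
  qed
  let ?q = "\<lambda>y. \<integral>x. base a (y - x) * fe x \<partial>lborel" and ?k = "\<lambda>y. \<integral>x. ?g (y - x) * fe x \<partial>lborel"
  let ?c = "8 / pi * (R + 1) * (A * S * Q * (1 + 1 / d))\<^sup>2"
  have R: "0 \<le> R" using U d by (simp add: R_def)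
  have base0: "0 \<le> base a t" for t using g_le[of t] by linarith
  have [measurable]: "base a \<in> borel_measurable borel" "?g \<in> borel_measurable borel"
    by (intro borel_measurable_continuous_onI continuous_on_base continuous_on_pert[OF b A U d])+
  note [measurable] = is_densityD(1)[OF fe]
  have chi: "(\<integral>\<^sup>+y. ennreal ((?k y)\<^sup>2 / ?q y) \<partial>lborel) \<le> ennreal (?c / c1)"
  proof -
    have "(\<integral>\<^sup>+y. ennreal ((?k y)\<^sup>2 / ?q y) \<partial>lborel) \<le> (\<integral>\<^sup>+y. ennreal (1 / c1) * ennreal ((1 + y\<^sup>2) * (?k y)\<^sup>2) \<partial>lborel)"
    proof (intro nn_integral_mono)
      fix y
      have "0 < c1 / (1 + y\<^sup>2)" using c1(1) by (simp add: add_pos_nonneg)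
      then have "(?k y)\<^sup>2 / ?q y \<le> (?k y)\<^sup>2 / (c1 / (1 + y\<^sup>2))"
        using c1(2)[of y] by (intro divide_left_mono mult_pos_pos) auto
      also have "\<dots> = 1 / c1 * ((1 + y\<^sup>2) * (?k y)\<^sup>2)" by simp
      finally show "ennreal ((?k y)\<^sup>2 / ?q y) \<le> ennreal (1 / c1) * ennreal ((1 + y\<^sup>2) * (?k y)\<^sup>2)"
        using c1(1) by (subst ennreal_mult'[symmetric]) (auto intro!: ennreal_leI)
    qed
    also have "\<dots> = ennreal (1 / c1) * (\<integral>\<^sup>+y. ennreal ((1 + y\<^sup>2) * (?k y)\<^sup>2) \<partial>lborel)"
      by (intro nn_integral_cmult) measurable
    also have "\<dots> \<le> ennreal (1 / c1) * ennreal ?c"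
      unfolding R_def S_def
      by (intro mult_left_mono noisy_pert_bound[OF b A U d fe Q(1)]) (use Q in \<open>auto simp: R_def\<close>)
    also have "\<dots> = ennreal (?c / c1)"
      using c1(1) by (subst ennreal_mult'[symmetric]) (auto simp: mult_ac)
    finally show ?thesis .
  qed
  \<comment> \<open>The hypotheses are centred at \<open>x\<close> and the error is measured at
    \<open>z\<close>. Taking \<open>z = x\<close> exploits the peak of the perturbation; for the
    integrated error the centre is immaterial and 0 is taken.\<close>
  have key: "(T \<in> pt_estimators n \<longrightarrow>
      ennreal ((?g (z - x))\<^sup>2) * ennreal (1 - 2 * \<tau>) \<le> risk_pt n fe z T (A_class \<alpha> r L)) \<and>
     (T' \<in> fun_estimators n \<longrightarrow>
      (\<integral>\<^sup>+t. ennreal ((?g (t - x))\<^sup>2) \<partial>lborel) * ennreal (1 - 2 * \<tau>) \<le> risk_L2 n fe T' (A_class \<alpha> r L))" for z x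
  proof -
    have m: "(\<lambda>t. base a (t - x) + ?g (t - x)) \<in> A_class \<alpha> r L" "(\<lambda>t. base a (t - x) - ?g (t - x)) \<in> A_class \<alpha> r L"
      using mem[of 1 x] mem[of "-1" x] by simp_all
    have d0: "is_density (\<lambda>t. base a (t - x))"
      by (rule is_density_fourier_pair[OF fourier_pair_translate[OF fb]]) (auto simp: base0 tent_simps)
    have e: "y - v - x = (y - x) - v" for y v by simp
    have q: "0 < (\<integral>v. base a (y - v - x) * fe v \<partial>lborel)" for y
    proof -
      have "0 < c1 / (1 + (y - x)\<^sup>2)" using c1(1) by (simp add: add_pos_nonneg)
      then show ?thesis unfolding e using c1(2)[of "y - x"] by linarith
    qed
    have chi': "(\<integral>\<^sup>+y. ennreal ((\<integral>v. ?g (y - v - x) * fe v \<partial>lborel)\<^sup>2 / (\<integral>v. base a (y - v - x) * fe v \<partial>lborel)) \<partial>lborel) \<le> ennreal (?c / c1)"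
      unfolding e using chi by (subst nn_integral_real_affine[where c = 1 and t = x]) auto
    have c: "0 \<le> ?c / c1" using R c1(1) by (intro divide_nonneg_pos mult_nonneg_nonneg) auto
    have dp: "is_density (\<lambda>t. base a (t - x) + ?g (t - x))" "is_density (\<lambda>t. base a (t - x) - ?g (t - x))"
      using m by (auto simp: A_class_def)
    show ?thesis
      using minimax_two_point[OF fe d0 dp base_le[OF a(1)] q chi' c n \<tau> m] by blast
  qed
  show "T \<in> pt_estimators n \<Longrightarrow>
      ennreal ((?g 0)\<^sup>2) * ennreal (1 - 2 * \<tau>) \<le> risk_pt n fe x T (A_class \<alpha> r L)"
    using key[of x x] by simp
  show "T' \<in> fun_estimators n \<Longrightarrow>
      (\<integral>\<^sup>+t. ennreal ((?g t)\<^sup>2) \<partial>lborel) * ennreal (1 - 2 * \<tau>) \<le> risk_L2 n fe T' (A_class \<alpha> r L)"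
    using key[of 0 0] by simp
qed

section \<open>Noise and bandwidth\<close>

lemma powr_le_powr_abs:
  fixes u R \<gamma> p :: real
  assumes "1 \<le> u" "u \<le> R" "\<bar>\<gamma>\<bar> \<le> p"
  shows "u powr \<gamma> \<le> R powr p"
proof -
  have "u powr \<gamma> \<le> u powr p" using assms by (intro powr_mono) auto
  also have "\<dots> \<le> R powr p" using assms by (intro powr_mono2) auto
  finally show ?thesis .
qed

text \<open>Merges the two assumptions into one constant and one exponent on V \<le> |u| \<le> R.
  The polynomial exponents may have either sign, so powers of |u| are bounded by
  \<open>R powr p\<close> with p the sum of their absolute values, while the exponential is taken at
  the inner edge \<open>V\<close>. The Lipschitz bound is the mean value inequality.\<close>

lemma noise_bounds:
  fixes fe :: "real \<Rightarrow> real"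
  assumes s: "0 < s" and \<beta>: "0 < \<beta>"
    and ND: "\<exists>u1 B \<gamma>1 D1 D2. u1 > 0 \<and> B > 0 \<and>
        (\<forall>u. u1 \<le> \<bar>u\<bar> \<longrightarrow>
            (Phi fe has_vector_derivative D1 u) (at u within {v. u1 \<le> \<bar>v\<bar>}) \<and>
            (D1 has_vector_derivative D2 u) (at u within {v. u1 \<le> \<bar>v\<bar>}) \<and>
            max (cmod (D1 u)) (cmod (D2 u)) \<le> B * \<bar>u\<bar> powr \<gamma>1 * exp (- \<beta> * \<bar>u\<bar> powr s)) \<and>
        continuous_on {v. u1 \<le> \<bar>v\<bar>} D2"
    and N_right: "\<exists>u0 bmax \<gamma>'. u0 > 0 \<and> bmax > 0 \<and>
        (\<forall>u. u0 \<le> \<bar>u\<bar> \<longrightarrow> cmod (Phi fe u) \<le> bmax * \<bar>u\<bar> powr \<gamma>' * exp (- \<beta> * \<bar>u\<bar> powr s))"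
  obtains C p V0 where "0 < C" "0 \<le> p" "1 \<le> V0"
    "\<And>V R u. V0 \<le> V \<Longrightarrow> V \<le> \<bar>u\<bar> \<Longrightarrow> \<bar>u\<bar> \<le> R \<Longrightarrow> cmod (Phi fe u) \<le> C * R powr p * exp (- \<beta> * V powr s)"
    "\<And>V R u v. V0 \<le> V \<Longrightarrow> V \<le> \<bar>u\<bar> \<Longrightarrow> \<bar>u\<bar> \<le> R \<Longrightarrow> V \<le> \<bar>v\<bar> \<Longrightarrow> \<bar>v\<bar> \<le> R \<Longrightarrow> 0 < u * v \<Longrightarrow>
        cmod (Phi fe u - Phi fe v) \<le> C * R powr p * exp (- \<beta> * V powr s) * \<bar>u - v\<bar>"
proof -
  obtain u1 B \<gamma>1 D1 D2 where u1: "u1 > 0" "B > 0"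
    and D1: "\<And>u. u1 \<le> \<bar>u\<bar> \<Longrightarrow> (Phi fe has_vector_derivative D1 u) (at u within {v. u1 \<le> \<bar>v\<bar>})"
    and D1b: "\<And>u. u1 \<le> \<bar>u\<bar> \<Longrightarrow> max (cmod (D1 u)) (cmod (D2 u)) \<le> B * \<bar>u\<bar> powr \<gamma>1 * exp (- \<beta> * \<bar>u\<bar> powr s)"
    using ND by blast
  obtain u0 bmax \<gamma>' where u0: "u0 > 0" "bmax > 0"
    and Nb: "\<And>u. u0 \<le> \<bar>u\<bar> \<Longrightarrow> cmod (Phi fe u) \<le> bmax * \<bar>u\<bar> powr \<gamma>' * exp (- \<beta> * \<bar>u\<bar> powr s)"
    using N_right by blast
  define C p V0 where "C = B + bmax" and "p = \<bar>\<gamma>1\<bar> + \<bar>\<gamma>'\<bar>" and "V0 = max 1 (max u0 u1)"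
  have le: "c * \<bar>u\<bar> powr \<gamma> * exp (- \<beta> * \<bar>u\<bar> powr s) \<le> C * R powr p * exp (- \<beta> * V powr s)"
    if "V0 \<le> V" "V \<le> \<bar>u\<bar>" "\<bar>u\<bar> \<le> R" "0 < c" "c \<le> C" "\<bar>\<gamma>\<bar> \<le> p" for c \<gamma> u V R
  proof -
    have V: "1 \<le> V" using that by (simp add: V0_def)
    have "\<bar>u\<bar> powr \<gamma> \<le> R powr p" using that V by (intro powr_le_powr_abs) auto
    moreover have "V powr s \<le> \<bar>u\<bar> powr s" using that V s by (intro powr_mono2) auto
    ultimately show ?thesis using that \<beta> by (intro mult_mono) auto
  qed
  show ?thesis
  proof (rule that[of C p V0])
    show "0 < C" "0 \<le> p" "1 \<le> V0" using u0 u1 by (auto simp: C_def p_def V0_def)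
    fix V R u assume *: "V0 \<le> V" "V \<le> \<bar>u\<bar>" "\<bar>u\<bar> \<le> R"
    then have "cmod (Phi fe u) \<le> bmax * \<bar>u\<bar> powr \<gamma>' * exp (- \<beta> * \<bar>u\<bar> powr s)"
      by (intro Nb) (auto simp: V0_def)
    also have "\<dots> \<le> C * R powr p * exp (- \<beta> * V powr s)"
      by (rule le) (use * u0 u1 in \<open>auto simp: C_def p_def\<close>)
    finally show "cmod (Phi fe u) \<le> C * R powr p * exp (- \<beta> * V powr s)" .
  next
    fix V R u v assume *: "V0 \<le> V" "V \<le> \<bar>u\<bar>" "\<bar>u\<bar> \<le> R" "V \<le> \<bar>v\<bar>" "\<bar>v\<bar> \<le> R" "0 < u * v"
    have V: "1 \<le> V" "u1 \<le> V" using * by (auto simp: V0_def)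
    \<comment> \<open>The mean value inequality needs an interval on which the derivative bound
      holds. Equal signs of \<open>u\<close> and \<open>v\<close> keep it away from 0, where nothing
      is assumed.\<close>
    have ex: "\<exists>I. convex I \<and> u \<in> I \<and> v \<in> I \<and> (\<forall>w\<in>I. V \<le> \<bar>w\<bar> \<and> \<bar>w\<bar> \<le> R)"
    proof (cases "0 < u")
      case True
      then have "0 < v" using * by (simp add: zero_less_mult_iff)
      then show ?thesis using True * V by (intro exI[of _ "{V..R}"]) auto
    next
      case False
      then have "u < 0" "v < 0" using * by (auto simp: zero_less_mult_iff)
      then show ?thesis using * V by (intro exI[of _ "{-R..-V}"]) auto
    qed
    then obtain I where I: "convex I" "u \<in> I" "v \<in> I" "\<And>w. w \<in> I \<Longrightarrow> V \<le> \<bar>w\<bar>" "\<And>w. w \<in> I \<Longrightarrow> \<bar>w\<bar> \<le> R"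
      by auto
    have "norm (Phi fe u - Phi fe v) \<le> C * R powr p * exp (- \<beta> * V powr s) * norm (u - v)"
    proof (rule differentiable_bound[OF I(1) _ _ I(2,3)])
      fix w assume w: "w \<in> I"
      have sub: "I \<subseteq> {v. u1 \<le> \<bar>v\<bar>}" using I(4) V by force
      have w1: "u1 \<le> \<bar>w\<bar>" using sub w by auto
      show "(Phi fe has_derivative (\<lambda>x. x *\<^sub>R D1 w)) (at w within I)"
        using has_vector_derivative_within_subset[OF D1[OF w1] sub] by (simp add: has_vector_derivative_def)
      have "onorm (\<lambda>x. x *\<^sub>R D1 w) = cmod (D1 w)"
        using onorm_scaleR_left[OF bounded_linear_ident, of "D1 w"] by (simp add: onorm_id)
      also have "\<dots> \<le> B * \<bar>w\<bar> powr \<gamma>1 * exp (- \<beta> * \<bar>w\<bar> powr s)" using D1b[OF w1] by simp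
      also have "\<dots> \<le> C * R powr p * exp (- \<beta> * V powr s)"
        by (rule le) (use * u0 u1 I(4,5)[OF w] in \<open>auto simp: C_def p_def\<close>)
      finally show "onorm (\<lambda>x. x *\<^sub>R D1 w) \<le> C * R powr p * exp (- \<beta> * V powr s)" .
    qed
    then show "cmod (Phi fe u - Phi fe v) \<le> C * R powr p * exp (- \<beta> * V powr s) * \<bar>u - v\<bar>" by simp
  qed
qed

section \<open>The bandwidth equation and the cut-off frequency\<close>

text \<open>The left-hand side \<open>F\<close> decreases strictly and continuously from infinity to
  0, so every positive value is attained exactly once and the definite description in
  \<open>h_star\<close> is meaningful.\<close>

lemma h_star_eq:
  assumes "0 < \<alpha>" "0 < \<beta>" "0 < r" "0 < s" and v: "0 < ln (real n) - (ln (ln (real n)))\<^sup>2"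
  shows "0 < h_star \<alpha> \<beta> r s n"
    "2 * \<beta> / h_star \<alpha> \<beta> r s n powr s + 2 * \<alpha> / h_star \<alpha> \<beta> r s n powr r = ln (real n) - (ln (ln (real n)))\<^sup>2"
proof -
  let ?v = "ln (real n) - (ln (ln (real n)))\<^sup>2"
  define F where "F h = 2 * \<beta> / h powr s + 2 * \<alpha> / h powr r" for h :: real
  have anti: "F h' < F h" if "0 < h" "h < h'" for h h'
    unfolding F_def using that assms
    by (intro add_strict_mono divide_strict_left_mono powr_less_mono2 mult_pos_pos) auto
  have "\<exists>h>0. F h = ?v"
  proof -
    have "filterlim (\<lambda>h. 2 * \<beta> / h powr s) at_top (at_right 0)" using assms(2,4) by real_asymp
    then have "filterlim F at_top (at_right 0)"
      by (rule filterlim_at_top_mono) (use assms(1) in \<open>auto simp: F_def\<close>)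
    then have "eventually (\<lambda>h. ?v < F h) (at_right 0)" by (simp add: filterlim_at_top_dense)
    from eventually_happens'[OF trivial_limit_at_right_real eventually_conj[OF eventually_at_right_less this]]
    obtain h1 where h1: "0 < h1" "?v < F h1" by blast
    have "((\<lambda>h. 2 * \<beta> / h powr s) \<longlongrightarrow> 0) at_top" "((\<lambda>h. 2 * \<alpha> / h powr r) \<longlongrightarrow> 0) at_top"
      using assms(1-4) by real_asymp+
    then have "(F \<longlongrightarrow> 0) at_top"
      unfolding F_def by (rule tendsto_add_zero)
    then have "eventually (\<lambda>h. F h < ?v) at_top" using v by (rule order_tendstoD(2))
    from eventually_happens'[OF trivial_limit_at_top_linorder eventually_conj[OF eventually_gt_at_top[of h1] this]]
    obtain h2 where h2: "h1 < h2" "F h2 < ?v" by blast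
    have "continuous_on {h1..h2} F"
      unfolding F_def using h1 by (intro continuous_intros) auto
    then obtain h where "h1 \<le> h" "F h = ?v" using IVT2'[of F h2 ?v h1] h1 h2 by auto
    then show ?thesis using h1 by (intro exI[of _ h]) auto
  qed
  then obtain h where h: "0 < h" "F h = ?v" by blast
  have "h' = h" if "0 < h'" "F h' = ?v" for h'
    using anti[of h h'] anti[of h' h] that h by (cases h h' rule: linorder_cases) auto
  then have "(THE h. 0 < h \<and> F h = ?v) = h"
    using h by (intro the_equality) blast+
  then have "h_star \<alpha> \<beta> r s n = h" by (simp only: h_star_def F_def)
  then show "0 < h_star \<alpha> \<beta> r s n"
    "2 * \<beta> / h_star \<alpha> \<beta> r s n powr s + 2 * \<alpha> / h_star \<alpha> \<beta> r s n powr r = ?v"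
    using h by (auto simp: F_def)
qed

definition freq :: "real \<Rightarrow> real \<Rightarrow> real \<Rightarrow> real \<Rightarrow> nat \<Rightarrow> real" where
  "freq \<alpha> \<beta> r s n = 1 / h_star \<alpha> \<beta> r s n"

lemma freq_eq:
  assumes "0 < \<alpha>" "0 < \<beta>" "0 < r" "0 < s" and v: "0 < ln (real n) - (ln (ln (real n)))\<^sup>2"
  shows "0 < freq \<alpha> \<beta> r s n"
    "2 * \<beta> * freq \<alpha> \<beta> r s n powr s + 2 * \<alpha> * freq \<alpha> \<beta> r s n powr r = ln (real n) - (ln (ln (real n)))\<^sup>2"
  using h_star_eq[OF assms] by (simp_all add: freq_def powr_divide)

lemma filterlim_log_minus_loglog_sq: "filterlim (\<lambda>n. ln (real n) - (ln (ln (real n)))\<^sup>2) at_top sequentially"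
  by real_asymp

text \<open>The left-hand side of the equation increases with the frequency. A frequency below
  \<open>M\<close> would keep it below its value at \<open>M\<close>, whereas the right-hand side
  tends to infinity.\<close>

lemma filterlim_freq:
  assumes "0 < \<alpha>" "0 < \<beta>" "0 < r" "0 < s"
  shows "filterlim (freq \<alpha> \<beta> r s) at_top sequentially"
  unfolding filterlim_at_top_gt[of _ _ 0]
proof (intro allI impI)
  fix M :: real assume M: "0 < M"
  have "eventually (\<lambda>n. max 0 (2 * \<beta> * M powr s + 2 * \<alpha> * M powr r) < ln (real n) - (ln (ln (real n)))\<^sup>2) sequentially"
    using filterlim_log_minus_loglog_sq unfolding filterlim_at_top_dense by blast
  then show "eventually (\<lambda>n. M \<le> freq \<alpha> \<beta> r s n) sequentially"
  proof eventually_elim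
    case (elim n)
    then have v: "0 < ln (real n) - (ln (ln (real n)))\<^sup>2" by simp
    note f = freq_eq[OF assms v]
    show ?case
    proof (rule ccontr)
      assume "\<not> M \<le> freq \<alpha> \<beta> r s n"
      then have "2 * \<beta> * freq \<alpha> \<beta> r s n powr s + 2 * \<alpha> * freq \<alpha> \<beta> r s n powr r \<le> 2 * \<beta> * M powr s + 2 * \<alpha> * M powr r"
        using f(1) assms by (intro add_mono mult_left_mono powr_mono2) auto
      then show False using f(2) elim by simp
    qed
  qed
qed

section \<open>Growth of powers just beyond the cut-off\<close>

text \<open>A Bernoulli inequality with half the slope, which makes it valid for exponents below 1
  as well: ln (1 + t) \<ge> t - t^2 \<ge> t / 2 on this range.\<close>

lemma one_plus_powr_lower:
  fixes t s :: real
  assumes "0 \<le> t" "t \<le> 1 / 2" "0 < s"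
  shows "1 + s * t / 2 \<le> (1 + t) powr s"
proof -
  have "t * t \<le> t * (1 / 2)" using assms by (intro mult_left_mono) auto
  then have "t / 2 \<le> t - t\<^sup>2" by (simp add: power2_eq_square)
  also have "\<dots> \<le> ln (1 + t)" using assms by (intro ln_one_plus_pos_lower_bound) auto
  finally have "s * (t / 2) \<le> s * ln (1 + t)" using assms by (intro mult_left_mono) auto
  then have "1 + s * t / 2 \<le> 1 + s * ln (1 + t)" by simp
  also have "\<dots> \<le> exp (s * ln (1 + t))" by (rule exp_ge_add_one_self)
  also have "\<dots> = (1 + t) powr s" using assms by (simp add: powr_def)
  finally show ?thesis .
qed

lemma one_plus_powr_upper:
  fixes t r :: real
  assumes "0 \<le> t" "r * t \<le> 1" "0 < r"
  shows "(1 + t) powr r \<le> 1 + r * t + (r * t)\<^sup>2"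
proof -
  have "(1 + t) powr r = exp (r * ln (1 + t))" using assms by (simp add: powr_def)
  also have "\<dots> \<le> exp (r * t)" using assms by (auto intro!: mult_left_mono ln_add_one_self_le_self)
  also have "\<dots> \<le> 1 + r * t + (r * t)\<^sup>2" using assms by (intro exp_bound) auto
  finally show ?thesis .
qed

definition width :: "real \<Rightarrow> real \<Rightarrow> real \<Rightarrow> real" where
  "width \<eta> r U = \<eta> * U powr (1 - r)"

text \<open>The factor \<open>U powr (r - 1)\<close> offsets the width of the support, which makes the weighted \<open>L\<^sub>2\<close> norm of
  the perturbation asymptotically constant.\<close>

definition amp :: "real \<Rightarrow> real \<Rightarrow> real \<Rightarrow> real \<Rightarrow> real" where
  "amp \<kappa> \<alpha> r U = sqrt (\<kappa> * U powr (r - 1)) * exp (- \<alpha> * U powr r)"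

lemma amp_square: "0 < \<kappa> \<Longrightarrow> 0 < U \<Longrightarrow> (amp \<kappa> \<alpha> r U)\<^sup>2 = \<kappa> * U powr (r - 1) * exp (- 2 * \<alpha> * U powr r)"
  by (simp add: amp_def power_mult_distrib exp_double[symmetric])

lemma width_eq: "0 < U \<Longrightarrow> U + w * width \<eta> r U = U * (1 + w * \<eta> * U powr (- r))"
  by (simp add: width_def distrib_left powr_diff powr_minus divide_inverse)

lemma tendsto_powr_neg: "0 < r \<Longrightarrow> ((\<lambda>U::real. c * U powr (- r)) \<longlongrightarrow> 0) at_top"
  by real_asymp

text \<open>The relative displacement of the edge is \<open>\<eta> * U powr (- r)\<close>. To first
  order it adds \<open>s * \<eta> * U powr (s - r)\<close> to \<open>U powr s\<close>, and half of
  that is kept. For r < s the gain is unbounded, which drives the chi-square estimate.\<close>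

lemma eventually_edge_powr_lower:
  assumes "0 < r" "0 < s" "0 < \<eta>"
  shows "eventually (\<lambda>U. U powr s + s * \<eta> / 2 * U powr (s - r) \<le> (U + width \<eta> r U) powr s) at_top"
proof -
  have "eventually (\<lambda>U. \<eta> * U powr (- r) < 1 / 2) at_top"
    using order_tendstoD(2)[OF tendsto_powr_neg[OF assms(1), of \<eta>], of "1 / 2"] by simp
  then show ?thesis using eventually_gt_at_top[of 0]
  proof eventually_elim
    case (elim U)
    have "U powr s * (1 + s * (\<eta> * U powr (- r)) / 2) \<le> U powr s * (1 + \<eta> * U powr (- r)) powr s"
      using elim assms by (intro mult_left_mono one_plus_powr_lower) auto
    also have "\<dots> = (U * (1 + \<eta> * U powr (- r))) powr s"
      using elim assms by (subst powr_mult) auto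
    also have "U * (1 + \<eta> * U powr (- r)) = U + width \<eta> r U"
      using width_eq[of U 1 \<eta> r] elim by simp
    finally show ?case
      by (simp add: algebra_simps powr_add[symmetric])
  qed
qed

text \<open>With exponent \<open>r\<close> instead of \<open>s\<close> the same displacement adds
  only a bounded amount. Uniformly over the support, the class weight is its value at
  \<open>U\<close> times exp (2 \<alpha> r \<eta> w), up to a factor close to 1.\<close>

lemma eventually_powr_upper:
  assumes "0 < r" "0 < \<eta>" "0 < W" "0 < e"
  shows "eventually (\<lambda>U. \<forall>w. 0 \<le> w \<and> w \<le> W \<longrightarrow> (U + width \<eta> r U * w) powr r \<le> U powr r + r * \<eta> * w + e) at_top"
proof -
  have "eventually (\<lambda>U. r * W * \<eta> * U powr (- r) < 1) at_top"
    using order_tendstoD(2)[OF tendsto_powr_neg[OF assms(1), of "r * W * \<eta>"], of 1] by simp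
  moreover have "eventually (\<lambda>U. (r * W * \<eta>)\<^sup>2 * U powr (- r) < e) at_top"
    using order_tendstoD(2)[OF tendsto_powr_neg[OF assms(1), of "(r * W * \<eta>)\<^sup>2"], of e] assms by simp
  ultimately show ?thesis using eventually_gt_at_top[of 0]
  proof eventually_elim
    case (elim U)
    show ?case
    proof (intro allI impI)
      fix w assume w: "0 \<le> w \<and> w \<le> W"
      let ?t = "w * \<eta> * U powr (- r)"
      have le: "r * ?t \<le> r * W * \<eta> * U powr (- r)"
        using w assms by (simp add: mult.assoc mult_mono)
      have t: "0 \<le> ?t" using w assms elim by simp
      have t1: "r * ?t \<le> 1" using le elim(1) by linarith
      have "(U + width \<eta> r U * w) powr r = (U * (1 + ?t)) powr r"
        using width_eq[of U w \<eta> r] elim by (simp add: mult.commute)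
      also have "\<dots> = U powr r * (1 + ?t) powr r"
        using elim t by (subst powr_mult) auto
      also have "\<dots> \<le> U powr r * (1 + r * ?t + (r * ?t)\<^sup>2)"
        using t t1 assms by (intro mult_left_mono one_plus_powr_upper) auto
      also have "\<dots> = U powr r + r * \<eta> * w * (U powr r * U powr (- r)) + (r * w * \<eta>)\<^sup>2 * U powr (- r) * (U powr r * U powr (- r))"
        by (simp add: algebra_simps power2_eq_square)
      also have "U powr r * U powr (- r) = 1" using elim by (simp add: powr_add[symmetric])
      also have "(r * w * \<eta>)\<^sup>2 * U powr (- r) * 1 \<le> (r * W * \<eta>)\<^sup>2 * U powr (- r)"
        using w assms by (auto intro!: mult_right_mono power_mono)
      finally show "(U + width \<eta> r U * w) powr r \<le> U powr r + r * \<eta> * w + e" using elim by simp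
    qed
  qed
qed

text \<open>The square \<open>(c + s * ln U)\<^sup>2\<close> stands for (log log n)^2 expressed
  through the frequency; any positive power of \<open>U\<close> outgrows it.\<close>

lemma tendsto_exp_loglog:
  assumes "0 < q" "0 < e" "0 < s"
  shows "((\<lambda>U::real. K * (U powr p * exp ((c + s * ln U)\<^sup>2 - e * U powr q))) \<longlongrightarrow> 0) at_top"
  using assms by real_asymp

lemma tendsto_powr_exp_0:
  assumes "0 < q" "0 < e"
  shows "((\<lambda>U::real. K * (U powr p * exp (- e * U powr q))) \<longlongrightarrow> 0) at_top"
  using assms by real_asymp

text \<open>The amplitude carries \<open>exp (- \<alpha> * U powr r)\<close> and all other factors
  grow at most polynomially, so bounding each of them by a multiple of \<open>U\<close> is
  enough.\<close>

lemma eventually_pert_small: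
  assumes "0 < \<alpha>" "0 < r" "r \<le> 2" "0 < \<eta>" "0 < \<kappa>" "0 < c0" "0 \<le> S"
  shows "eventually (\<lambda>U. 2 * amp \<kappa> \<alpha> r U * S * (width \<eta> r U + 1 / width \<eta> r U) \<le> c0) at_top"
proof -
  have "eventually (\<lambda>U. 2 * S * sqrt \<kappa> * (\<eta> + 1 / \<eta>) * (U powr 2 * exp (- \<alpha> * U powr r)) < c0) at_top"
    by (rule order_tendstoD(2)[OF tendsto_powr_exp_0 \<open>0 < c0\<close>]) (use assms in auto)
  then show ?thesis using eventually_ge_at_top[of 1]
  proof eventually_elim
    case (elim U)
    have p: "U powr a \<le> U" if "a \<le> 1" for a using elim that powr_mono[of a 1 U] by simp
    have "sqrt (U powr (r - 1)) \<le> U"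
    proof -
      have "sqrt (U powr (r - 1)) = U powr ((r - 1) / 2)" using elim by (simp add: powr_half_sqrt[symmetric] powr_powr)
      then show ?thesis using p[of "(r - 1) / 2"] assms by simp
    qed
    then have a: "amp \<kappa> \<alpha> r U \<le> sqrt \<kappa> * U * exp (- \<alpha> * U powr r)"
      using assms by (simp add: amp_def real_sqrt_mult mult_left_mono)
    have "1 / width \<eta> r U = 1 / \<eta> * U powr (r - 1)"
      using elim by (simp add: width_def powr_diff)
    then have w: "width \<eta> r U + 1 / width \<eta> r U \<le> (\<eta> + 1 / \<eta>) * U"
      using p[of "1 - r"] p[of "r - 1"] assms unfolding width_def distrib_right
      by (auto intro!: add_mono mult_left_mono divide_right_mono)
    have "2 * amp \<kappa> \<alpha> r U * S * (width \<eta> r U + 1 / width \<eta> r U)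
        \<le> 2 * (sqrt \<kappa> * U * exp (- \<alpha> * U powr r)) * S * ((\<eta> + 1 / \<eta>) * U)"
      using a w assms elim by (intro mult_mono) (auto simp: amp_def width_def)
    also have "\<dots> = 2 * S * sqrt \<kappa> * (\<eta> + 1 / \<eta>) * (U powr 2 * exp (- \<alpha> * U powr r))"
      using elim by (simp add: power2_eq_square algebra_simps)
    finally show ?case using elim by simp
  qed
qed

section \<open>Asymptotics\<close>

text \<open>The normalisation of \<open>amp\<close> and \<open>width\<close> makes 2 A^2 d exp (2
  \<alpha> U^r) equal to 2 \<kappa> \<eta>, independently of \<open>U\<close>. What remains is the
  weighted energy \<open>K\<close> of the profile times exp (2 \<alpha> e), where \<open>e\<close>
  is the error in the expansion of the weight.\<close>

lemma eventually_class_bound: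
  assumes \<alpha>: "0 < \<alpha>" and r: "0 < r" and \<eta>: "0 < \<eta>" and \<kappa>: "0 < \<kappa>" and b: "\<And>k. 0 \<le> b k"
    and K: "(\<integral>\<^sup>+w. ennreal ((prof N b w)\<^sup>2 * exp (2 * \<alpha> * r * \<eta> * w)) \<partial>lborel) \<le> ennreal K" "0 \<le> K"
    and M: "2 * \<kappa> * \<eta> * K < M"
  shows "eventually (\<lambda>U. (\<integral>\<^sup>+u. ennreal ((pert_hat N b (amp \<kappa> \<alpha> r U) U (width \<eta> r U) u)\<^sup>2 * exp (2 * \<alpha> * \<bar>u\<bar> powr r)) \<partial>lborel) \<le> ennreal M) at_top"
proof -
  \<comment> \<open>The strict inequality in \<open>M\<close> leaves room for a small positive
    expansion error \<open>e\<close>.\<close>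
  have "((\<lambda>e. 2 * \<kappa> * \<eta> * K * exp (2 * \<alpha> * e)) \<longlongrightarrow> 2 * \<kappa> * \<eta> * K * exp (2 * \<alpha> * 0)) (at_right 0)"
    by (intro tendsto_intros)
  then have "eventually (\<lambda>e. 2 * \<kappa> * \<eta> * K * exp (2 * \<alpha> * e) < M) (at_right 0)"
    using M by (intro order_tendstoD(2)) auto
  from eventually_happens'[OF trivial_limit_at_right_real eventually_conj[OF eventually_at_right_less this]]
  obtain e where e: "0 < e" "2 * \<kappa> * \<eta> * K * exp (2 * \<alpha> * e) < M" by blast
  have "eventually (\<lambda>U. \<forall>w. 0 \<le> w \<and> w \<le> real N + 2 \<longrightarrow> (U + width \<eta> r U * w) powr r \<le> U powr r + r * \<eta> * w + e) at_top"
    using r \<eta> e by (intro eventually_powr_upper) auto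
  then show ?thesis using eventually_ge_at_top[of 1]
  proof eventually_elim
    case (elim U)
    let ?d = "width \<eta> r U" and ?A = "amp \<kappa> \<alpha> r U"
    let ?P = "prof N b"
    note [measurable] = measurable_prof[OF b, of N]
    have d: "0 < ?d" and A: "0 \<le> ?A" using elim \<eta> \<kappa> by (auto simp: width_def amp_def)
    have up: "U powr (r - 1) * U powr (1 - r) = 1" using elim by (simp add: powr_add[symmetric])
    have "2 * ?A\<^sup>2 * ?d * exp (2 * \<alpha> * (U powr r + e)) = 2 * \<kappa> * \<eta> * (U powr (r - 1) * U powr (1 - r)) *
        (exp (- 2 * \<alpha> * U powr r) * exp (2 * \<alpha> * (U powr r + e)))"
      using elim \<kappa> by (simp add: amp_square width_def)
    also have "\<dots> = 2 * \<kappa> * \<eta> * exp (2 * \<alpha> * e)"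
      unfolding up exp_add[symmetric] by (simp add: algebra_simps)
    finally have Ad: "2 * ?A\<^sup>2 * ?d * exp (2 * \<alpha> * (U powr r + e)) = 2 * \<kappa> * \<eta> * exp (2 * \<alpha> * e)" .
    have "(\<integral>\<^sup>+u. ennreal ((pert_hat N b ?A U ?d u)\<^sup>2 * exp (2 * \<alpha> * \<bar>u\<bar> powr r)) \<partial>lborel)
       = ennreal (2 * ?A\<^sup>2 * ?d) * (\<integral>\<^sup>+w. ennreal ((?P w)\<^sup>2 * exp (2 * \<alpha> * \<bar>U + ?d * w\<bar> powr r)) \<partial>lborel)"
      using nn_integral_pert_hat[OF b A _ d, of U "\<lambda>v. exp (2 * \<alpha> * v powr r)" N] elim by simp
    also have "\<dots> \<le> ennreal (2 * ?A\<^sup>2 * ?d) * (\<integral>\<^sup>+w. ennreal (exp (2 * \<alpha> * (U powr r + e))) * ennreal ((?P w)\<^sup>2 * exp (2 * \<alpha> * r * \<eta> * w)) \<partial>lborel)"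
    proof (intro mult_left_mono nn_integral_mono)
      fix w
      show "ennreal ((?P w)\<^sup>2 * exp (2 * \<alpha> * \<bar>U + ?d * w\<bar> powr r))
          \<le> ennreal (exp (2 * \<alpha> * (U powr r + e))) * ennreal ((?P w)\<^sup>2 * exp (2 * \<alpha> * r * \<eta> * w))"
      proof (cases "0 \<le> w \<and> w \<le> real N + 2")
        case True
        then have "(U + ?d * w) powr r \<le> U powr r + r * \<eta> * w + e" using elim by blast
        moreover have "\<bar>U + ?d * w\<bar> = U + ?d * w" using True d elim by simp
        ultimately have "2 * \<alpha> * \<bar>U + ?d * w\<bar> powr r \<le> 2 * \<alpha> * (U powr r + r * \<eta> * w + e)"
          using \<alpha> by (intro mult_left_mono) auto
        then have "exp (2 * \<alpha> * \<bar>U + ?d * w\<bar> powr r) \<le> exp (2 * \<alpha> * (U powr r + e)) * exp (2 * \<alpha> * r * \<eta> * w)"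
          unfolding exp_add[symmetric] by (simp add: algebra_simps)
        then have "(?P w)\<^sup>2 * exp (2 * \<alpha> * \<bar>U + ?d * w\<bar> powr r) \<le> (?P w)\<^sup>2 * (exp (2 * \<alpha> * (U powr r + e)) * exp (2 * \<alpha> * r * \<eta> * w))"
          by (rule mult_left_mono) simp
        then show ?thesis by (subst ennreal_mult'[symmetric]) (auto intro!: ennreal_leI simp: mult.left_commute)
      next
        case False
        then have "?P w = 0" by (intro prof_eq_0[OF b]) auto
        then show ?thesis by simp
      qed
    qed simp
    also have "\<dots> = ennreal (2 * ?A\<^sup>2 * ?d) * (ennreal (exp (2 * \<alpha> * (U powr r + e))) * (\<integral>\<^sup>+w. ennreal ((?P w)\<^sup>2 * exp (2 * \<alpha> * r * \<eta> * w)) \<partial>lborel))"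
      by (subst nn_integral_cmult) auto
    also have "\<dots> \<le> ennreal (2 * ?A\<^sup>2 * ?d) * (ennreal (exp (2 * \<alpha> * (U powr r + e))) * ennreal K)"
      by (intro mult_left_mono K) auto
    also have "\<dots> = ennreal (2 * ?A\<^sup>2 * ?d * exp (2 * \<alpha> * (U powr r + e)) * K)"
      using d K by (simp add: ennreal_mult'[symmetric] mult.assoc)
    also have "\<dots> \<le> ennreal M"
      unfolding Ad using e by (intro ennreal_leI) (simp add: mult_ac)
    finally show ?case .
  qed
qed

text \<open>By the bandwidth equation n = exp (2 \<beta> U^s + 2 \<alpha> U^r + (log log n)^2). The
  squared amplitude cancels the \<alpha> term and the squared noise bound the \<beta> term, leaving
  (log log n)^2 and powers of \<open>U\<close> against the edge gain exp (- \<beta> s \<eta> U^(s -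
  r)). Hence n times the chi-square bound X tends to 0, and (1 + X)^n \<le> exp (n X).\<close>

lemma eventually_chi_bound:
  assumes \<alpha>: "0 < \<alpha>" and \<beta>: "0 < \<beta>" and r: "0 < r" and rs: "r < s" and s: "s \<le> 2" and \<eta>: "0 < \<eta>" and \<kappa>: "0 < \<kappa>"
    and S: "0 \<le> S" and C: "0 < C" and p: "0 \<le> p" and c1: "0 < c1" and \<tau>: "0 < \<tau>"
  shows "eventually (\<lambda>n. let U = freq \<alpha> \<beta> r s n; d = width \<eta> r U; R = U + (real N + 2) * d;
       Q = C * R powr p * exp (- \<beta> * (U + d) powr s) in
       (1 + 8 / pi * (R + 1) * (amp \<kappa> \<alpha> r U * S * Q * (1 + 1 / d))\<^sup>2 / c1) ^ n \<le> 1 + \<tau>\<^sup>2) sequentially"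
proof -
  have s0: "0 < s" using r rs by simp
  define c where "c = ln (4 * (\<alpha> + \<beta>))"
  \<comment> \<open>Collects all constants: 3 from R + 1 \<le> 3 U and \<open>2 powr (2 * p)\<close>
    from R \<le> 2 U. The exponent 2 p + 4 below counts 2 p from the noise bound, 1 from R + 1, 1
    from the squared amplitude and 2 from (1 + 1 / d)^2.\<close>
  define K where "K = 8 / pi * 3 * S\<^sup>2 * C\<^sup>2 * 2 powr (2 * p) * \<kappa> * (1 + 1 / \<eta>)\<^sup>2 / c1"
  let ?\<Psi> = "\<lambda>U. K * (U powr (2 * p + 4) * exp ((c + s * ln U)\<^sup>2 - \<beta> * s * \<eta> * U powr (s - r)))"
  let ?U = "freq \<alpha> \<beta> r s"
  have lim: "filterlim ?U at_top sequentially" by (rule filterlim_freq[OF \<alpha> \<beta> r s0])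
  have "(?\<Psi> \<longlongrightarrow> 0) at_top"
    using \<beta> s0 \<eta> rs by (intro tendsto_exp_loglog) auto
  then have "eventually (\<lambda>U. ?\<Psi> U < ln (1 + \<tau>\<^sup>2)) at_top"
    using \<tau> by (intro order_tendstoD(2)) (auto simp: ln_gt_zero)
  moreover have "eventually (\<lambda>U. U powr s + s * \<eta> / 2 * U powr (s - r) \<le> (U + width \<eta> r U) powr s) at_top"
    by (rule eventually_edge_powr_lower[OF r s0 \<eta>])
  moreover have "eventually (\<lambda>U. (real N + 2) * \<eta> * U powr (- r) < 1) at_top"
    using order_tendstoD(2)[OF tendsto_powr_neg[OF r, of "(real N + 2) * \<eta>"], of 1] by simp
  ultimately have "eventually (\<lambda>U. 1 \<le> U \<and> ?\<Psi> U < ln (1 + \<tau>\<^sup>2) \<and> U powr s + s * \<eta> / 2 * U powr (s - r) \<le> (U + width \<eta> r U) powr s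
      \<and> (real N + 2) * \<eta> * U powr (- r) < 1) at_top"
    using eventually_ge_at_top[of 1] by eventually_elim auto
  from eventually_compose_filterlim[OF this lim]
  have ev1: "eventually (\<lambda>n. 1 \<le> ?U n \<and> ?\<Psi> (?U n) < ln (1 + \<tau>\<^sup>2) \<and> ?U n powr s + s * \<eta> / 2 * ?U n powr (s - r) \<le> (?U n + width \<eta> r (?U n)) powr s
      \<and> (real N + 2) * \<eta> * ?U n powr (- r) < 1) sequentially" .
  have ev2: "eventually (\<lambda>n. 0 < ln (real n) - (ln (ln (real n)))\<^sup>2) sequentially"
    using filterlim_log_minus_loglog_sq unfolding filterlim_at_top_dense by blast
  \<comment> \<open>Makes the right-hand side of the bandwidth equation at least half of ln n. This
    gives ln n \<le> 4 (\<alpha> + \<beta>) U^s, and taking logarithms yields the constant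
    \<open>c\<close>.\<close>
  have ev3: "eventually (\<lambda>n. (ln (ln (real n)))\<^sup>2 \<le> ln (real n) / 2) sequentially" by real_asymp
  \<comment> \<open>Ensures that log log n is nonnegative, so that its upper bound may be
    squared.\<close>
  have ev4: "eventually (\<lambda>n. 1 \<le> ln (real n)) sequentially" by real_asymp
  show ?thesis
    using ev1 ev2 ev3 ev4 eventually_gt_at_top[of 0]
  proof eventually_elim
    case (elim n)
    define U where "U = ?U n"
    define d where "d = width \<eta> r U"
    define R where "R = U + (real N + 2) * d"
    define Q where "Q = C * R powr p * exp (- \<beta> * (U + d) powr s)"
    define X where "X = 8 / pi * (R + 1) * (amp \<kappa> \<alpha> r U * S * Q * (1 + 1 / d))\<^sup>2 / c1"
    have U: "1 \<le> U" "?\<Psi> U < ln (1 + \<tau>\<^sup>2)" "U powr s + s * \<eta> / 2 * U powr (s - r) \<le> (U + d) powr s"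
      "(real N + 2) * \<eta> * U powr (- r) < 1"
      using elim(1) by (auto simp: U_def d_def)
    have d: "0 < d" using U \<eta> by (simp add: d_def width_def)
    have E: "2 * \<beta> * U powr s + 2 * \<alpha> * U powr r = ln (real n) - (ln (ln (real n)))\<^sup>2"
      unfolding U_def by (rule freq_eq[OF \<alpha> \<beta> r s0 elim(2)])
    have R: "R \<le> 2 * U" "R + 1 \<le> 3 * U" "1 \<le> R"
    proof -
      have "R = U * (1 + (real N + 2) * \<eta> * U powr (- r))"
        unfolding R_def d_def using U by (intro width_eq) auto
      also have "\<dots> \<le> U * (1 + 1)" using U by (intro mult_left_mono) auto
      finally show "R \<le> 2 * U" by simp
      then show "R + 1 \<le> 3 * U" using U by simp
      show "1 \<le> R" using U d by (simp add: R_def add_increasing2)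
    qed
    have "ln (real n) \<le> 2 * (2 * \<beta> * U powr s + 2 * \<alpha> * U powr r)" using E elim by simp
    also have "\<dots> \<le> 2 * (2 * \<beta> * U powr s + 2 * \<alpha> * U powr s)"
      using U rs \<alpha> by (intro mult_left_mono add_mono powr_mono order_refl) auto
    also have "\<dots> = 4 * (\<alpha> + \<beta>) * U powr s" by (simp add: algebra_simps)
    finally have le: "ln (real n) \<le> 4 * (\<alpha> + \<beta>) * U powr s" .
    have "0 < ln (real n)" "0 < 4 * (\<alpha> + \<beta>) * U powr s" using le elim(4) by linarith+
    then have "ln (ln (real n)) \<le> ln (4 * (\<alpha> + \<beta>) * U powr s)"
      using le by (simp only: ln_le_cancel_iff)
    also have "\<dots> = c + s * ln U"
      using \<alpha> \<beta> U by (simp add: c_def ln_mult ln_powr)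
    finally have "(ln (ln (real n)))\<^sup>2 \<le> (c + s * ln U)\<^sup>2"
      using elim(4) by (intro power_mono) (simp_all only: ln_ge_zero)
    then have "ln (real n) \<le> 2 * \<beta> * U powr s + 2 * \<alpha> * U powr r + (c + s * ln U)\<^sup>2"
      using E by linarith
    then have "exp (ln (real n)) \<le> exp (2 * \<beta> * U powr s + 2 * \<alpha> * U powr r + (c + s * ln U)\<^sup>2)"
      by (simp only: exp_le_cancel_iff)
    then have n: "real n \<le> exp (2 * \<beta> * U powr s + 2 * \<alpha> * U powr r + (c + s * ln U)\<^sup>2)"
      using elim(5) by simp
    have d1: "1 + 1 / d \<le> (1 + 1 / \<eta>) * U"
    proof -
      have "1 / d = 1 / \<eta> * U powr (r - 1)" using U by (simp add: d_def width_def powr_diff)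
      also have "\<dots> \<le> 1 / \<eta> * U" using U \<eta> rs s powr_mono[of "r - 1" 1 U] by (intro mult_left_mono) auto
      finally show ?thesis using U by (simp add: distrib_right)
    qed
    have Q2: "Q\<^sup>2 \<le> C\<^sup>2 * (2 powr (2 * p) * U powr (2 * p)) * exp (- 2 * \<beta> * U powr s - \<beta> * s * \<eta> * U powr (s - r))"
    proof -
      have "Q\<^sup>2 = C\<^sup>2 * R powr (2 * p) * exp (- 2 * \<beta> * (U + d) powr s)"
        using R by (simp add: Q_def power_mult_distrib exp_double[symmetric] powr_power)
      also have "\<dots> \<le> C\<^sup>2 * (2 * U) powr (2 * p) * exp (- 2 * \<beta> * (U powr s + s * \<eta> / 2 * U powr (s - r)))"
        using R U p \<beta> C by (intro mult_mono powr_mono2) auto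
      also have "(2 * U) powr (2 * p) = 2 powr (2 * p) * U powr (2 * p)"
        by (rule powr_mult)
      also have "- 2 * \<beta> * (U powr s + s * \<eta> / 2 * U powr (s - r)) = - 2 * \<beta> * U powr s - \<beta> * s * \<eta> * U powr (s - r)"
        by (simp add: algebra_simps)
      finally show ?thesis .
    qed
    have A2: "(amp \<kappa> \<alpha> r U)\<^sup>2 \<le> \<kappa> * U * exp (- 2 * \<alpha> * U powr r)"
    proof -
      have "(amp \<kappa> \<alpha> r U)\<^sup>2 = \<kappa> * U powr (r - 1) * exp (- 2 * \<alpha> * U powr r)"
        using U \<kappa> by (intro amp_square) auto
      also have "\<dots> \<le> \<kappa> * U * exp (- 2 * \<alpha> * U powr r)"
        using U \<kappa> rs s powr_mono[of "r - 1" 1 U] by (intro mult_right_mono mult_left_mono) auto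
      finally show ?thesis .
    qed
    have X0: "0 \<le> X" using R c1 by (simp add: X_def)
    have "X = 8 / pi * (R + 1) * ((amp \<kappa> \<alpha> r U)\<^sup>2 * S\<^sup>2 * Q\<^sup>2 * (1 + 1 / d)\<^sup>2) / c1"
      by (simp add: X_def power_mult_distrib)
    also have "\<dots> \<le> 8 / pi * (3 * U) * ((\<kappa> * U * exp (- 2 * \<alpha> * U powr r)) * S\<^sup>2 *
        (C\<^sup>2 * (2 powr (2 * p) * U powr (2 * p)) * exp (- 2 * \<beta> * U powr s - \<beta> * s * \<eta> * U powr (s - r))) * ((1 + 1 / \<eta>) * U)\<^sup>2) / c1"
      using R A2 Q2 d1 U d \<kappa> c1 S C by (intro divide_right_mono mult_mono power_mono) auto
    also have "\<dots> = K * (U powr (2 * p) * U ^ 4 * (exp (- 2 * \<alpha> * U powr r) * exp (- 2 * \<beta> * U powr s - \<beta> * s * \<eta> * U powr (s - r))))"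
      by (simp add: K_def power_mult_distrib power2_eq_square power4_eq_xxxx)
    finally have X: "X \<le> K * (U powr (2 * p + 4) * exp (- 2 * \<alpha> * U powr r - 2 * \<beta> * U powr s - \<beta> * s * \<eta> * U powr (s - r)))"
      using U by (simp add: powr_add exp_add[symmetric] algebra_simps)
    have "real n * X \<le> exp (2 * \<beta> * U powr s + 2 * \<alpha> * U powr r + (c + s * ln U)\<^sup>2) *
       (K * (U powr (2 * p + 4) * exp (- 2 * \<alpha> * U powr r - 2 * \<beta> * U powr s - \<beta> * s * \<eta> * U powr (s - r))))"
      using n X X0 by (intro mult_mono) auto
    also have "\<dots> = K * (U powr (2 * p + 4) * (exp (2 * \<beta> * U powr s + 2 * \<alpha> * U powr r + (c + s * ln U)\<^sup>2) *
       exp (- 2 * \<alpha> * U powr r - 2 * \<beta> * U powr s - \<beta> * s * \<eta> * U powr (s - r))))"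
      by (simp only: mult_ac)
    also have "\<dots> = ?\<Psi> U"
      unfolding exp_add[symmetric] by (simp add: algebra_simps)
    finally have nX: "real n * X \<le> ln (1 + \<tau>\<^sup>2)" using U by linarith
    have "(1 + X) ^ n \<le> exp X ^ n" using X0 by (intro power_mono exp_ge_add_one_self) auto
    also have "\<dots> = exp (real n * X)" by (rule exp_of_nat_mult[symmetric])
    also have "\<dots> \<le> exp (ln (1 + \<tau>\<^sup>2))" using nX by simp
    also have "\<dots> = 1 + \<tau>\<^sup>2" using \<tau> by (simp add: add_pos_nonneg)
    finally show ?case by (simp add: Let_def U_def d_def R_def Q_def X_def)
  qed
qed

lemma phi2_freq:
  assumes "0 < freq \<alpha> \<beta> r s n"
  shows "phi2 \<alpha> \<beta> r s L n = L / (2 * pi * \<alpha> * r) * freq \<alpha> \<beta> r s n powr (1 - r) * exp (- 2 * \<alpha> * freq \<alpha> \<beta> r s n powr r)"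
    and "phi2_L2 \<alpha> \<beta> r s L n = L * exp (- 2 * \<alpha> * freq \<alpha> \<beta> r s n powr r)"
proof -
  let ?U = "freq \<alpha> \<beta> r s n"
  have h: "h_star \<alpha> \<beta> r s n = 1 / ?U" by (simp add: freq_def)
  have "(1 / ?U) powr (r - 1) = ?U powr (1 - r)"
    using assms powr_minus_divide[of ?U "r - 1"] by (simp add: powr_divide)
  moreover have "- 2 * \<alpha> / (1 / ?U) powr r = - 2 * \<alpha> * ?U powr r"
    using assms by (simp add: powr_divide)
  ultimately show "phi2 \<alpha> \<beta> r s L n = L / (2 * pi * \<alpha> * r) * ?U powr (1 - r) * exp (- 2 * \<alpha> * ?U powr r)"
    and "phi2_L2 \<alpha> \<beta> r s L n = L * exp (- 2 * \<alpha> * ?U powr r)"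
    by (simp_all only: phi2_def phi2_L2_def h Let_def)
qed

text \<open>Reduces the theorem to a choice of profile. If \<kappa> \<eta> K is close to pi L, the
  pointwise factor is close to 2 \<alpha> r \<eta> S^2 / K, where S is the integral of the profile;
  Cauchy-Schwarz against exp (2 \<alpha> r \<eta> w) keeps it below 1. The factor for the integrated
  error is close to the squared norm of the profile divided by K.\<close>

theorem eventually_risk_lower:
  fixes b :: "nat \<Rightarrow> real" and fe :: "real \<Rightarrow> real"
  assumes \<alpha>: "0 < \<alpha>" and L: "0 < L" and r: "0 < r" and rs: "r < s" and s: "s \<le> 2" and \<beta>: "0 < \<beta>"
    and fe: "is_density fe"
    and ND: "\<exists>u1 B \<gamma>1 D1 D2. u1 > 0 \<and> B > 0 \<and>
        (\<forall>u. u1 \<le> \<bar>u\<bar> \<longrightarrow>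
            (Phi fe has_vector_derivative D1 u) (at u within {v. u1 \<le> \<bar>v\<bar>}) \<and>
            (D1 has_vector_derivative D2 u) (at u within {v. u1 \<le> \<bar>v\<bar>}) \<and>
            max (cmod (D1 u)) (cmod (D2 u)) \<le> B * \<bar>u\<bar> powr \<gamma>1 * exp (- \<beta> * \<bar>u\<bar> powr s)) \<and>
        continuous_on {v. u1 \<le> \<bar>v\<bar>} D2"
    and N_right: "\<exists>u0 bmax \<gamma>'. u0 > 0 \<and> bmax > 0 \<and>
        (\<forall>u. u0 \<le> \<bar>u\<bar> \<longrightarrow> cmod (Phi fe u) \<le> bmax * \<bar>u\<bar> powr \<gamma>' * exp (- \<beta> * \<bar>u\<bar> powr s))"
    and b: "\<And>k. 0 \<le> b k" and \<eta>: "0 < \<eta>" and \<kappa>: "0 < \<kappa>" and \<tau>: "0 < \<tau>"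
    and K: "(\<integral>\<^sup>+w. ennreal ((prof N b w)\<^sup>2 * exp (2 * \<alpha> * r * \<eta> * w)) \<partial>lborel) \<le> ennreal K" "0 \<le> K"
    and \<kappa>K: "\<kappa> * \<eta> * K < pi * L"
  shows "eventually (\<lambda>n. 0 < phi2 \<alpha> \<beta> r s L n \<and> 0 < phi2_L2 \<alpha> \<beta> r s L n \<and>
      (\<forall>x. \<forall>T\<in>pt_estimators n.
         ennreal (\<kappa> * \<eta>\<^sup>2 * (\<Sum>k<N. b k)\<^sup>2 * (2 * \<alpha> * r) / (pi * L) * phi2 \<alpha> \<beta> r s L n) * ennreal (1 - 2 * \<tau>)
           \<le> risk_pt n fe x T (A_class \<alpha> r L)) \<and>
      (\<forall>T\<in>fun_estimators n.
         ennreal (\<kappa> * \<eta> / (pi * L) * phi2_L2 \<alpha> \<beta> r s L n) * (\<integral>\<^sup>+w. ennreal ((prof N b w)\<^sup>2) \<partial>lborel) * ennreal (1 - 2 * \<tau>)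
           \<le> risk_L2 n fe T (A_class \<alpha> r L))) sequentially"
proof -
  have s0: "0 < s" using r rs by simp
  let ?S = "\<Sum>k<N. b k"
  have S: "0 \<le> ?S" by (intro sum_nonneg b)
  \<comment> \<open>The energy of the central density tends to 0 with its bandwidth
    \<open>a\<close>, so it fits into the gap between \<kappa> \<eta> K and pi L.\<close>
  have "((\<lambda>a. 2 * a * exp (2 * \<alpha> * a powr r)) \<longlongrightarrow> 0) (at_right 0)"
    using \<alpha> r by real_asymp
  then have "eventually (\<lambda>a. 2 * a * exp (2 * \<alpha> * a powr r) < 2 * pi * L - 2 * \<kappa> * \<eta> * K) (at_right 0)"
    using \<kappa>K by (intro order_tendstoD(2)) auto
  from eventually_happens'[OF trivial_limit_at_right_real eventually_conj[OF eventually_at_right_less this]]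
  obtain a where a: "0 < a" "2 * a * exp (2 * \<alpha> * a powr r) < 2 * pi * L - 2 * \<kappa> * \<eta> * K" by blast
  define c0 where "c0 = a / (2 * pi * (a\<^sup>2 + pi\<^sup>2))"
  have c0: "0 < c0" "\<And>t. c0 / (1 + t\<^sup>2) \<le> base a t"
    using a base_lower[OF a(1)] by (auto simp: c0_def add_pos_nonneg)
  have base0: "0 \<le> base a t" for t
  proof -
    have "0 \<le> c0 / (1 + t\<^sup>2)" using c0(1) by simp
    then show ?thesis using c0(2)[of t] by linarith
  qed
  have d0: "is_density (base a)"
    by (rule is_density_fourier_pair[OF fourier_pair_base[OF a(1)]]) (auto simp: base0 tent_simps)
  obtain c1 where c1: "0 < c1" "\<And>y. c1 / (1 + y\<^sup>2) \<le> (\<integral>x. base a (y - x) * fe x \<partial>lborel)"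
    using convolve_lower_bound[OF fe d0 base_le[OF a(1)] c0] by blast
  obtain C p V0 where C: "0 < C" and p: "0 \<le> p" and V0: "1 \<le> V0"
    and noise: "\<And>V R u. V0 \<le> V \<Longrightarrow> V \<le> \<bar>u\<bar> \<Longrightarrow> \<bar>u\<bar> \<le> R \<Longrightarrow> cmod (Phi fe u) \<le> C * R powr p * exp (- \<beta> * V powr s)"
    "\<And>V R u v. V0 \<le> V \<Longrightarrow> V \<le> \<bar>u\<bar> \<Longrightarrow> \<bar>u\<bar> \<le> R \<Longrightarrow> V \<le> \<bar>v\<bar> \<Longrightarrow> \<bar>v\<bar> \<le> R \<Longrightarrow> 0 < u * v \<Longrightarrow>
        cmod (Phi fe u - Phi fe v) \<le> C * R powr p * exp (- \<beta> * V powr s) * \<bar>u - v\<bar>"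
    by (rule noise_bounds[OF s0 \<beta> ND N_right]) blast
  let ?U = "freq \<alpha> \<beta> r s"
  have lim: "filterlim ?U at_top sequentially" by (rule filterlim_freq[OF \<alpha> \<beta> r s0])
  have "eventually (\<lambda>U. 2 * amp \<kappa> \<alpha> r U * ?S * (width \<eta> r U + 1 / width \<eta> r U) \<le> c0) at_top"
    using \<alpha> r rs s \<eta> \<kappa> c0 S by (intro eventually_pert_small) auto
  moreover have "eventually (\<lambda>U. (\<integral>\<^sup>+u. ennreal ((pert_hat N b (amp \<kappa> \<alpha> r U) U (width \<eta> r U) u)\<^sup>2 * exp (2 * \<alpha> * \<bar>u\<bar> powr r)) \<partial>lborel)
      \<le> ennreal (2 * pi * L - 2 * a * exp (2 * \<alpha> * a powr r))) at_top"
    using a by (intro eventually_class_bound[OF \<alpha> r \<eta> \<kappa> b K]) auto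
  ultimately have "eventually (\<lambda>U. 1 \<le> U \<and> a \<le> U \<and> V0 \<le> U \<and>
      2 * amp \<kappa> \<alpha> r U * ?S * (width \<eta> r U + 1 / width \<eta> r U) \<le> c0 \<and>
      (\<integral>\<^sup>+u. ennreal ((pert_hat N b (amp \<kappa> \<alpha> r U) U (width \<eta> r U) u)\<^sup>2 * exp (2 * \<alpha> * \<bar>u\<bar> powr r)) \<partial>lborel)
      \<le> ennreal (2 * pi * L - 2 * a * exp (2 * \<alpha> * a powr r))) at_top"
    using eventually_ge_at_top[of 1] eventually_ge_at_top[of a] eventually_ge_at_top[of V0] by eventually_elim auto
  from eventually_compose_filterlim[OF this lim] eventually_chi_bound[OF \<alpha> \<beta> r rs s \<eta> \<kappa> S C p c1(1) \<tau>, of N]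
  show ?thesis
  proof eventually_elim
    case (elim n)
    define U where "U = ?U n"
    define d where "d = width \<eta> r U"
    define A where "A = amp \<kappa> \<alpha> r U"
    define R where "R = U + (real N + 2) * d"
    define Q where "Q = C * R powr p * exp (- \<beta> * (U + d) powr s)"
    have U: "1 \<le> U" "a \<le> U" "V0 \<le> U" "2 * A * ?S * (d + 1 / d) \<le> c0"
      and cls: "(\<integral>\<^sup>+u. ennreal ((pert_hat N b A U d u)\<^sup>2 * exp (2 * \<alpha> * \<bar>u\<bar> powr r)) \<partial>lborel)
      \<le> ennreal (2 * pi * L - 2 * a * exp (2 * \<alpha> * a powr r))"
      using elim(1) unfolding U_def d_def A_def by auto
    have chi: "(1 + 8 / pi * (U + (real N + 2) * d + 1) * (A * ?S * Q * (1 + 1 / d))\<^sup>2 / c1) ^ n \<le> 1 + \<tau>\<^sup>2"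
      using elim(2) unfolding U_def d_def A_def Q_def R_def Let_def by simp
    have d: "0 < d" using U \<eta> by (simp add: d_def width_def)
    have A: "0 \<le> A" using \<kappa> U by (simp add: A_def amp_def)
    have Q: "0 \<le> Q" using C by (simp add: Q_def)
    have aL: "2 * a * exp (2 * \<alpha> * a powr r) \<le> 2 * pi * L"
    proof -
      have "0 \<le> 2 * \<kappa> * \<eta> * K" using \<kappa> \<eta> K(2) by simp
      then show ?thesis using a by linarith
    qed
    have q1: "cmod (Phi fe u) \<le> Q" if "U + d \<le> \<bar>u\<bar>" "\<bar>u\<bar> \<le> U + (real N + 2) * d" for u
      unfolding Q_def using that U d by (intro noise) (auto simp: R_def)
    have q2: "cmod (Phi fe u - Phi fe v) \<le> Q * \<bar>u - v\<bar>"
      if "U + d \<le> \<bar>u\<bar>" "\<bar>u\<bar> \<le> U + (real N + 2) * d" "U + d \<le> \<bar>v\<bar>" "\<bar>v\<bar> \<le> U + (real N + 2) * d" "0 < u * v" for u v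
      unfolding Q_def using that U d by (intro noise) (auto simp: R_def)
    note risk = risk_lower_bounds[OF \<alpha> r b A U(1) d fe a(1) U(2) c0(2) U(4) c1 aL cls Q q1 q2 chi \<tau>]
    have U0: "0 < ?U n" using U by (simp add: U_def)
    note phi = phi2_freq[OF U0, of L, folded U_def]
    have A2: "A\<^sup>2 = \<kappa> * U powr (r - 1) * exp (- 2 * \<alpha> * U powr r)"
      unfolding A_def using \<kappa> U by (intro amp_square) auto
    have up: "U powr (r - 1) * U powr (1 - r) = 1" using U by (simp add: powr_add[symmetric])
    \<comment> \<open>Squared amplitude times squared width contributes U^(r - 1) U^(2 - 2 r) = U^(1
      - r), the power in \<open>phi2\<close>. In \<open>v2\<close> the width enters only once and
      the powers of \<open>U\<close> cancel.\<close>
    have v1: "(pert N b A U d 0)\<^sup>2 = \<kappa> * \<eta>\<^sup>2 * ?S\<^sup>2 * (2 * \<alpha> * r) / (pi * L) * phi2 \<alpha> \<beta> r s L n"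
    proof -
      have "(pert N b A U d 0)\<^sup>2 = A\<^sup>2 * d\<^sup>2 / pi\<^sup>2 * ?S\<^sup>2"
        unfolding pert_0[OF b A U(1) d] by (simp add: power_mult_distrib power_divide)
      also have "\<dots> = \<kappa> * \<eta>\<^sup>2 * ?S\<^sup>2 / pi\<^sup>2 * ((U powr (r - 1) * U powr (1 - r)) * U powr (1 - r) * exp (- 2 * \<alpha> * U powr r))"
        unfolding A2 d_def width_def by (simp add: power2_eq_square)
      also have "\<dots> = \<kappa> * \<eta>\<^sup>2 * ?S\<^sup>2 / pi\<^sup>2 * (U powr (1 - r) * exp (- 2 * \<alpha> * U powr r))"
        unfolding up by simp
      also have "\<dots> = \<kappa> * \<eta>\<^sup>2 * ?S\<^sup>2 * (2 * \<alpha> * r) / (pi * L) * phi2 \<alpha> \<beta> r s L n"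
        unfolding phi using \<alpha> r L by (simp add: field_simps power2_eq_square)
      finally show ?thesis .
    qed
    have v2: "(\<integral>\<^sup>+t. ennreal ((pert N b A U d t)\<^sup>2) \<partial>lborel) = ennreal (\<kappa> * \<eta> / (pi * L) * phi2_L2 \<alpha> \<beta> r s L n) * (\<integral>\<^sup>+w. ennreal ((prof N b w)\<^sup>2) \<partial>lborel)"
    proof -
      note P = fourier_pair_plancherel[OF fourier_pair_pert[OF d, of N b A U], simplified]
      have "(\<integral>\<^sup>+t. ennreal ((pert N b A U d t)\<^sup>2) \<partial>lborel) = ennreal (1 / (2 * pi) * (\<integral>u. (pert_hat N b A U d u)\<^sup>2 \<partial>lborel))"
        using P by (subst nn_integral_eq_integral) auto
      also have "\<dots> = ennreal (1 / (2 * pi)) * (\<integral>\<^sup>+u. ennreal ((pert_hat N b A U d u)\<^sup>2) \<partial>lborel)"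
        using P by (subst nn_integral_eq_integral) (auto simp: ennreal_mult'[symmetric])
      also have "(\<integral>\<^sup>+u. ennreal ((pert_hat N b A U d u)\<^sup>2) \<partial>lborel) = ennreal (2 * A\<^sup>2 * d) * (\<integral>\<^sup>+w. ennreal ((prof N b w)\<^sup>2) \<partial>lborel)"
        using nn_integral_pert_hat[OF b A U(1) d, of "\<lambda>_. 1" N] by simp
      also have "ennreal (1 / (2 * pi)) * (ennreal (2 * A\<^sup>2 * d) * (\<integral>\<^sup>+w. ennreal ((prof N b w)\<^sup>2) \<partial>lborel))
          = ennreal (1 / (2 * pi) * (2 * A\<^sup>2 * d)) * (\<integral>\<^sup>+w. ennreal ((prof N b w)\<^sup>2) \<partial>lborel)"
      proof -
        have "ennreal (1 / (2 * pi) * (2 * A\<^sup>2 * d)) = ennreal (1 / (2 * pi)) * ennreal (2 * A\<^sup>2 * d)"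
          using d by (intro ennreal_mult) auto
        then show ?thesis by (simp only: mult.assoc)
      qed
      also have "1 / (2 * pi) * (2 * A\<^sup>2 * d) = \<kappa> * \<eta> / pi * ((U powr (r - 1) * U powr (1 - r)) * exp (- 2 * \<alpha> * U powr r))"
        by (simp add: A2 d_def width_def)
      also have "\<dots> = \<kappa> * \<eta> / (pi * L) * phi2_L2 \<alpha> \<beta> r s L n"
        unfolding up phi using L by simp
      finally show ?thesis .
    qed
    have "0 < phi2 \<alpha> \<beta> r s L n" "0 < phi2_L2 \<alpha> \<beta> r s L n"
      unfolding phi using U \<alpha> r L by (auto intro!: mult_pos_pos divide_pos_pos)
    then show ?case using risk unfolding v1 v2 by blast
  qed
qed

section \<open>Choice of the profile\<close>

text \<open>Each tent is the difference of two consecutive unit ramps \<open>clamp\<close>, so the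
  sum telescopes.\<close>

lemma sum_tent_le_1: "(\<Sum>k<N. tent (w - real (k + 2))) \<le> 1"
proof -
  define clamp where "clamp x = max 0 (min 1 x)" for x :: real
  have "tent (w - real (k + 2)) = clamp (w - 1 - real k) - clamp (w - 1 - real (Suc k))" for k
    unfolding tent_def clamp_def by (auto simp: max_def min_def abs_if)
  then have "(\<Sum>k<N. tent (w - real (k + 2))) = clamp (w - 1 - real 0) - clamp (w - 1 - real N)"
    using sum_lessThan_telescope'[of "\<lambda>k. clamp (w - 1 - real k)" N] by simp
  also have "\<dots> \<le> 1" by (auto simp: clamp_def)
  finally show ?thesis .
qed

text \<open>The tents form a partition of unity, and each is supported within distance 1 of its node.\<close>

lemma prof_exp_le:
  assumes "0 \<le> \<theta>"
  shows "prof N (\<lambda>k. exp (- \<theta> * real k)) w * exp (\<theta> * w) \<le> exp (3 * \<theta>)"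
proof -
  have "prof N (\<lambda>k. exp (- \<theta> * real k)) w \<le> (\<Sum>k<N. exp (- \<theta> * (w - 3)) * tent (w - real (k + 2)))"
    unfolding prof_def
  proof (intro sum_mono)
    fix k
    show "exp (- \<theta> * real k) * tent (w - real (k + 2)) \<le> exp (- \<theta> * (w - 3)) * tent (w - real (k + 2))"
    proof (cases "1 \<le> \<bar>w - real (k + 2)\<bar>")
      case False
      \<comment> \<open>The tent at node k + 2 is nonzero only for w < k + 3; this is the origin of
        the constant 3.\<close>
      then have "w - 3 \<le> real k" by auto
      then have "- \<theta> * real k \<le> - \<theta> * (w - 3)" using assms by (simp add: mult_left_mono)
      then show ?thesis by (intro mult_right_mono) (auto simp: tent_simps)
    qed (simp add: tent_eq_0)
  qed
  also have "\<dots> = exp (- \<theta> * (w - 3)) * (\<Sum>k<N. tent (w - real (k + 2)))"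
    by (simp add: sum_distrib_left)
  also have "\<dots> \<le> exp (- \<theta> * (w - 3)) * 1"
    by (intro mult_left_mono sum_tent_le_1) auto
  finally have "prof N (\<lambda>k. exp (- \<theta> * real k)) w * exp (\<theta> * w) \<le> exp (- \<theta> * (w - 3)) * exp (\<theta> * w)"
    by (intro mult_right_mono) auto
  also have "\<dots> = exp (3 * \<theta>)" by (simp add: exp_add[symmetric] algebra_simps)
  finally show ?thesis .
qed

lemma nn_integral_tent: "(\<integral>\<^sup>+w. ennreal (tent (w - c)) \<partial>lborel) = 1"
proof -
  have "(\<integral>\<^sup>+w. ennreal (tent (w - c)) \<partial>lborel) = (\<integral>\<^sup>+w. ennreal (tent w) \<partial>lborel)"
    by (subst nn_integral_real_affine[where c = 1 and t = c]) auto
  also have "\<dots> = ennreal (\<integral>w. tent w \<partial>lborel)"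
    using has_integral_tent_cos[of 0] by (intro nn_integral_eq_integral) (auto simp: has_bochner_integral_iff tent_simps)
  also have "(\<integral>w. tent w \<partial>lborel) = 1"
    using has_integral_tent_cos[of 0] by (auto simp: has_bochner_integral_iff fejer_def)
  finally show ?thesis by simp
qed

lemma nn_integral_prof:
  assumes "\<And>k. 0 \<le> b k"
  shows "(\<integral>\<^sup>+w. ennreal (prof N b w) \<partial>lborel) = ennreal (\<Sum>k<N. b k)"
proof -
  have "(\<integral>\<^sup>+w. ennreal (prof N b w) \<partial>lborel) = (\<integral>\<^sup>+w. (\<Sum>k<N. ennreal (b k) * ennreal (tent (w - real (k + 2)))) \<partial>lborel)"
    unfolding prof_def using assms
    by (intro nn_integral_cong) (simp add: sum_ennreal[symmetric] tent_simps ennreal_mult')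
  also have "\<dots> = (\<Sum>k<N. ennreal (b k) * (\<integral>\<^sup>+w. ennreal (tent (w - real (k + 2))) \<partial>lborel))"
    by (subst nn_integral_sum) (auto simp: nn_integral_cmult)
  also have "\<dots> = ennreal (\<Sum>k<N. b k)"
    unfolding nn_integral_tent using assms by (simp add: sum_ennreal)
  finally show ?thesis .
qed

lemma one_le_Liminf_ennreal:
  fixes X :: "'a \<Rightarrow> ennreal"
  assumes "\<And>v. 0 < v \<Longrightarrow> v < 1 \<Longrightarrow> eventually (\<lambda>n. ennreal v \<le> X n) F"
  shows "1 \<le> Liminf F X"
proof -
  have "(\<lambda>m. ennreal (1 - 1 / real (m + 2))) \<longlonglongrightarrow> ennreal 1"
    by (intro tendsto_ennrealI) real_asymp
  moreover have "ennreal (1 - 1 / real (m + 2)) \<le> Liminf F X" for m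
    by (intro Liminf_bounded assms) (auto simp: field_simps)
  ultimately show ?thesis
    by (intro LIMSEQ_le_const2[of "\<lambda>m. ennreal (1 - 1 / real (m + 2))"]) auto
qed

lemma le_INF_mult_inverse:
  fixes R :: "'a \<Rightarrow> ennreal"
  assumes "0 < \<phi>" "0 \<le> v" "\<And>T. T \<in> E \<Longrightarrow> ennreal (v * \<phi>) \<le> R T"
  shows "ennreal v \<le> (INF T\<in>E. R T) * ennreal (1 / \<phi>)"
proof -
  have "ennreal v = ennreal (v * \<phi>) * ennreal (1 / \<phi>)"
    using assms by (subst ennreal_mult[symmetric]) auto
  also have "\<dots> \<le> (INF T\<in>E. R T) * ennreal (1 / \<phi>)"
    using assms by (intro mult_right_mono INF_greatest) auto
  finally show ?thesis .
qed

theorem theorem4: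
  fixes \<alpha> L r s \<beta> :: real and fe :: "real \<Rightarrow> real"
  assumes "\<alpha> > 0" and "L > 0" and "0 < r" and "r < s" and "s \<le> 2" and "\<beta> > 0"
    and fe_dens: "is_density fe"
    and ND: "\<exists>u1 B \<gamma>1 D1 D2. u1 > 0 \<and> B > 0 \<and>
        (\<forall>u. u1 \<le> \<bar>u\<bar> \<longrightarrow>
            (Phi fe has_vector_derivative D1 u) (at u within {v. u1 \<le> \<bar>v\<bar>}) \<and>
            (D1 has_vector_derivative D2 u) (at u within {v. u1 \<le> \<bar>v\<bar>}) \<and>
            max (cmod (D1 u)) (cmod (D2 u)) \<le> B * \<bar>u\<bar> powr \<gamma>1 * exp (- \<beta> * \<bar>u\<bar> powr s)) \<and>
        continuous_on {v. u1 \<le> \<bar>v\<bar>} D2"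
    and N_right: "\<exists>u0 bmax \<gamma>'. u0 > 0 \<and> bmax > 0 \<and>
        (\<forall>u. u0 \<le> \<bar>u\<bar> \<longrightarrow> cmod (Phi fe u) \<le> bmax * \<bar>u\<bar> powr \<gamma>' * exp (- \<beta> * \<bar>u\<bar> powr s))"
  shows "(\<forall>x::real. liminf (\<lambda>n. (INF T\<in>pt_estimators n. risk_pt n fe x T (A_class \<alpha> r L))
              * ennreal (1 / phi2 \<alpha> \<beta> r s L n)) \<ge> 1)
       \<and> liminf (\<lambda>n. (INF T\<in>fun_estimators n. risk_L2 n fe T (A_class \<alpha> r L))
              * ennreal (1 / phi2_L2 \<alpha> \<beta> r s L n)) \<ge> 1"
proof -
  define c where "c = 2 * \<alpha> * r"
  have c: "0 < c" using assms by (simp add: c_def)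
  note core = eventually_risk_lower[OF assms(1-6) fe_dens ND N_right]
  have "eventually (\<lambda>n. ennreal v \<le> (INF T\<in>pt_estimators n. risk_pt n fe x T (A_class \<alpha> r L)) * ennreal (1 / phi2 \<alpha> \<beta> r s L n)) sequentially"
    if v: "0 < v" "v < 1" for v x
  proof -
    \<comment> \<open>One factor per loss: 1 - 1 / m for the energy left to the central density, exp
      (- 3 c / m) for the discretisation of the profile, 1 - exp (- c m) for its truncation, 1 - 2 /
      m for the overlap of the samples with \<tau> = 1 / m.\<close>
    have "(\<lambda>m::nat. (1 - 1 / real m) * exp (- (3 * c / real m)) * (1 - exp (- (c * real m))) * (1 - 2 / real m)) \<longlonglongrightarrow> 1"
      using c by real_asymp
    then have "eventually (\<lambda>m. v < (1 - 1 / real m) * exp (- (3 * c / real m)) * (1 - exp (- (c * real m))) * (1 - 2 / real m)) sequentially"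
      using v by (intro order_tendstoD(1)) auto
    from eventually_happens'[OF trivial_limit_sequentially eventually_conj[OF this eventually_gt_at_top[of 2]]]
    obtain m :: nat where m: "v < (1 - 1 / real m) * exp (- (3 * c / real m)) * (1 - exp (- (c * real m))) * (1 - 2 / real m)" "2 < m"
      by blast
    \<comment> \<open>In units of the width the class weight grows like exp (\<theta> w) with
      \<theta> = c \<eta>, so the extremal profile decays like exp (- \<theta> w). With m * m nodes
      it reaches \<theta> N = c m, which tends to infinity while the step \<theta> tends to
      0.\<close>
    define \<eta> \<theta> N where "\<eta> = 1 / real m" and "\<theta> = c / real m" and "N = m * m"
    define b where "b k = exp (- \<theta> * real k)" for k :: nat
    define S where "S = (\<Sum>k<N. b k)"
    have \<theta>: "0 < \<theta>" using c m by (simp add: \<theta>_def)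
    have \<eta>: "0 < \<eta>" using m by (simp add: \<eta>_def)
    have b: "0 \<le> b k" for k by (simp add: b_def)
    note [measurable] = measurable_prof[OF b, of N]
    have S: "(1 - exp (- (c * real m))) / \<theta> \<le> S" "0 < S"
    proof -
      have "S = (\<Sum>k<N. exp (- \<theta>) ^ k)"
        by (simp add: S_def b_def exp_of_nat_mult[symmetric] mult.commute)
      also have "\<dots> = (1 - exp (- \<theta>) ^ N) / (1 - exp (- \<theta>))"
        using \<theta> by (subst geometric_sum) (auto simp: field_simps)
      also have "exp (- \<theta>) ^ N = exp (- (c * real m))"
        using m by (simp add: exp_of_nat_mult[symmetric] N_def \<theta>_def)
      finally have S: "S = (1 - exp (- (c * real m))) / (1 - exp (- \<theta>))" .
      have e: "0 < 1 - exp (- (c * real m))" "0 < 1 - exp (- \<theta>)" using c m \<theta> by auto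
      then show "0 < S" by (simp add: S)
      have "1 - exp (- \<theta>) \<le> \<theta>" using exp_ge_add_one_self[of "- \<theta>"] by simp
      then show "(1 - exp (- (c * real m))) / \<theta> \<le> S"
        unfolding S using e \<theta> by (intro divide_left_mono) auto
    qed
    \<comment> \<open>One factor of the squared profile absorbs the weight up to exp (3 \<theta>);
      the other integrates to \<open>S\<close>. Hence S^2 / K is S exp (- 3 \<theta>), and \<theta>
      S is nearly 1 by the geometric sum.\<close>
    define K where "K = exp (3 * \<theta>) * S"
    have K0: "0 < K" using S by (simp add: K_def)
    have K: "(\<integral>\<^sup>+w. ennreal ((prof N b w)\<^sup>2 * exp (2 * \<alpha> * r * \<eta> * w)) \<partial>lborel) \<le> ennreal K"
    proof -
      have "(\<integral>\<^sup>+w. ennreal ((prof N b w)\<^sup>2 * exp (2 * \<alpha> * r * \<eta> * w)) \<partial>lborel) \<le> (\<integral>\<^sup>+w. ennreal (exp (3 * \<theta>)) * ennreal (prof N b w) \<partial>lborel)"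
      proof (intro nn_integral_mono)
        fix w
        have "prof N b w * (prof N b w * exp (\<theta> * w)) \<le> prof N b w * exp (3 * \<theta>)"
          using prof_exp_le[of \<theta> N w] \<theta> by (intro mult_left_mono prof_nonneg[OF b]) (auto simp: b_def[abs_def])
        then have "(prof N b w)\<^sup>2 * exp (2 * \<alpha> * r * \<eta> * w) \<le> exp (3 * \<theta>) * prof N b w"
          by (simp add: power2_eq_square \<theta>_def \<eta>_def c_def mult.assoc mult.commute)
        then show "ennreal ((prof N b w)\<^sup>2 * exp (2 * \<alpha> * r * \<eta> * w)) \<le> ennreal (exp (3 * \<theta>)) * ennreal (prof N b w)"
          by (subst ennreal_mult'[symmetric]) (auto intro!: ennreal_leI)
      qed
      also have "\<dots> = ennreal (exp (3 * \<theta>)) * ennreal S"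
        by (subst nn_integral_cmult) (auto simp: nn_integral_prof[OF b] S_def)
      also have "\<dots> = ennreal K" by (simp add: K_def ennreal_mult')
      finally show ?thesis .
    qed
    \<comment> \<open>Exhausts the energy constraint up to the share 1 / m reserved for the central
      density.\<close>
    define \<kappa> where "\<kappa> = (1 - 1 / real m) * (pi * L) / (\<eta> * K)"
    have m1: "0 < 1 - 1 / real m" "0 < 1 - 2 / real m" "0 < 1 / real m" using m by auto
    have \<kappa>: "0 < \<kappa>" using m1 \<eta> K0 assms by (simp add: \<kappa>_def)
    have "\<kappa> * \<eta> * K = (1 - 1 / real m) * (pi * L)" using \<eta> K0 by (simp add: \<kappa>_def)
    also have "\<dots> < 1 * (pi * L)" using m assms by (intro mult_strict_right_mono) auto
    finally have \<kappa>K: "\<kappa> * \<eta> * K < pi * L" by simp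
    have val: "\<kappa> * \<eta>\<^sup>2 * S\<^sup>2 * (2 * \<alpha> * r) / (pi * L) = (1 - 1 / real m) * exp (- (3 * c / real m)) * (\<theta> * S)"
    proof -
      have "\<kappa> * \<eta>\<^sup>2 * S\<^sup>2 * c / (pi * L) = (1 - 1 / real m) * (\<eta> * c * S * exp (- (3 * \<theta>)))"
        using \<eta> S assms by (simp add: \<kappa>_def K_def power2_eq_square exp_minus field_simps)
      then show ?thesis by (simp add: \<theta>_def \<eta>_def c_def mult_ac)
    qed
    have "v \<le> (1 - 1 / real m) * exp (- (3 * c / real m)) * (1 - exp (- (c * real m))) * (1 - 2 / real m)" using m by simp
    also have "\<dots> \<le> (1 - 1 / real m) * exp (- (3 * c / real m)) * (\<theta> * S) * (1 - 2 / real m)"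
      using S(1) \<theta> m1 by (intro mult_right_mono mult_left_mono) (auto simp: field_simps)
    finally have v_le: "v \<le> \<kappa> * \<eta>\<^sup>2 * S\<^sup>2 * (2 * \<alpha> * r) / (pi * L) * (1 - 2 * (1 / real m))"
      unfolding val by simp
    show ?thesis
      using core[OF b \<eta> \<kappa> m1(3) K less_imp_le[OF K0] \<kappa>K]
    proof eventually_elim
      case (elim n)
      show ?case
      proof (intro le_INF_mult_inverse)
        show "0 < phi2 \<alpha> \<beta> r s L n" "0 \<le> v" using elim v by auto
        fix T assume T: "T \<in> pt_estimators n"
        have "v * phi2 \<alpha> \<beta> r s L n \<le> \<kappa> * \<eta>\<^sup>2 * S\<^sup>2 * (2 * \<alpha> * r) / (pi * L) * (1 - 2 * (1 / real m)) * phi2 \<alpha> \<beta> r s L n"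
          using elim v_le by (intro mult_right_mono) auto
        then have "ennreal (v * phi2 \<alpha> \<beta> r s L n) \<le> ennreal ((\<kappa> * \<eta>\<^sup>2 * S\<^sup>2 * (2 * \<alpha> * r) / (pi * L) * phi2 \<alpha> \<beta> r s L n) * (1 - 2 * (1 / real m)))"
          by (intro ennreal_leI) (simp add: mult_ac)
        also have "\<dots> = ennreal (\<kappa> * \<eta>\<^sup>2 * S\<^sup>2 * (2 * \<alpha> * r) / (pi * L) * phi2 \<alpha> \<beta> r s L n) * ennreal (1 - 2 * (1 / real m))"
          using m1 by (intro ennreal_mult'') auto
        also have "\<dots> \<le> risk_pt n fe x T (A_class \<alpha> r L)"
          using elim T unfolding S_def by blast
        finally show "ennreal (v * phi2 \<alpha> \<beta> r s L n) \<le> risk_pt n fe x T (A_class \<alpha> r L)" .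
      qed
    qed
  qed
  moreover have "eventually (\<lambda>n. ennreal v \<le> (INF T\<in>fun_estimators n. risk_L2 n fe T (A_class \<alpha> r L)) * ennreal (1 / phi2_L2 \<alpha> \<beta> r s L n)) sequentially"
    if v: "0 < v" "v < 1" for v
  proof -
    have "(\<lambda>m::nat. (1 - 1 / real m) * exp (- (3 * c / real m)) * (1 - 2 / real m)) \<longlonglongrightarrow> 1"
      using c by real_asymp
    then have "eventually (\<lambda>m. v < (1 - 1 / real m) * exp (- (3 * c / real m)) * (1 - 2 / real m)) sequentially"
      using v by (intro order_tendstoD(1)) auto
    from eventually_happens'[OF trivial_limit_sequentially eventually_conj[OF this eventually_gt_at_top[of 2]]]
    obtain m :: nat where m: "v < (1 - 1 / real m) * exp (- (3 * c / real m)) * (1 - 2 / real m)" "2 < m"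
      by blast
    define \<eta> \<theta> where "\<eta> = 1 / real m" and "\<theta> = c / real m"
    \<comment> \<open>For the integrated error one tent is enough. On its support [1, 3] the weight
      exp (\<theta> w) tends to 1 as m grows, so weighted and unweighted energy agree in the limit
      and there is no truncation loss.\<close>
    define b where "b k = (1 :: real)" for k :: nat
    have \<theta>: "0 < \<theta>" using c m by (simp add: \<theta>_def)
    have \<eta>: "0 < \<eta>" using m by (simp add: \<eta>_def)
    have b: "0 \<le> b k" for k by (simp add: b_def)
    have P: "prof 1 b w = tent (w - 2)" for w by (simp add: prof_def b_def)
    define J where "J = (\<integral>w. (tent w)\<^sup>2 \<partial>lborel)"
    have iJ: "integrable lborel (\<lambda>w. (tent w)\<^sup>2)"
      using fourier_pair_plancherel(2)[OF fourier_pair_fejer] by simp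
    have nJ: "(\<integral>\<^sup>+w. ennreal ((prof 1 b w)\<^sup>2) \<partial>lborel) = ennreal J"
      unfolding P J_def using iJ
      by (subst nn_integral_real_affine[where c = 1 and t = 2]) (auto intro!: nn_integral_eq_integral)
    have J: "0 < J"
    proof -
      have "J \<noteq> 0"
      proof
        assume "J = 0"
        then have "AE w in lborel. (tent w)\<^sup>2 = 0"
          using integral_nonneg_eq_0_iff_AE[OF iJ] by (auto simp: J_def)
        then have "AE w in lborel. ennreal (tent (w - 0)) = 0" by eventually_elim simp
        then have "(\<integral>\<^sup>+w. ennreal (tent (w - 0)) \<partial>lborel) = (\<integral>\<^sup>+w. 0 \<partial>(lborel :: real measure))" by (rule nn_integral_cong_AE)
        then show False by (simp only: nn_integral_tent) simp
      qed
      moreover have "0 \<le> J" unfolding J_def by (intro integral_nonneg_AE) auto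
      ultimately show ?thesis by simp
    qed
    define K where "K = exp (3 * \<theta>) * J"
    have K0: "0 < K" using J by (simp add: K_def)
    have K: "(\<integral>\<^sup>+w. ennreal ((prof 1 b w)\<^sup>2 * exp (2 * \<alpha> * r * \<eta> * w)) \<partial>lborel) \<le> ennreal K"
    proof -
      have "(\<integral>\<^sup>+w. ennreal ((prof 1 b w)\<^sup>2 * exp (2 * \<alpha> * r * \<eta> * w)) \<partial>lborel) \<le> (\<integral>\<^sup>+w. ennreal (exp (3 * \<theta>)) * ennreal ((prof 1 b w)\<^sup>2) \<partial>lborel)"
      proof (intro nn_integral_mono)
        fix w
        have "(prof 1 b w)\<^sup>2 * exp (2 * \<alpha> * r * \<eta> * w) \<le> (prof 1 b w)\<^sup>2 * exp (3 * \<theta>)"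
        proof (cases "w \<le> 3")
          case True
          then have "\<theta> * w \<le> \<theta> * 3" using \<theta> by (intro mult_left_mono) auto
          then have "2 * \<alpha> * r * \<eta> * w \<le> 3 * \<theta>"
            by (simp add: \<theta>_def \<eta>_def c_def mult_ac)
          then show ?thesis by (intro mult_left_mono) auto
        next
          case False
          then show ?thesis unfolding P by (simp add: tent_eq_0)
        qed
        then show "ennreal ((prof 1 b w)\<^sup>2 * exp (2 * \<alpha> * r * \<eta> * w)) \<le> ennreal (exp (3 * \<theta>)) * ennreal ((prof 1 b w)\<^sup>2)"
          by (subst ennreal_mult'[symmetric]) (auto intro!: ennreal_leI simp: mult.commute)
      qed
      also have "\<dots> = ennreal (exp (3 * \<theta>)) * (\<integral>\<^sup>+w. ennreal ((prof 1 b w)\<^sup>2) \<partial>lborel)"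
        unfolding P by (rule nn_integral_cmult) measurable
      also have "\<dots> = ennreal K" unfolding nJ by (simp add: K_def ennreal_mult')
      finally show ?thesis .
    qed
    define \<kappa> where "\<kappa> = (1 - 1 / real m) * (pi * L) / (\<eta> * K)"
    have m1: "0 < 1 - 1 / real m" "0 < 1 - 2 / real m" "0 < 1 / real m" using m by auto
    have \<kappa>: "0 < \<kappa>" using m1 \<eta> K0 assms by (simp add: \<kappa>_def)
    have "\<kappa> * \<eta> * K = (1 - 1 / real m) * (pi * L)" using \<eta> K0 by (simp add: \<kappa>_def)
    also have "\<dots> < 1 * (pi * L)" using m assms by (intro mult_strict_right_mono) auto
    finally have \<kappa>K: "\<kappa> * \<eta> * K < pi * L" by simp
    have val: "\<kappa> * \<eta> / (pi * L) * J = (1 - 1 / real m) * exp (- (3 * c / real m))"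
      using \<eta> J assms by (simp add: \<kappa>_def K_def exp_minus field_simps \<theta>_def)
    show ?thesis
      using core[OF b \<eta> \<kappa> m1(3) K less_imp_le[OF K0] \<kappa>K]
    proof eventually_elim
      case (elim n)
      show ?case
      proof (intro le_INF_mult_inverse)
        show phi: "0 < phi2_L2 \<alpha> \<beta> r s L n" "0 \<le> v" using elim v by auto
        fix T assume T: "T \<in> fun_estimators n"
        have "v * phi2_L2 \<alpha> \<beta> r s L n \<le> \<kappa> * \<eta> / (pi * L) * J * (1 - 2 * (1 / real m)) * phi2_L2 \<alpha> \<beta> r s L n"
          using phi m unfolding val by (intro mult_right_mono) auto
        then have "ennreal (v * phi2_L2 \<alpha> \<beta> r s L n) \<le> ennreal ((\<kappa> * \<eta> / (pi * L) * phi2_L2 \<alpha> \<beta> r s L n) * J * (1 - 2 * (1 / real m)))"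
          by (intro ennreal_leI) (simp add: mult_ac)
        also have "\<dots> = ennreal (\<kappa> * \<eta> / (pi * L) * phi2_L2 \<alpha> \<beta> r s L n) * ennreal J * ennreal (1 - 2 * (1 / real m))"
        proof -
          have "0 \<le> 1 - 2 * (1 / real m)" using m1 by simp
          then show ?thesis using J by (simp only: ennreal_mult'' less_imp_le)
        qed
        also have "\<dots> \<le> risk_L2 n fe T (A_class \<alpha> r L)"
          using elim T unfolding nJ by blast
        finally show "ennreal (v * phi2_L2 \<alpha> \<beta> r s L n) \<le> risk_L2 n fe T (A_class \<alpha> r L)" .
      qed
    qed
  qed
  ultimately show ?thesis by (intro conjI allI one_le_Liminf_ennreal) blast+
qed

end
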